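(* Let $\Gamma=\langle a,b\rangle$ be the group of automorphisms of the binary rooted tree $\{1,2\}^*$ generated by the automorphisms $a,b$ defined recursively by $$(1w)^a=2\,w^b,\quad (2w)^a=1\,w,\quad (1w)^b=1\,w^a,\quad (2w)^b=2\,w\qquad (w\in\{1,2\}^* ).$$ Let $\sigma:\Gamma\to\Gamma$ be the endomorphism given by $a^\sigma=b$, $b^\sigma=a^2$, and let $\Delta=\langle \Gamma,t\mid a^t=b,\ b^t=a^2\rangle$ be the corresponding HNN extension. Then $\Gamma$ and $\Delta$ are amenable, but do not belong to the class $\mathsf{BG}$. Moreover $\Gamma$ is infinitely presented (it admits no finite presentation), and $\Delta$ has the balanced, finite presentation $$\Delta=\langle b,t\mid b^{t^2}b^{-2},\ [[[b,t^{-1}],b],b]\rangle .$$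
   Context: Tree automorphisms act on the right on words. Conventions: $x^y=y^{-1}xy$ and $[x,y]=x^{-1}y^{-1}xy$; so $b^{t^2}b^{-2}=t^{-2}bt^{2}b^{-2}$. In the presentation of $\Delta$ the generator $a$ of $\Gamma$ corresponds to $b^{t^{-1}}=tbt^{-1}$. A presentation is balanced if it has as many relators as generators. A finitely generated group $G=\langle S\rangle$ with growth function $\gamma(n)=\#\{g\in G: g\in S^n\}$ has subexponential growth if $\gamma\not\sim 2^n$, where $\gamma\precsim\delta$ means that there is $C\in\mathbb N$ with $\gamma(n)\le\delta(Cn)$ for all $n\in\mathbb N$, and $\gamma\sim\delta$ means $\gamma\precsim\delta$ and $\delta\precsim\gamma$. A group is locally of subexponential growth if all its finitely generated subgroups have subexponential growth. $\mathsf{BG}$ is the smallest class of groups containing all groups locally of subexponential growth and closed under taking subgroups, quotients, extensions and direct limits. *)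

theory Defs
  imports Complex_Main "HOL-Algebra.Generated_Groups"
begin

text \<open>Throughout, \<open>x\<^sup>y = y\<^sup>-\<^sup>1 x y\<close> and \<open>[x, y] = x\<^sup>-\<^sup>1 y\<^sup>-\<^sup>1 x y\<close>.\<close>

definition conj_by :: "('a, 'b) monoid_scheme \<Rightarrow> 'a \<Rightarrow> 'a \<Rightarrow> 'a" where
  "conj_by G x y = inv\<^bsub>G\<^esub> y \<otimes>\<^bsub>G\<^esub> x \<otimes>\<^bsub>G\<^esub> y"

definition commutator :: "('a, 'b) monoid_scheme \<Rightarrow> 'a \<Rightarrow> 'a \<Rightarrow> 'a" where
  "commutator G x y = inv\<^bsub>G\<^esub> x \<otimes>\<^bsub>G\<^esub> inv\<^bsub>G\<^esub> y \<otimes>\<^bsub>G\<^esub> x \<otimes>\<^bsub>G\<^esub> y"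


section \<open>Free groups and presentations\<close>

text \<open>The letter \<open>(x, True)\<close> stands for \<open>x\<close> and \<open>(x, False)\<close> for its inverse. Elements of the free
  group are the freely reduced words; the product \<open>u v\<close> prepends the letters of \<open>u\<close> to \<open>v\<close> one by
  one, cancelling where possible.\<close>

fun flip :: "'x \<times> bool \<Rightarrow> 'x \<times> bool" where
  "flip (x, e) = (x, \<not> e)"

fun push :: "'x \<times> bool \<Rightarrow> ('x \<times> bool) list \<Rightarrow> ('x \<times> bool) list" where
  "push l [] = [l]"
| "push l (m # w) = (if m = flip l then w else l # m # w)"

definition free_group :: "'x set \<Rightarrow> ('x \<times> bool) list monoid" where
  "free_group X =
    \<lparr>carrier = {w \<in> lists (X \<times> UNIV). successively (\<lambda>l m. m \<noteq> flip l) w},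
     mult = (\<lambda>u v. foldr push u v), one = []\<rparr>"

definition free_gen :: "'x \<Rightarrow> ('x \<times> bool) list" where
  "free_gen x = [(x, True)]"

definition normal_closure :: "('a, 'b) monoid_scheme \<Rightarrow> 'a set \<Rightarrow> 'a set" where
  "normal_closure G R = \<Inter> {N. N \<lhd> G \<and> R \<subseteq> N}"

text \<open>\<open>presented_group X R\<close> is \<open>\<langle>X | R\<rangle>\<close>, for \<open>R \<subseteq> carrier (free_group X)\<close>, and \<open>presented_gen X R x\<close> is
  the image of the generator \<open>x\<close> in it.\<close>

definition presented_group ::
    "'x set \<Rightarrow> ('x \<times> bool) list set \<Rightarrow> ('x \<times> bool) list set monoid" where
  "presented_group X R = free_group X Mod normal_closure (free_group X) R"

definition presented_gen ::
    "'x set \<Rightarrow> ('x \<times> bool) list set \<Rightarrow> 'x \<Rightarrow> ('x \<times> bool) list set" where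
  "presented_gen X R x = normal_closure (free_group X) R #>\<^bsub>free_group X\<^esub> free_gen x"

definition finite_presentation :: "'x set \<Rightarrow> ('x \<times> bool) list set \<Rightarrow> bool" where
  "finite_presentation X R \<longleftrightarrow> finite X \<and> finite R \<and> R \<subseteq> carrier (free_group X)"

definition balanced_presentation :: "'x set \<Rightarrow> ('x \<times> bool) list set \<Rightarrow> bool" where
  "balanced_presentation X R \<longleftrightarrow> card R = card X"

text \<open>A finite generating set can be taken to consist of natural numbers.\<close>

definition finitely_presented :: "('a, 'b) monoid_scheme \<Rightarrow> bool" where
  "finitely_presented G \<longleftrightarrow>
    (\<exists>(X :: nat set) R. finite_presentation X R \<and> presented_group X R \<cong> G)"


section \<open>Relative presentations and HNN extensions\<close>

text \<open>\<open>adjoin_letter G R\<close> is \<open>\<langle>G, t | R\<rangle>\<close>: the generators are the elements \<open>Some g\<close> of \<open>G\<close> together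
  with the letter \<open>t = None\<close>, and the relators are \<open>R\<close> together with the multiplication table of \<open>G\<close>.\<close>

definition letter_gens :: "('a, 'b) monoid_scheme \<Rightarrow> 'a option set" where
  "letter_gens G = insert None (Some ` carrier G)"

definition letter_free :: "('a, 'b) monoid_scheme \<Rightarrow> ('a option \<times> bool) list monoid" where
  "letter_free G = free_group (letter_gens G)"

definition mult_table :: "('a, 'b) monoid_scheme \<Rightarrow> ('a option \<times> bool) list set" where
  "mult_table G =
    {free_gen (Some g) \<otimes>\<^bsub>letter_free G\<^esub> free_gen (Some h)
       \<otimes>\<^bsub>letter_free G\<^esub> inv\<^bsub>letter_free G\<^esub> free_gen (Some (g \<otimes>\<^bsub>G\<^esub> h))
     | g h. g \<in> carrier G \<and> h \<in> carrier G}"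

definition adjoin_letter ::
    "('a, 'b) monoid_scheme \<Rightarrow> ('a option \<times> bool) list set \<Rightarrow> ('a option \<times> bool) list set monoid" where
  "adjoin_letter G R = presented_group (letter_gens G) (mult_table G \<union> R)"

definition adjoin_gen ::
    "('a, 'b) monoid_scheme \<Rightarrow> ('a option \<times> bool) list set \<Rightarrow> 'a option \<Rightarrow> ('a option \<times> bool) list set" where
  "adjoin_gen G R x = presented_gen (letter_gens G) (mult_table G \<union> R) x"

text \<open>The HNN extension \<open>\<langle>G, t | g\<^sup>t = \<phi> g for g \<in> A\<rangle>\<close> along an injective homomorphism \<open>\<phi>\<close> from a
  subgroup \<open>A\<close> of \<open>G\<close> to \<open>G\<close>.\<close>

definition hnn_extension ::
    "('a, 'b) monoid_scheme \<Rightarrow> 'a set \<Rightarrow> ('a \<Rightarrow> 'a) \<Rightarrow> ('a option \<times> bool) list set monoid" where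
  "hnn_extension G A \<phi> = adjoin_letter G
    {conj_by (letter_free G) (free_gen (Some g)) (free_gen None)
       \<otimes>\<^bsub>letter_free G\<^esub> inv\<^bsub>letter_free G\<^esub> free_gen (Some (\<phi> g)) | g. g \<in> A}"


section \<open>The groups \<open>\<Gamma>\<close> and \<open>\<Delta>\<close>\<close>

datatype digit = One | Two

text \<open>The vertices of the tree \<open>{1,2}\<^sup>*\<close> are the words, with root \<open>[]\<close>; the children of \<open>w\<close> are \<open>w1\<close>
  and \<open>w2\<close>. Automorphisms act on the right, so \<open>f \<otimes> g\<close> is \<open>f\<close> followed by \<open>g\<close>.\<close>

definition child :: "digit list \<Rightarrow> digit list \<Rightarrow> bool" where
  "child v w \<longleftrightarrow> (\<exists>x. w = v @ [x])"

definition tree_aut :: "(digit list \<Rightarrow> digit list) monoid" where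
  "tree_aut =
    \<lparr>carrier = {f. bij f \<and> f [] = [] \<and> (\<forall>v w. child (f v) (f w) \<longleftrightarrow> child v w)},
     mult = (\<lambda>f g. g \<circ> f), one = id\<rparr>"

fun aut_a :: "digit list \<Rightarrow> digit list" and aut_b :: "digit list \<Rightarrow> digit list" where
  "aut_a [] = []"
| "aut_a (One # w) = Two # aut_b w"
| "aut_a (Two # w) = One # w"
| "aut_b [] = []"
| "aut_b (One # w) = One # aut_a w"
| "aut_b (Two # w) = Two # w"

definition Gamma :: "(digit list \<Rightarrow> digit list) monoid" where
  "Gamma = subgroup_generated tree_aut {aut_a, aut_b}"

text \<open>The relators \<open>a\<^sup>t b\<^sup>-\<^sup>1\<close> and \<open>b\<^sup>t a\<^sup>-\<^sup>2\<close>.\<close>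

definition Delta_relators :: "((digit list \<Rightarrow> digit list) option \<times> bool) list set" where
  "Delta_relators =
    (let F = letter_free Gamma; a = free_gen (Some aut_a); b = free_gen (Some aut_b); t = free_gen None
     in {conj_by F a t \<otimes>\<^bsub>F\<^esub> inv\<^bsub>F\<^esub> b, conj_by F b t \<otimes>\<^bsub>F\<^esub> inv\<^bsub>F\<^esub> (a [^]\<^bsub>F\<^esub> (2::nat))})"

definition Delta :: "((digit list \<Rightarrow> digit list) option \<times> bool) list set monoid" where
  "Delta = adjoin_letter Gamma Delta_relators"

definition Delta_of_Gamma ::
    "(digit list \<Rightarrow> digit list) \<Rightarrow> ((digit list \<Rightarrow> digit list) option \<times> bool) list set" where
  "Delta_of_Gamma g = adjoin_gen Gamma Delta_relators (Some g)"

definition Delta_t :: "((digit list \<Rightarrow> digit list) option \<times> bool) list set" where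
  "Delta_t = adjoin_gen Gamma Delta_relators None"

datatype bt = Gen_b | Gen_t

text \<open>The relators \<open>t\<^sup>-\<^sup>2 b t\<^sup>2 b\<^sup>-\<^sup>2\<close>, the conjugate of \<open>b\<close> by \<open>t\<^sup>2\<close> times \<open>b\<^sup>-\<^sup>2\<close>, and \<open>[[[b, t\<^sup>-\<^sup>1], b], b]\<close>.\<close>

definition bt_relators :: "(bt \<times> bool) list set" where
  "bt_relators =
    (let F = free_group {Gen_b, Gen_t}; b = free_gen Gen_b; t = free_gen Gen_t
     in {conj_by F b (t [^]\<^bsub>F\<^esub> (2::nat)) \<otimes>\<^bsub>F\<^esub> inv\<^bsub>F\<^esub> (b [^]\<^bsub>F\<^esub> (2::nat)),
         commutator F (commutator F (commutator F b (inv\<^bsub>F\<^esub> t)) b) b})"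


section \<open>Amenability\<close>

text \<open>A group is amenable if it carries an invariant mean, that is, a finitely additive probability
  measure on all subsets which is invariant under right translation.\<close>

definition amenable :: "('a, 'b) monoid_scheme \<Rightarrow> bool" where
  "amenable G \<longleftrightarrow> group G \<and>
    (\<exists>\<mu> :: 'a set \<Rightarrow> real.
      (\<forall>A. A \<subseteq> carrier G \<longrightarrow> 0 \<le> \<mu> A) \<and>
      \<mu> (carrier G) = 1 \<and>
      (\<forall>A B. A \<subseteq> carrier G \<longrightarrow> B \<subseteq> carrier G \<longrightarrow> A \<inter> B = {} \<longrightarrow> \<mu> (A \<union> B) = \<mu> A + \<mu> B) \<and>
      (\<forall>A g. A \<subseteq> carrier G \<longrightarrow> g \<in> carrier G \<longrightarrow> \<mu> (A #>\<^bsub>G\<^esub> g) = \<mu> A))"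


section \<open>Growth\<close>

primrec set_pow :: "('a, 'b) monoid_scheme \<Rightarrow> 'a set \<Rightarrow> nat \<Rightarrow> 'a set" where
  "set_pow G S 0 = {\<one>\<^bsub>G\<^esub>}"
| "set_pow G S (Suc n) = set_pow G S n <#>\<^bsub>G\<^esub> S"

definition growth :: "('a, 'b) monoid_scheme \<Rightarrow> 'a set \<Rightarrow> nat \<Rightarrow> nat" where
  "growth G S n = card (set_pow G S n)"

definition growth_le :: "(nat \<Rightarrow> nat) \<Rightarrow> (nat \<Rightarrow> nat) \<Rightarrow> bool" where
  "growth_le \<gamma> \<delta> \<longleftrightarrow> (\<exists>C::nat. \<forall>n. \<gamma> n \<le> \<delta> (C * n))"

definition growth_equiv :: "(nat \<Rightarrow> nat) \<Rightarrow> (nat \<Rightarrow> nat) \<Rightarrow> bool" where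
  "growth_equiv \<gamma> \<delta> \<longleftrightarrow> growth_le \<gamma> \<delta> \<and> growth_le \<delta> \<gamma>"

text \<open>As usual for growth functions, the finite generating set \<open>S\<close> is taken symmetric and containing
  the identity, so that \<open>S\<^sup>n\<close> is the ball of radius \<open>n\<close>. Up to equivalence the growth function does
  not depend on the choice of \<open>S\<close>.\<close>

definition growth_generators :: "('a, 'b) monoid_scheme \<Rightarrow> 'a set \<Rightarrow> bool" where
  "growth_generators G S \<longleftrightarrow> finite S \<and> S \<subseteq> carrier G \<and> \<one>\<^bsub>G\<^esub> \<in> S \<and> (\<forall>s\<in>S. inv\<^bsub>G\<^esub> s \<in> S) \<and>
    generate G S = carrier G"

definition subexponential_growth :: "('a, 'b) monoid_scheme \<Rightarrow> bool" where
  "subexponential_growth G \<longleftrightarrow> group G \<and>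
    (\<exists>S. growth_generators G S \<and> \<not> growth_equiv (growth G S) (\<lambda>n. 2 ^ n))"

definition locally_subexponential :: "('a, 'b) monoid_scheme \<Rightarrow> bool" where
  "locally_subexponential G \<longleftrightarrow> group G \<and>
    (\<forall>S. finite S \<longrightarrow> S \<subseteq> carrier G \<longrightarrow> subexponential_growth (subgroup_generated G S))"


section \<open>Direct limits\<close>

definition directed_system ::
    "'i set \<Rightarrow> ('i \<times> 'i) set \<Rightarrow> ('i \<Rightarrow> 'a monoid) \<Rightarrow> ('i \<Rightarrow> 'i \<Rightarrow> 'a \<Rightarrow> 'a) \<Rightarrow> bool" where
  "directed_system I r \<G> f \<longleftrightarrow>
    I \<noteq> {} \<and> preorder_on I r \<and> (\<forall>i\<in>I. \<forall>j\<in>I. \<exists>k\<in>I. (i, k) \<in> r \<and> (j, k) \<in> r) \<and>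
    (\<forall>i\<in>I. group (\<G> i)) \<and>
    (\<forall>i\<in>I. \<forall>j\<in>I. (i, j) \<in> r \<longrightarrow> f i j \<in> hom (\<G> i) (\<G> j)) \<and>
    (\<forall>i\<in>I. \<forall>x\<in>carrier (\<G> i). f i i x = x) \<and>
    (\<forall>i\<in>I. \<forall>j\<in>I. \<forall>k\<in>I. \<forall>x\<in>carrier (\<G> i).
       (i, j) \<in> r \<longrightarrow> (j, k) \<in> r \<longrightarrow> f j k (f i j x) = f i k x)"

text \<open>The direct limit is the disjoint union of the \<open>\<G> i\<close> modulo eventual equality; two classes are
  multiplied by choosing representatives over a common index.\<close>

definition eventually_equal ::
    "'i set \<Rightarrow> ('i \<times> 'i) set \<Rightarrow> ('i \<Rightarrow> 'a monoid) \<Rightarrow> ('i \<Rightarrow> 'i \<Rightarrow> 'a \<Rightarrow> 'a) \<Rightarrow> (('i \<times> 'a) \<times> ('i \<times> 'a)) set" where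
  "eventually_equal I r \<G> f =
    {((i, x), (j, y)). i \<in> I \<and> j \<in> I \<and> x \<in> carrier (\<G> i) \<and> y \<in> carrier (\<G> j) \<and>
       (\<exists>k\<in>I. (i, k) \<in> r \<and> (j, k) \<in> r \<and> f i k x = f j k y)}"

definition direct_limit ::
    "'i set \<Rightarrow> ('i \<times> 'i) set \<Rightarrow> ('i \<Rightarrow> 'a monoid) \<Rightarrow> ('i \<Rightarrow> 'i \<Rightarrow> 'a \<Rightarrow> 'a) \<Rightarrow> ('i \<times> 'a) set monoid" where
  "direct_limit I r \<G> f =
    \<lparr>carrier = (SIGMA i:I. carrier (\<G> i)) // eventually_equal I r \<G> f,
     mult = (\<lambda>P Q. eventually_equal I r \<G> f ``
       {(i, x \<otimes>\<^bsub>\<G> i\<^esub> y) | i x y. (i, x) \<in> P \<and> (i, y) \<in> Q}),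
     one = eventually_equal I r \<G> f `` {(i, \<one>\<^bsub>\<G> i\<^esub>) | i. i \<in> I}\<rparr>"


section \<open>The class \<open>BG\<close>\<close>

text \<open>\<open>BG\<close> is the smallest such class among the groups whose elements, and direct limits whose
  indices, are drawn from the type \<open>'u\<close>. The type plays the role of a universe: a derivation that a
  group belongs to the class involves only a set of groups and of index sets, and so takes place over
  some (large enough) type. Belonging to the class means belonging to it over some \<open>'u\<close>; not belonging
  to it is therefore expressed by a theorem with \<open>'u\<close> as a free type variable. Closure under
  isomorphism is a special case of closure under quotients.\<close>

inductive BG :: "'u monoid \<Rightarrow> bool" where
  base: "locally_subexponential G \<Longrightarrow> BG G"
| subgroup: "BG G \<Longrightarrow> subgroup H G \<Longrightarrow> BG (G\<lparr>carrier := H\<rparr>)"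
| quotient: "BG G \<Longrightarrow> N \<lhd> G \<Longrightarrow> group Q \<Longrightarrow> G Mod N \<cong> Q \<Longrightarrow> BG Q"
| extension: "group G \<Longrightarrow> N \<lhd> G \<Longrightarrow> BG (G\<lparr>carrier := N\<rparr>) \<Longrightarrow> G Mod N \<cong> Q \<Longrightarrow> BG Q \<Longrightarrow> BG G"
| limit: "directed_system (I :: 'u set) r \<G> f \<Longrightarrow> (\<And>i. i \<in> I \<Longrightarrow> BG (\<G> i)) \<Longrightarrow>
    group L \<Longrightarrow> direct_limit I r \<G> f \<cong> L \<Longrightarrow> BG L"

definition in_BG :: "'u itself \<Rightarrow> ('a, 'b) monoid_scheme \<Rightarrow> bool" where
  "in_BG U G \<longleftrightarrow> (\<exists>H :: 'u monoid. G \<cong> H \<and> BG H)"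

end

(* An element of \<Gamma> is determined by its action on the first level and by its two
   sections, and both sections of a nontrivial reduced word representing 1 are shorter than the word.
   Since \<sigma> g has sections g and b^k, with k the exponent sum of b in g, induction on length shows that
   every relation of \<Gamma> follows from the relations \<sigma>^i [[a, b], b]; in \<Delta> these all follow from the
   one with i = 0. The depth at which the sections of a relation become freely trivial filters the
   relations by a strictly increasing chain of normal subgroups, so \<Gamma> is not finitely presented.

   A nontrivial normal subgroup of \<Gamma> contains elements with sections a and b at a common vertex, hence
   has \<Gamma> as a subquotient. Together with the exponential growth of \<Gamma> (the positive words are
   distinct) this shows by induction that no group in BG has \<Gamma> as a subquotient.

   For amenability, consider the lazy simple random walk. Watched at a vertex of the first level, its
   section is again a walk of this kind, but a definite fraction of the steps is lost. Hence the
   expected total length of the sections at level k after n steps is at most c_k n with c_k --> 0; as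
   there are only exponentially many elements for which this length is at most n, the entropy of the
   walk grows sublinearly. Then some increment of the entropy is small, and by the inequality between
   relative entropy and Hellinger distance the distribution of the walk at that time is almost
   invariant. *)
theory Submission
  imports Defs "HOL-Analysis.Function_Topology" "HOL-Analysis.L2_Norm"
begin

section \<open>Words and presentations\<close>

text \<open>Sections are taken of words, not only of group elements: every letter lands in exactly
  one of the two sections, so their lengths add up to that of the word, and statements about
  relations become inductions on words. The same exactness is the obstacle for amenability:
  descending a level shortens nothing by itself. The loss comes from excursions of a vertex from
  \<open>One\<close> to \<open>Two\<close> and back, half of which write nothing into the section.
  The walk induced on a section runs on its own clock and with other weights of a and b. Killing the
  walk at rate \<epsilon> turns the change of clock into an explicit change of the two weights, and
  a function that dominates the cost plus its own average after one step bounds the expected cost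
  without any limit theorem. The bound has the form m / \<epsilon>^2, with m tending to 0 as the
  level grows; \<epsilon> of order 1 / N makes it a bound on the sum over the first N steps. Hence
  the entropy is controlled through such sums rather than at single times. That \<Gamma> embeds in
  \<Delta> comes from an explicit action of \<Delta>, in place of normal forms for HNN
  extensions.\<close>

abbreviation reduced :: "('x \<times> bool) list \<Rightarrow> bool" where
  "reduced \<equiv> successively (\<lambda>l m. m \<noteq> flip l)"

definition words :: "'x set \<Rightarrow> ('x \<times> bool) list set" where
  "words X = lists (X \<times> UNIV)"

lemma words_simps [simp]:
  "[] \<in> words X" "l # w \<in> words X \<longleftrightarrow> fst l \<in> X \<and> w \<in> words X"
  "u @ v \<in> words X \<longleftrightarrow> u \<in> words X \<and> v \<in> words X"
  by (cases l; auto simp: words_def)+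

abbreviation act_free :: "('x \<times> bool) list \<Rightarrow> ('x \<times> bool) list \<Rightarrow> ('x \<times> bool) list" where
  "act_free \<equiv> foldr push"

definition winv :: "('x \<times> bool) list \<Rightarrow> ('x \<times> bool) list" where
  "winv w = rev (map flip w)"

lemma flip_flip [simp]: "flip (flip l) = l"
  by (cases l) auto

lemma flip_neq [simp]: "flip l \<noteq> l" "l \<noteq> flip l"
  by (cases l; auto)+

lemma fst_flip [simp]: "fst (flip l) = fst l"
  by (cases l) auto

lemma winv_simps [simp]:
  "winv [] = []" "winv (l # w) = winv w @ [flip l]" "winv (u @ v) = winv v @ winv u"
  by (simp_all add: winv_def)

lemma winv_words: "w \<in> words X \<Longrightarrow> winv w \<in> words X"
  by (induction w) auto

text \<open>Each letter permutes the reduced words, its inverse letter undoing it. This is van der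
  Waerden's trick: associativity of the free group then comes from composition of maps and needs no
  confluence argument.\<close>

lemma push_flip [simp]: "reduced w \<Longrightarrow> push (flip l) (push l w) = w"
  by (cases w rule: list.exhaust; cases "tl w")
    (auto simp: successively_Cons)

lemma push_flip' [simp]: "reduced w \<Longrightarrow> push l (push (flip l) w) = w"
  using push_flip[of w "flip l"] by simp

lemma reduced_push: "reduced w \<Longrightarrow> reduced (push l w)"
  by (cases w) (auto simp: successively_Cons)

lemma reduced_act: "reduced w \<Longrightarrow> reduced (act_free u w)"
  by (induction u) (auto simp: reduced_push)

lemma push_words: "fst l \<in> X \<Longrightarrow> w \<in> words X \<Longrightarrow> push l w \<in> words X"
  by (cases w) auto

lemma act_words: "u \<in> words X \<Longrightarrow> w \<in> words X \<Longrightarrow> act_free u w \<in> words X"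
  by (induction u) (auto intro: push_words)

lemma act_push: "reduced w \<Longrightarrow> act_free (push l v) w = push l (act_free v w)"
  by (cases v) (auto simp: reduced_act)

lemma act_assoc: "reduced w \<Longrightarrow> act_free (act_free u v) w = act_free u (act_free v w)"
  by (induction u) (auto simp: act_push)

lemma act_reduced: "reduced u \<Longrightarrow> act_free u [] = u"
proof (induction u)
  case (Cons l u)
  then show ?case by (cases u) auto
qed simp

lemma act_winv: "reduced w \<Longrightarrow> act_free (winv u) (act_free u w) = w"
  by (induction u arbitrary: w) (auto simp: reduced_act)

lemma free_group_simps [simp]:
  "u \<otimes>\<^bsub>free_group X\<^esub> v = act_free u v" "\<one>\<^bsub>free_group X\<^esub> = []"
  "carrier (free_group X) = {w \<in> words X. reduced w}"
  by (simp_all add: free_group_def words_def)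

lemma group_free_group: "group (free_group X)"
proof (rule groupI)
  fix w assume w: "w \<in> carrier (free_group X)"
  define v where "v = act_free (winv w) []"
  have "v \<in> carrier (free_group X)"
    using w by (auto simp: v_def intro!: reduced_act act_words winv_words)
  moreover have "act_free v w = []"
    using w act_winv[of "[]" w] by (simp add: v_def act_assoc act_reduced)
  ultimately show "\<exists>y\<in>carrier (free_group X). y \<otimes>\<^bsub>free_group X\<^esub> w = \<one>\<^bsub>free_group X\<^esub>"
    by auto
qed (auto simp: act_assoc reduced_act act_words act_reduced)

lemma free_gen_carrier: "x \<in> X \<Longrightarrow> free_gen x \<in> carrier (free_group X)"
  by (simp add: free_gen_def)

lemma free_gen_funcset: "free_gen \<in> X \<rightarrow> carrier (free_group X)"
  by (intro funcsetI free_gen_carrier)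

section \<open>Evaluation of words in a group\<close>

definition leval :: "('a, 'b) monoid_scheme \<Rightarrow> ('x \<Rightarrow> 'a) \<Rightarrow> 'x \<times> bool \<Rightarrow> 'a" where
  "leval G f l = (if snd l then f (fst l) else inv\<^bsub>G\<^esub> f (fst l))"

text \<open>Evaluation is defined for all words, reduced or not, so that relations can be handled
  without normal forms.\<close>

primrec weval :: "('a, 'b) monoid_scheme \<Rightarrow> ('x \<Rightarrow> 'a) \<Rightarrow> ('x \<times> bool) list \<Rightarrow> 'a" where
  "weval G f [] = \<one>\<^bsub>G\<^esub>"
| "weval G f (l # w) = leval G f l \<otimes>\<^bsub>G\<^esub> weval G f w"

lemma weval_cong:
  "w \<in> words X \<Longrightarrow> (\<And>x. x \<in> X \<Longrightarrow> f x = g x) \<Longrightarrow> weval G f w = weval G g w"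
  by (induction w) (auto simp: leval_def)

context group
begin

lemma leval_closed [simp]: "f \<in> X \<rightarrow> carrier G \<Longrightarrow> fst l \<in> X \<Longrightarrow> leval G f l \<in> carrier G"
  by (auto simp: leval_def Pi_iff)

lemma leval_flip: "f \<in> X \<rightarrow> carrier G \<Longrightarrow> fst l \<in> X \<Longrightarrow> leval G f (flip l) = inv leval G f l"
  by (cases l) (auto simp: leval_def Pi_iff)

lemma weval_closed [simp]: "f \<in> X \<rightarrow> carrier G \<Longrightarrow> w \<in> words X \<Longrightarrow> weval G f w \<in> carrier G"
  by (induction w) (auto simp: leval_def Pi_iff)

lemma weval_append:
  "f \<in> X \<rightarrow> carrier G \<Longrightarrow> u \<in> words X \<Longrightarrow> v \<in> words X \<Longrightarrow>
    weval G f (u @ v) = weval G f u \<otimes> weval G f v"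
proof (induction u)
  case (Cons l u)
  then show ?case using leval_closed[of f X l] weval_closed[of f X u] weval_closed[of f X v]
    by (simp add: m_assoc)
qed auto

lemma weval_winv:
  "f \<in> X \<rightarrow> carrier G \<Longrightarrow> u \<in> words X \<Longrightarrow> weval G f (winv u) = inv weval G f u"
proof (induction u)
  case (Cons l u)
  then show ?case using leval_closed[of f X l] weval_closed[of f X u] leval_closed[of f X "flip l"]
    by (simp add: weval_append[of f X] winv_words leval_flip[of f X] inv_mult_group)
qed auto

lemma weval_push:
  "f \<in> X \<rightarrow> carrier G \<Longrightarrow> fst l \<in> X \<Longrightarrow> w \<in> words X \<Longrightarrow>
    weval G f (push l w) = leval G f l \<otimes> weval G f w"
  using leval_closed[of f X l] weval_closed[of f X "tl w"]
  by (cases w) (auto simp: leval_flip[of f X] m_assoc[symmetric])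

lemma weval_act:
  "f \<in> X \<rightarrow> carrier G \<Longrightarrow> u \<in> words X \<Longrightarrow> v \<in> words X \<Longrightarrow>
    weval G f (act_free u v) = weval G f u \<otimes> weval G f v"
proof (induction u)
  case (Cons l u)
  then show ?case using leval_closed[of f X l] weval_closed[of f X u] weval_closed[of f X v]
    by (simp add: m_assoc weval_push[of f X] act_words)
qed auto

lemma weval_hom: "f \<in> X \<rightarrow> carrier G \<Longrightarrow> weval G f \<in> hom (free_group X) G"
  by (auto simp: hom_def weval_act[of f X])

lemma weval_gen: "f \<in> X \<rightarrow> carrier G \<Longrightarrow> x \<in> X \<Longrightarrow> weval G f (free_gen x) = f x"
  by (auto simp: free_gen_def leval_def Pi_iff)

lemma hom_weval:
  assumes "group H" "h \<in> hom G H" "f \<in> X \<rightarrow> carrier G" "w \<in> words X"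
  shows "h (weval G f w) = weval H (h \<circ> f) w"
proof -
  interpret h: group_hom G H h
    using assms(1,2) is_group by (simp add: group_hom_def group_hom_axioms_def)
  have *: "h (leval G f l) = leval H (h \<circ> f) l" if "fst l \<in> X" for l
    using that assms(3) by (auto simp: leval_def Pi_iff)
  show ?thesis
    using assms(4)
  proof (induction w)
    case (Cons l w)
    then show ?case
      using assms leval_closed[of f X l] weval_closed[of f X w] *[of l] by (simp add: comp_def)
  qed simp
qed

section \<open>Normal closures and the universal property of a presentation\<close>

lemma normal_Inter:
  assumes "\<And>N. N \<in> \<N> \<Longrightarrow> N \<lhd> G" "\<N> \<noteq> {}"
  shows "\<Inter>\<N> \<lhd> G"
proof -
  have "subgroup (\<Inter>\<N>) G"
    using assms by (intro subgroups_Inter) (auto simp: normal_imp_subgroup)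
  moreover have "g \<otimes> n \<otimes> inv g \<in> \<Inter>\<N>" if "g \<in> carrier G" "n \<in> \<Inter>\<N>" for g n
    using assms(1) that by (auto simp: normal_inv_iff)
  ultimately show ?thesis by (simp add: normal_inv_iff)
qed

lemma normal_carrier: "carrier G \<lhd> G"
  by (auto simp: normal_inv_iff subgroup_self)

lemma normal_closure_normal: "R \<subseteq> carrier G \<Longrightarrow> normal_closure G R \<lhd> G"
  unfolding normal_closure_def using normal_carrier by (intro normal_Inter) auto

end

lemma normal_closure_superset: "R \<subseteq> normal_closure G R"
  by (auto simp: normal_closure_def)

lemma normal_closure_minimal: "N \<lhd> G \<Longrightarrow> R \<subseteq> N \<Longrightarrow> normal_closure G R \<subseteq> N"
  by (auto simp: normal_closure_def)

lemma (in group_hom) vimage_normal: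
  assumes "N \<lhd> H"
  shows "{x \<in> carrier G. h x \<in> N} \<lhd> G"
proof -
  interpret N: normal N H by fact
  have "subgroup {x \<in> carrier G. h x \<in> N} G"
    using N.one_closed by (intro G.subgroupI) (auto simp: N.m_inv_closed N.m_closed simp del: N.one_closed)
  moreover have "g \<otimes> x \<otimes> inv g \<in> {x \<in> carrier G. h x \<in> N}"
    if "g \<in> carrier G" "x \<in> {x \<in> carrier G. h x \<in> N}" for g x
    using that N.inv_op_closed2 by simp
  ultimately show ?thesis by (simp add: G.normal_inv_iff)
qed

lemma group_presented_group:
  "R \<subseteq> carrier (free_group X) \<Longrightarrow> group (presented_group X R)"
  unfolding presented_group_def
  using group.normal_closure_normal[OF group_free_group] normal.factorgroup_is_group by blast

lemma weval_free_group: "w \<in> carrier (free_group X) \<Longrightarrow> weval (free_group X) free_gen w = w"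
proof (induction w)

  case (Cons l w)
  from Cons.prems have w: "reduced w" "w \<in> words X" by (auto simp: successively_Cons)
  have i: "inv\<^bsub>free_group X\<^esub> [(fst l, True)] = [(fst l, False)]"
    using Cons.prems by (intro group.inv_equality[OF group_free_group]) auto
  have "leval (free_group X) free_gen l = [l]"
    using i by (cases l) (auto simp: leval_def free_gen_def)
  then show ?case using Cons w
    by (cases w) auto
qed simp

context
  fixes X :: "'x set" and R :: "('x \<times> bool) list set"
  assumes R: "R \<subseteq> carrier (free_group X)"
begin

interpretation F: group "free_group X" by (rule group_free_group)
interpretation N: normal "normal_closure (free_group X) R" "free_group X"
  by (rule F.normal_closure_normal[OF R])
interpretation P: group "presented_group X R" by (rule group_presented_group[OF R])

lemma class_hom: "(\<lambda>w. normal_closure (free_group X) R #>\<^bsub>free_group X\<^esub> w)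
    \<in> hom (free_group X) (presented_group X R)"
  unfolding presented_group_def by (rule N.r_coset_hom_Mod)

lemma presented_gen_closed: "presented_gen X R \<in> X \<rightarrow> carrier (presented_group X R)"
  using hom_in_carrier[OF class_hom] free_gen_carrier[of _ X] by (auto simp: presented_gen_def)

lemma weval_presented:
  assumes "w \<in> carrier (free_group X)"
  shows "weval (presented_group X R) (presented_gen X R) w
    = normal_closure (free_group X) R #>\<^bsub>free_group X\<^esub> w"
proof -
  have "normal_closure (free_group X) R #>\<^bsub>free_group X\<^esub> weval (free_group X) free_gen w
     = weval (presented_group X R) (presented_gen X R) w"
    using assms F.hom_weval[OF P.is_group class_hom free_gen_funcset, of w]
    by (simp add: presented_gen_def[abs_def] comp_def)
  then show ?thesis using weval_free_group[OF assms] by simp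
qed

lemma presented_surj:
  assumes "p \<in> carrier (presented_group X R)"
  obtains w where "w \<in> words X" "p = weval (presented_group X R) (presented_gen X R) w"
proof -
  from assms obtain w where "w \<in> carrier (free_group X)"
     "p = normal_closure (free_group X) R #>\<^bsub>free_group X\<^esub> w"
    unfolding presented_group_def FactGroup_def RCOSETS_def by auto
  with weval_presented[of w] that[of w] show ?thesis by auto
qed

lemma weval_relator:
  assumes "r \<in> R"
  shows "weval (presented_group X R) (presented_gen X R) r = \<one>\<^bsub>presented_group X R\<^esub>"
  using assms R normal_closure_superset[of R "free_group X"] 
  by (subst weval_presented) (auto simp: presented_group_def N.rcos_const)

lemma presented_eq_one:
  assumes "w \<in> carrier (free_group X)"
    and "weval (presented_group X R) (presented_gen X R) w = \<one>\<^bsub>presented_group X R\<^esub>"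
  shows "w \<in> normal_closure (free_group X) R"
proof -
  have "normal_closure (free_group X) R #>\<^bsub>free_group X\<^esub> w = normal_closure (free_group X) R"
    using assms weval_presented[OF assms(1)] by (simp add: presented_group_def)
  then show ?thesis using F.rcos_self[OF assms(1) N.subgroup_axioms] by simp
qed

lemma presented_hom_exists:
  assumes "group G" "f \<in> X \<rightarrow> carrier G" "\<And>r. r \<in> R \<Longrightarrow> weval G f r = \<one>\<^bsub>G\<^esub>"
  obtains h where "h \<in> hom (presented_group X R) G" "\<And>x. x \<in> X \<Longrightarrow> h (presented_gen X R x) = f x"
proof -
  interpret G: group G by fact
  interpret e: group_hom "free_group X" G "weval G f"
    using G.weval_hom[OF assms(2)] by unfold_locales
  let ?N = "normal_closure (free_group X) R"
  have sub: "?N \<subseteq> kernel (free_group X) G (weval G f)"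
    using assms(3) R by (intro normal_closure_minimal e.normal_kernel) (auto simp: kernel_def)
  define h where "h P = weval G f (SOME w. w \<in> P)" for P
  have h: "h (?N #>\<^bsub>free_group X\<^esub> w) = weval G f w" if w: "w \<in> carrier (free_group X)" for w
  proof -
    have "(SOME v. v \<in> ?N #>\<^bsub>free_group X\<^esub> w) \<in> ?N #>\<^bsub>free_group X\<^esub> w"
      using F.rcos_self[OF w N.subgroup_axioms] by (rule someI)
    then obtain n where n: "n \<in> ?N" "(SOME v. v \<in> ?N #>\<^bsub>free_group X\<^esub> w) = n \<otimes>\<^bsub>free_group X\<^esub> w"
      by (auto simp: r_coset_def)
    have nc: "n \<in> carrier (free_group X)" "weval G f n = \<one>\<^bsub>G\<^esub>"
      using n(1) sub by (auto simp: kernel_def)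
    then show ?thesis using e.hom_mult[OF nc(1) w] e.hom_closed[OF w] unfolding h_def n(2) by simp
  qed
  have "h \<in> hom (presented_group X R) G"
  proof (rule homI)
    fix p assume "p \<in> carrier (presented_group X R)"
    then obtain w where w: "w \<in> carrier (free_group X)" "p = ?N #>\<^bsub>free_group X\<^esub> w"
      unfolding presented_group_def FactGroup_def RCOSETS_def by auto
    then show "h p \<in> carrier G" using h e.hom_closed by simp
    fix q assume "q \<in> carrier (presented_group X R)"
    then obtain v where v: "v \<in> carrier (free_group X)" "q = ?N #>\<^bsub>free_group X\<^esub> v"
      unfolding presented_group_def FactGroup_def RCOSETS_def by auto
    have "p \<otimes>\<^bsub>presented_group X R\<^esub> q = ?N #>\<^bsub>free_group X\<^esub> (w \<otimes>\<^bsub>free_group X\<^esub> v)"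
      using hom_mult[OF class_hom w(1) v(1)] w(2) v(2) by simp
    moreover have "w \<otimes>\<^bsub>free_group X\<^esub> v \<in> carrier (free_group X)" using w v by blast
    ultimately show "h (p \<otimes>\<^bsub>presented_group X R\<^esub> q) = h p \<otimes>\<^bsub>G\<^esub> h q"
      using h[OF w(1)] h[OF v(1)] h[of "w \<otimes>\<^bsub>free_group X\<^esub> v"] w(2) v(2) 
         e.hom_mult[OF w(1) v(1)] by metis
  qed
  moreover have "h (presented_gen X R x) = f x" if "x \<in> X" for x
    using h[OF free_gen_carrier[OF that]] G.weval_gen[OF assms(2) that]
    by (simp add: presented_gen_def)
  ultimately show thesis using that by blast
qed

lemma presented_hom_eqI:
  assumes "group G" "h \<in> hom (presented_group X R) G" "k \<in> hom (presented_group X R) G"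
    and "\<And>x. x \<in> X \<Longrightarrow> h (presented_gen X R x) = k (presented_gen X R x)"
    and "p \<in> carrier (presented_group X R)"
  shows "h p = k p"
proof -
  obtain w where w: "w \<in> words X" "p = weval (presented_group X R) (presented_gen X R) w"
    using presented_surj[OF assms(5)] by blast
  have "weval G (h \<circ> presented_gen X R) w = weval G (k \<circ> presented_gen X R) w"
    using w(1) assms(4) by (intro weval_cong[of _ X]) auto
  then show ?thesis
    using P.hom_weval[OF assms(1,2) presented_gen_closed w(1)]
      P.hom_weval[OF assms(1,3) presented_gen_closed w(1)] w(2) by simp
qed

end

section \<open>The group \<open>\<Gamma>\<close> and its sections\<close>

datatype ab = La | Lb

type_synonym word = "(ab \<times> bool) list"

fun inv_a :: "digit list \<Rightarrow> digit list" and inv_b :: "digit list \<Rightarrow> digit list" where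
  "inv_a [] = []"
| "inv_a (One # w) = Two # w"
| "inv_a (Two # w) = One # inv_b w"
| "inv_b [] = []"
| "inv_b (One # w) = One # inv_a w"
| "inv_b (Two # w) = Two # w"

primrec gam :: "ab \<Rightarrow> digit list \<Rightarrow> digit list" where
  "gam La = aut_a"
| "gam Lb = aut_b"

fun lact :: "ab \<times> bool \<Rightarrow> digit list \<Rightarrow> digit list" where
  "lact (La, True) = aut_a"
| "lact (La, False) = inv_a"
| "lact (Lb, True) = aut_b"
| "lact (Lb, False) = inv_b"

primrec act :: "word \<Rightarrow> digit list \<Rightarrow> digit list" where
  "act [] = id"
| "act (l # w) = act w \<circ> lact l"

lemma inv_aut [simp]: "inv_a (aut_a v) = v" "inv_b (aut_b v) = v"
proof -
  \<comment> \<open>The recursions for a and b call each other, so the two claims can only be proved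
    together.\<close>
  have "inv_a (aut_a v) = v \<and> inv_b (aut_b v) = v"
  proof (induction v)
    case (Cons x v)
    then show ?case by (cases x) auto
  qed simp
  then show "inv_a (aut_a v) = v" "inv_b (aut_b v) = v" by auto
qed

lemma aut_inv [simp]: "aut_a (inv_a v) = v" "aut_b (inv_b v) = v"
proof -
  have "aut_a (inv_a v) = v \<and> aut_b (inv_b v) = v"
  proof (induction v)
    case (Cons x v)
    then show ?case by (cases x) auto
  qed simp
  then show "aut_a (inv_a v) = v" "aut_b (inv_b v) = v" by auto
qed

lemma lact_flip [simp]: "lact (flip l) (lact l v) = v" "lact l (lact (flip l) v) = v"
  by (cases l; cases "fst l"; cases "snd l"; simp)+

lemma lact_Nil [simp]: "lact l [] = []"
  by (cases l; cases "fst l"; cases "snd l"; simp)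

lemma lact_child:
  shows "\<exists>y. aut_a (v @ [x]) = aut_a v @ [y]" "\<exists>y. aut_b (v @ [x]) = aut_b v @ [y]"
    and "\<exists>y. inv_a (v @ [x]) = inv_a v @ [y]" "\<exists>y. inv_b (v @ [x]) = inv_b v @ [y]"
proof -
  have "(\<exists>y. aut_a (v @ [x]) = aut_a v @ [y]) \<and> (\<exists>y. aut_b (v @ [x]) = aut_b v @ [y]) \<and>
    (\<exists>y. inv_a (v @ [x]) = inv_a v @ [y]) \<and> (\<exists>y. inv_b (v @ [x]) = inv_b v @ [y])"
  proof (induction v)
    case Nil
    then show ?case by (cases x) auto
  next
    case (Cons z v)
    then show ?case by (cases z) auto
  qed
  then show "\<exists>y. aut_a (v @ [x]) = aut_a v @ [y]" "\<exists>y. aut_b (v @ [x]) = aut_b v @ [y]"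
    and "\<exists>y. inv_a (v @ [x]) = inv_a v @ [y]" "\<exists>y. inv_b (v @ [x]) = inv_b v @ [y]"
    by auto
qed

lemma lact_child': "child v w \<Longrightarrow> child (lact l v) (lact l w)"
  using lact_child[of v] by (cases l; cases "fst l"; cases "snd l") (auto simp: child_def)

lemma lact_in_tree_aut: "lact l \<in> carrier tree_aut"
proof -
  have "bij (lact l)"
    by (rule bij_betw_byWitness[where f' = "lact (flip l)"]) auto
  moreover have "child (lact l v) (lact l w) \<longleftrightarrow> child v w" for v w
    using lact_child'[of v w l] lact_child'[of "lact l v" "lact l w" "flip l"] by auto
  ultimately show ?thesis by (simp add: tree_aut_def)
qed

lemma tree_aut_simps [simp]:
  "f \<otimes>\<^bsub>tree_aut\<^esub> g = g \<circ> f" "\<one>\<^bsub>tree_aut\<^esub> = id"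
  by (simp_all add: tree_aut_def)

lemma group_tree_aut: "group tree_aut"
proof (rule groupI)
  fix f assume f: "f \<in> carrier tree_aut"
  define g where "g = inv_into UNIV f"
  have b: "bij f" "f [] = []" and c: "\<And>v w. child (f v) (f w) \<longleftrightarrow> child v w"
    using f by (auto simp: tree_aut_def)
  have fg: "f (g v) = v" and gf: "g (f v) = v" for v
    using b by (simp_all add: g_def bij_is_surj bij_is_inj surj_f_inv_f)
  have "child (g v) (g w) \<longleftrightarrow> child v w" for v w
    using c[of "g v" "g w"] by (simp add: fg)
  moreover have "g [] = []" using gf[of "[]"] b by simp
  moreover have "bij g" using b by (simp add: g_def bij_imp_bij_inv)
  ultimately have "g \<in> carrier tree_aut" by (simp add: tree_aut_def)
  moreover have "g \<otimes>\<^bsub>tree_aut\<^esub> f = \<one>\<^bsub>tree_aut\<^esub>"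
    by (auto simp: fg)
  ultimately show "\<exists>g\<in>carrier tree_aut. g \<otimes>\<^bsub>tree_aut\<^esub> f = \<one>\<^bsub>tree_aut\<^esub>" by blast
qed (auto simp: tree_aut_def bij_comp)

interpretation tree: group tree_aut by (rule group_tree_aut)

lemma gam_lact: "gam g = lact (g, True)"
  by (cases g) auto

lemma gam_closed: "gam \<in> UNIV \<rightarrow> carrier tree_aut"
  using lact_in_tree_aut by (simp add: gam_lact)

lemma leval_tree: "leval tree_aut gam l = lact l"
proof (cases l)
  case (Pair g e)
  have "inv\<^bsub>tree_aut\<^esub> lact (g, True) = lact (g, False)"
    using lact_flip[of "(g, True)"] by (intro tree.inv_equality lact_in_tree_aut) auto
  then show ?thesis using Pair by (cases e) (auto simp: leval_def gam_lact)
qed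

lemma words_UNIV [simp]: "words UNIV = UNIV"
  by (auto simp: words_def)

lemma weval_tree: "weval tree_aut gam w = act w"
  by (induction w) (auto simp: leval_tree)

lemma act_in_tree_aut [simp]: "act w \<in> carrier tree_aut"
  using tree.weval_closed[OF gam_closed, of w] by (simp add: weval_tree)

lemma act_append [simp]: "act (u @ v) = act v \<circ> act u"
  by (induction u) auto

lemma act_winv_act [simp]: "act (winv w) (act w v) = v" "act w (act (winv w) v) = v"
  by (induction w arbitrary: v) auto

lemma inv_act: "inv\<^bsub>tree_aut\<^esub> act w = act (winv w)"
  using tree.weval_winv[OF gam_closed, of w] by (simp add: weval_tree)

lemma carrier_Gamma: "carrier Gamma = range act"
proof -
  have "aut_a \<in> carrier tree_aut" "aut_b \<in> carrier tree_aut"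
    using lact_in_tree_aut[of "(La, True)"] lact_in_tree_aut[of "(Lb, True)"] by simp_all
  then have *: "carrier Gamma = generate tree_aut {aut_a, aut_b}"
    by (simp add: Gamma_def carrier_subgroup_generated Int_absorb1)
  have "generate tree_aut {aut_a, aut_b} \<subseteq> range act"
  proof (rule tree.generate_subgroup_incl)
    have "aut_a = act [(La, True)]" "aut_b = act [(Lb, True)]" by auto
    then show "{aut_a, aut_b} \<subseteq> range act" by blast
    show "subgroup (range act) tree_aut"
    proof (rule tree.subgroupI)
      fix f g assume "f \<in> range act" "g \<in> range act"
      then obtain u w where "f = act u" "g = act w" by blast
      then have "f \<otimes>\<^bsub>tree_aut\<^esub> g = act (u @ w)" by simp
      then show "f \<otimes>\<^bsub>tree_aut\<^esub> g \<in> range act" by blast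
    qed (auto simp: inv_act)
  qed
  moreover have "act w \<in> generate tree_aut {aut_a, aut_b}" for w
  proof (induction w)
    case Nil
    then show ?case using generate.one[of tree_aut] unfolding tree_aut_simps act.simps .
  next
    case (Cons l w)
    have "lact l \<in> generate tree_aut {aut_a, aut_b}"
    proof (cases l)
      case (Pair g e)
      have "leval tree_aut gam l \<in> generate tree_aut {aut_a, aut_b}"
        using Pair by (cases g) (auto simp: leval_def intro: generate.incl generate.inv)
      then show ?thesis by (simp add: leval_tree)
    qed
    then show ?case using generate.eng[OF _ Cons.IH] by (metis act.simps(2) tree_aut_simps(1))
  qed
  ultimately show ?thesis using * by blast
qed

lemma group_Gamma: "group Gamma"
  by (simp add: Gamma_def)

interpretation Gam: group Gamma by (rule group_Gamma)

lemma Gamma_simps [simp]: "f \<otimes>\<^bsub>Gamma\<^esub> g = g \<circ> f" "\<one>\<^bsub>Gamma\<^esub> = id"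
  by (simp_all add: Gamma_def)

lemma act_in_Gamma [simp]: "act w \<in> carrier Gamma"
  by (simp add: carrier_Gamma)

lemma Gamma_cases:
  assumes "g \<in> carrier Gamma" obtains w where "g = act w"
  using assms by (auto simp: carrier_Gamma)

lemma inv_Gamma [simp]: "inv\<^bsub>Gamma\<^esub> act w = act (winv w)"
  by (rule Gam.inv_equality) auto

lemma gam_in_Gamma: "gam \<in> UNIV \<rightarrow> carrier Gamma"
proof -
  have "gam g = act [(g, True)]" for g by (simp add: gam_lact)
  then show ?thesis by (metis Pi_I act_in_Gamma)
qed

lemma weval_Gamma: "weval Gamma gam w = act w"
proof (induction w)
  case (Cons l w)
  have "inv\<^bsub>Gamma\<^esub> lact l = lact (flip l)" for l
    using inv_Gamma[of "[l]"] by simp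
  then have "leval Gamma gam l = lact l" by (cases l) (auto simp: leval_def gam_lact)
  then show ?case using Cons by simp
qed simp

section \<open>The wreath recursion on words\<close>

fun lpos :: "ab \<times> bool \<Rightarrow> digit \<Rightarrow> digit" where
  "lpos (La, _) One = Two"
| "lpos (La, _) Two = One"
| "lpos (Lb, _) x = x"

text \<open>This is a = (b, 1) followed by the exchange of the subtrees, and b = (a, 1). Of the two
  sections of a letter one is empty and the other is a single letter.\<close>

fun lsec :: "ab \<times> bool \<Rightarrow> digit \<Rightarrow> word" where
  "lsec (La, True) One = [(Lb, True)]"
| "lsec (La, False) Two = [(Lb, False)]"
| "lsec (Lb, e) One = [(La, e)]"
| "lsec _ _ = []"

primrec wpos :: "word \<Rightarrow> digit \<Rightarrow> digit" where
  "wpos [] x = x"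
| "wpos (l # w) x = wpos w (lpos l x)"

primrec wsec :: "word \<Rightarrow> digit \<Rightarrow> word" where
  "wsec [] x = []"
| "wsec (l # w) x = lsec l x @ wsec w (lpos l x)"

lemma lact_Cons: "lact l (x # v) = lpos l x # act (lsec l x) v"
  by (cases l; cases "fst l"; cases "snd l"; cases x) auto

lemma act_Cons: "act w (x # v) = wpos w x # act (wsec w x) v"
  by (induction w arbitrary: x v) (auto simp: lact_Cons)

lemma act_Nil [simp]: "act w [] = []"
  by (induction w) auto

lemma wpos_append [simp]: "wpos (u @ v) x = wpos v (wpos u x)"
  by (induction u arbitrary: x) auto

lemma wsec_append [simp]: "wsec (u @ v) x = wsec u x @ wsec v (wpos u x)"
  by (induction u arbitrary: x) auto

lemma act_eq_iff: "act u = act w \<longleftrightarrow> (\<forall>x. wpos u x = wpos w x \<and> act (wsec u x) = act (wsec w x))"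
proof
  assume eq: "act u = act w"
  have "wpos u x = wpos w x \<and> act (wsec u x) v = act (wsec w x) v" for x v
    using fun_cong[OF eq, of "x # v"] by (simp add: act_Cons)
  then show "\<forall>x. wpos u x = wpos w x \<and> act (wsec u x) = act (wsec w x)" by blast
next
  assume "\<forall>x. wpos u x = wpos w x \<and> act (wsec u x) = act (wsec w x)"
  then have "act u v = act w v" for v by (cases v) (auto simp: act_Cons)
  then show "act u = act w" by blast
qed

lemma All_digit: "(\<forall>x. P x) \<longleftrightarrow> P One \<and> P Two"
  by (metis digit.exhaust)

lemma wpos_inj: "wpos w x = wpos w y \<longleftrightarrow> x = y"
proof -
  have "lpos l x = lpos l y \<longleftrightarrow> x = y" for l x y
    by (cases l; cases "fst l"; cases x; cases y) auto
  then show ?thesis by (induction w arbitrary: x y) auto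
qed

lemma act_eq_id_iff:
  "act w = id \<longleftrightarrow> wpos w One = One \<and> act (wsec w One) = id \<and> act (wsec w Two) = id"
proof -
  have "wpos w One = One \<Longrightarrow> wpos w Two = Two" using wpos_inj[of w One Two] by (cases "wpos w Two") auto
  then show ?thesis using act_eq_iff[of w "[]"] by (auto simp: All_digit)
qed

section \<open>Exponent sums\<close>

primrec ex :: "ab \<Rightarrow> word \<Rightarrow> int" where
  "ex g [] = 0"
| "ex g (l # w) = (if fst l = g then if snd l then 1 else - 1 else 0) + ex g w"

lemma ex_append [simp]: "ex g (u @ v) = ex g u + ex g v"
  by (induction u) auto

lemma ex_winv [simp]: "ex g (winv u) = - ex g u"
  by (induction u) (auto split: if_splits)

text \<open>\<open>2 ex Lb - ex La\<close> of the letters read so far is the potential of the current vertex.\<close>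

lemma ex_A: "2 * ex Lb (wsec w x) = ex La w + (if wpos w x = Two then 1 else 0) - (if x = Two then 1 else 0)"
proof (induction w arbitrary: x)
  case (Cons l w)
  have "2 * ex Lb (lsec l x) = ex La [l] + (if lpos l x = Two then 1 else 0) - (if x = Two then 1 else 0)"
    by (cases l; cases "fst l"; cases "snd l"; cases x) auto
  then show ?case using Cons[of "lpos l x"] by (simp add: algebra_simps)
qed simp

text \<open>The letters a in the two sections are the traces of the letters b of \<open>w\<close>.
  The vertices are an arbitrary pair because letters a exchange them during the induction.\<close>

lemma ex_B: "x \<noteq> y \<Longrightarrow> ex Lb w = ex La (wsec w x) + ex La (wsec w y)"
proof (induction w arbitrary: x y)
  case (Cons l w)
  have "lpos l x \<noteq> lpos l y" "ex Lb [l] = ex La (lsec l x) + ex La (lsec l y)"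
    using Cons.prems by (cases l; cases "fst l"; cases "snd l"; cases x; cases y; auto)+
  then show ?case using Cons.IH[of "lpos l x" "lpos l y"] by simp
qed simp

text \<open>The sections of a relation are relations. By \<open>ex_A\<close> its exponent of a is
  twice an exponent of b in a section, and by \<open>ex_B\<close> its exponent of b is a sum of
  exponents of a in the sections; so both are divisible by every power of 2.\<close>

lemma ex_kernel: "act w = id \<Longrightarrow> ex g w = 0"
proof -
  assume w: "act w = id"
  have dvd: "act w = id \<Longrightarrow> 2 ^ n dvd ex La w \<and> 2 ^ n dvd ex Lb w" for n w
  proof (induction n arbitrary: w)
    case (Suc n)
    have La: "2 ^ Suc n dvd ex La w" if "act w = id" for w
    proof -
      have "ex La w = 2 * ex Lb (wsec w One)" "2 ^ n dvd ex Lb (wsec w One)"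
        using Suc.IH[of "wsec w One"] ex_A[of w One] that by (auto simp: act_eq_id_iff[of w])
      then show ?thesis by simp
    qed
    have "act (wsec w One) = id" "act (wsec w Two) = id"
      using Suc.prems act_eq_id_iff[of w] by blast+
    then have "2 ^ Suc n dvd ex Lb w" using La ex_B[of One Two w] by simp
    then show ?case using La[OF Suc.prems] by blast
  qed simp
  \<comment> \<open>An integer divisible by 2 to the power of its own absolute value is 0.\<close>
  have "2 ^ nat \<bar>ex g w\<bar> dvd ex g w" using dvd[OF w] by (cases g) auto
  then have "ex g w = 0 \<or> 2 ^ nat \<bar>ex g w\<bar> \<le> \<bar>ex g w\<bar>"
    using zdvd_imp_le[of "2 ^ nat \<bar>ex g w\<bar>" "\<bar>ex g w\<bar>"] by auto
  moreover have "int (nat \<bar>ex g w\<bar>) < 2 ^ nat \<bar>ex g w\<bar>"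
    using of_nat_less_two_power by blast
  ultimately show ?thesis by linarith
qed

lemma ex_cong: "act u = act w \<Longrightarrow> ex g u = ex g w"
  using ex_kernel[of "u @ winv w" g] by (simp add: fun_eq_iff)

lemma (in group) weval_single:
  assumes "f \<in> UNIV \<rightarrow> carrier G" "fst ` set w \<subseteq> {x}"
  shows "weval G f w = f x [^] ex x w"
  using assms(2)
proof (induction w)
  case (Cons l w)
  have "f x \<in> carrier G" using assms(1) by auto
  moreover have "leval G f l = f x [^] ex x [l]"
    using Cons.prems calculation by (auto simp: leval_def int_pow_neg)
  ultimately show ?case using Cons by (simp add: int_pow_mult)
qed (auto simp: int_pow_0)

lemma act_single: "fst ` set w \<subseteq> {x} \<Longrightarrow> act w = gam x [^]\<^bsub>Gamma\<^esub> ex x w"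
  using Gam.weval_single[OF gam_in_Gamma] by (simp add: weval_Gamma)

section \<open>The endomorphism \<sigma>\<close>

fun phil :: "ab \<times> bool \<Rightarrow> word" where
  "phil (La, e) = [(Lb, e)]"
| "phil (Lb, e) = [(La, e), (La, e)]"

definition phi :: "word \<Rightarrow> word" where
  "phi w = concat (map phil w)"

lemma phi_simps [simp]: "phi [] = []" "phi (l # w) = phil l @ phi w" "phi (u @ v) = phi u @ phi v"
  by (simp_all add: phi_def)

lemma wpos_phi [simp]: "wpos (phi w) x = x"
proof (induction w)
  case (Cons l w)
  then show ?case by (cases l; cases "fst l"; cases "snd l"; cases x) auto
qed simp

text \<open>Since b has sections (a, 1) and a^2 has sections (b, b), the substitution copies
  \<open>w\<close> below \<open>One\<close> as a word and not merely as an element.\<close>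

lemma wsec_phi_One [simp]: "wsec (phi w) One = w"
proof (induction w)
  case (Cons l w)
  then show ?case by (cases l; cases "fst l"; cases "snd l") auto
qed simp

lemma wsec_phi_Two [simp]: "wsec (phi w) Two = filter (\<lambda>l. fst l = Lb) w"
proof (induction w)
  case (Cons l w)
  then show ?case by (cases l; cases "fst l"; cases "snd l") auto
qed simp

lemma act_filter_B: "act (filter (\<lambda>l. fst l = Lb) w) = aut_b [^]\<^bsub>Gamma\<^esub> ex Lb w"
proof -
  have "ex Lb (filter (\<lambda>l. fst l = Lb) w) = ex Lb w" by (induction w) auto
  then show ?thesis by (subst act_single[where x = Lb]) auto
qed

text \<open>The section of \<open>phi w\<close> at \<open>Two\<close> is a power of b whose exponent
  depends only on the element, by \<open>ex_cong\<close>. This is what makes \<sigma> well defined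
  on \<Gamma>; the section at \<open>One\<close> makes it injective.\<close>

lemma act_phi_cong: "act u = act w \<Longrightarrow> act (phi u) = act (phi w)"
  by (simp add: act_eq_iff[of "phi u"] All_digit act_filter_B ex_cong[of u w])

definition sig :: "(digit list \<Rightarrow> digit list) \<Rightarrow> digit list \<Rightarrow> digit list" where
  "sig g = act (phi (SOME w. act w = g))"

lemma sig_act: "sig (act w) = act (phi w)"
  unfolding sig_def by (rule act_phi_cong) (rule someI[of _ w], simp)

lemma sig_hom: "sig \<in> hom Gamma Gamma"
proof (rule homI)
  fix f g assume "f \<in> carrier Gamma" "g \<in> carrier Gamma"
  then obtain u w where "f = act u" "g = act w" by (metis Gamma_cases)
  then show "sig (f \<otimes>\<^bsub>Gamma\<^esub> g) = sig f \<otimes>\<^bsub>Gamma\<^esub> sig g"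
    using sig_act[of "u @ w"] by (simp add: sig_act)
qed (simp add: sig_def)

lemma sig_mon: "sig \<in> mon Gamma Gamma"
proof -
  have "inj_on sig (carrier Gamma)"
  proof (rule inj_onI)
    fix f g assume "f \<in> carrier Gamma" "g \<in> carrier Gamma" "sig f = sig g"
    then obtain u w where *: "f = act u" "g = act w" "act (phi u) = act (phi w)"
      by (metis Gamma_cases sig_act)
    then have "act (wsec (phi u) One) = act (wsec (phi w) One)" using act_eq_iff[of "phi u"] by blast
    then show "f = g" using * by simp
  qed
  then show ?thesis using sig_hom by (simp add: mon_def)
qed

lemma sig_gens: "sig aut_a = aut_b" "sig aut_b = aut_a [^]\<^bsub>Gamma\<^esub> (2::nat)"
proof -
  have "aut_a = act [(La, True)]" "aut_b = act [(Lb, True)]" by auto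
  moreover have "aut_a [^]\<^bsub>Gamma\<^esub> (2::nat) = aut_a \<circ> aut_a"
    by (simp add: numeral_2_eq_2)
  ultimately show "sig aut_a = aut_b" "sig aut_b = aut_a [^]\<^bsub>Gamma\<^esub> (2::nat)"
    using sig_act[of "[(La, True)]"] sig_act[of "[(Lb, True)]"] by simp_all
qed

section \<open>The relations of \<open>\<Gamma>\<close>\<close>

lemma not_reducedE:
  assumes "\<not> reduced w"
  obtains u l v where "w = u @ l # flip l # v"
proof -
  have "\<exists>u l v. w = u @ l # flip l # v"
    using assms
  proof (induction w)
    case (Cons l w)
    show ?case
    proof (cases "reduced w")
      case True
      then obtain v where "w = flip l # v" using Cons.prems by (cases w) (auto simp: successively_Cons)
      then show ?thesis by (metis append_Nil)
    next
      case False
      then show ?thesis using Cons.IH by (metis append_Cons)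
    qed
  qed simp
  then show thesis using that by blast
qed

lemma reduced_single: "reduced w \<Longrightarrow> fst ` set w \<subseteq> {x} \<Longrightarrow> \<bar>ex x w\<bar> = int (length w)"
proof -
  have "reduced w \<Longrightarrow> fst ` set w \<subseteq> {x} \<Longrightarrow>
    (\<forall>l \<in> set w. l = hd w) \<and> ex x w = (if w = [] \<or> snd (hd w) then 1 else - 1) * int (length w)"
  proof (induction w)
    case (Cons l w)
    have "w \<noteq> [] \<Longrightarrow> hd w = l"
      using Cons.prems by (cases w; cases l) (auto simp: successively_Cons prod_eq_iff)
    with Cons show ?case by (cases w) (auto simp: successively_Cons)
  qed simp
  then show "reduced w \<Longrightarrow> fst ` set w \<subseteq> {x} \<Longrightarrow> \<bar>ex x w\<bar> = int (length w)"
    by (auto split: if_splits)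
qed

lemma lpos_flip [simp]: "lpos (flip l) (lpos l x) = x" "lpos l (lpos (flip l) x) = x"
  by (cases l; cases "fst l"; cases x; simp)+

lemma lsec_flip: "lsec (flip l) (lpos l x) = winv (lsec l x)"
  by (cases l; cases "fst l"; cases "snd l"; cases x) auto

lemma length_wsec: "x \<noteq> y \<Longrightarrow> length (wsec w x) + length (wsec w y) = length w"
proof (induction w arbitrary: x y)
  case (Cons l w)
  have "lpos l x \<noteq> lpos l y" "length (lsec l x) + length (lsec l y) = 1"
    using Cons.prems by (cases l; cases "fst l"; cases "snd l"; cases x; cases y; auto)+
  then show ?case using Cons.IH[of "lpos l x" "lpos l y"] by simp
qed simp

text \<open>In these two situations all letters contribute to the section at \<open>One\<close>, respectively \<open>Two\<close>.\<close>

lemma wsec_Two_empty: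
  "reduced w \<Longrightarrow> wsec w Two = [] \<Longrightarrow> wpos w One = One \<Longrightarrow> fst ` set w \<subseteq> {Lb}"
proof (induction w)
  case (Cons l w)
  show ?case
  proof (cases "fst l")
    case La
    then obtain w' where "l = (La, True)" "w = (La, False) # w'"
      using Cons.prems
      by (cases w; cases l; cases "snd l"; cases "fst (hd w)"; cases "snd (hd w)") (auto simp: prod_eq_iff)
    then show ?thesis using Cons.prems by simp
  next
    case Lb
    then show ?thesis using Cons by (cases l) (auto simp: successively_Cons)
  qed
qed simp

lemma wsec_One_empty:
  "reduced w \<Longrightarrow> wsec w One = [] \<Longrightarrow> wpos w One = One \<Longrightarrow> w \<noteq> [] \<Longrightarrow>
    \<exists>u. w = (La, False) # u @ [(La, True)] \<and> fst ` set u \<subseteq> {Lb}"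
proof -
  \<comment> \<open>Read from \<open>Two\<close>, the letters b, b^-1 and a leave no trace. After a
    the vertex is at \<open>One\<close>, where only a^-1 would leave none, and reducedness forbids
    it; so the word ends there.\<close>
  have *: "reduced w \<Longrightarrow> wsec w Two = [] \<Longrightarrow> wpos w Two = One \<Longrightarrow>
    \<exists>u. w = u @ [(La, True)] \<and> fst ` set u \<subseteq> {Lb}" for w
  proof (induction w)
    case (Cons l w)
    show ?case
    proof (cases "fst l")
      case La
      then have l: "l = (La, True)"
        using Cons.prems by (cases l; cases "snd l") auto
      have "w = []"
        using Cons.prems l
        by (cases w; cases "fst (hd w)"; cases "snd (hd w)") (auto simp: prod_eq_iff)
      then show ?thesis using l by auto
    next
      case Lb
      then obtain u where "w = u @ [(La, True)]" "fst ` set u \<subseteq> {Lb}"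
        using Cons by (cases l) (auto simp: successively_Cons)
      then have "l # w = (l # u) @ [(La, True)]" "fst ` set (l # u) \<subseteq> {Lb}" using Lb by auto
      then show ?thesis by blast
    qed
  qed simp
  assume w: "reduced w" "wsec w One = []" "wpos w One = One" "w \<noteq> []"
  then obtain l v where lv: "w = l # v" by (cases w) auto
  then have "l = (La, False)" using w by (cases l; cases "fst l"; cases "snd l") auto
  then show ?thesis using *[of v] w lv by (auto simp: successively_Cons)
qed

text \<open>The lengths of the sections add up to that of \<open>w\<close>, so one is shorter as
  soon as the other is nonempty. If a section were empty, \<open>w\<close> would be a power of b,
  possibly conjugated by a; its exponent vanishes by \<open>ex_kernel\<close>, which contradicts
  that \<open>w\<close> is reduced and nonempty.\<close>

lemma kernel_sections_shorter:
  assumes "act w = id" "reduced w" "w \<noteq> []"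
  shows "length (wsec w One) < length w" "length (wsec w Two) < length w"
proof -
  have w: "wpos w One = One" using assms act_eq_id_iff by blast
  have triv: "u = []" if "fst ` set u \<subseteq> {Lb}" "reduced u" "ex Lb u = ex Lb w" for u
    using reduced_single[of u Lb] that ex_kernel[OF assms(1)] by simp
  have "wsec w Two \<noteq> []"
    using wsec_Two_empty[of w] triv[of w] assms w by auto
  moreover have "wsec w One \<noteq> []"
  proof
    assume "wsec w One = []"
    then obtain u where u: "w = (La, False) # u @ [(La, True)]" "fst ` set u \<subseteq> {Lb}"
      using wsec_One_empty assms w by blast
    then have "u = []" using triv[of u] assms(2) by (auto simp: successively_Cons successively_append_iff)
    then show False using assms(2) u by simp
  qed
  ultimately show "length (wsec w One) < length w" "length (wsec w Two) < length w"
    using length_wsec[of One Two w] by (metis length_greater_0_conv less_add_same_cancel1 less_add_same_cancel2 digit.distinct(1))+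
qed

lemma act_cancel: "act (u @ l # flip l # v) = act (u @ v)"
  by (auto simp: fun_eq_iff)

text \<open>Induction on length: an unreduced relation loses a cancelling pair, a reduced one is
  replaced by its two shorter sections.\<close>

lemma kernel_induct [consumes 1, case_names Nil cancel sections]:
  assumes "act w = id" "P []"
    and "\<And>u l v. P (u @ v) \<Longrightarrow> P (u @ l # flip l # v)"
    and "\<And>w. act w = id \<Longrightarrow> P (wsec w One) \<Longrightarrow> P (wsec w Two) \<Longrightarrow> P w"
  shows "P w"
  using assms(1)
proof (induction "length w" arbitrary: w rule: less_induct)
  case less
  consider "w = []" | "\<not> reduced w" | "reduced w" "w \<noteq> []" by blast
  then show ?case
  proof cases
    case 2
    then obtain u l v where w: "w = u @ l # flip l # v" using not_reducedE by blast
    then have "act (u @ v) = id" using less.prems act_cancel by metis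
    then have "P (u @ v)" using w by (intro less.hyps) auto
    then show ?thesis using assms(3) w by blast
  next
    case 3
    have "act (wsec w One) = id" "act (wsec w Two) = id" using less.prems act_eq_id_iff by blast+
    then show ?thesis
      using kernel_sections_shorter[OF less.prems 3] less.hyps assms(4) less.prems by blast
  qed (use assms in blast)
qed

subsection \<open>\<open>\<Gamma>\<close> is not finitely presented\<close>

text \<open>Depth n describes the kernel of the n-fold wreath recursion on the free group; the union
  over n is the kernel of the action on the tree.\<close>

primrec ker_depth :: "nat \<Rightarrow> word \<Rightarrow> bool" where
  "ker_depth 0 w \<longleftrightarrow> act_free w [] = []"
| "ker_depth (Suc n) w \<longleftrightarrow> wpos w One = One \<and> (\<forall>x. ker_depth n (wsec w x))"

lemma wpos_fixed: "wpos w One = One \<Longrightarrow> wpos w x = x"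
  using wpos_inj[of w One Two] by (cases x; cases "wpos w Two") auto

text \<open>A cancelling pair of letters leaves in each section either nothing or again a cancelling
  pair. So depth is a property of elements of the free group although it is defined on
  words.\<close>

lemma ker_depth_cancel: "ker_depth n (u @ l # flip l # v) \<longleftrightarrow> ker_depth n (u @ v)"
proof (induction n arbitrary: u l v)
  case 0
  then show ?case by (simp add: reduced_act)
next
  case (Suc n)
  have "ker_depth n (wsec (u @ l # flip l # v) x) \<longleftrightarrow> ker_depth n (wsec (u @ v) x)" for x
  proof -
    have "\<exists>m. lsec l y = [] \<or> lsec l y = [m]" for y
      by (cases l; cases "fst l"; cases "snd l"; cases y) auto
    then obtain m where "lsec l (wpos u x) = [] \<or> lsec l (wpos u x) = [m]" by blast
    then show ?thesis
      using Suc[of "wsec u x" m "wsec v (wpos u x)"] by (auto simp: lsec_flip)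
  qed
  then show ?case by simp
qed

lemma ker_depth_push: "ker_depth n (u @ push l v @ z) \<longleftrightarrow> ker_depth n (u @ l # v @ z)"
  by (cases v) (auto simp: ker_depth_cancel)

lemma ker_depth_act_free': "ker_depth n (u @ act_free v w @ z) \<longleftrightarrow> ker_depth n (u @ v @ w @ z)"
proof (induction v arbitrary: u)
  case (Cons l v)
  then show ?case using Cons[of "u @ [l]"] by (simp add: ker_depth_push)
qed simp

lemma ker_depth_act_free: "ker_depth n (act_free v w) \<longleftrightarrow> ker_depth n (v @ w)"
  using ker_depth_act_free'[of n "[]" v w "[]"] by simp

lemma ker_depth_Nil [simp]: "ker_depth n []"
  by (induction n) auto

lemma ker_depth_append: "ker_depth n u \<Longrightarrow> ker_depth n w \<Longrightarrow> ker_depth n (u @ w)"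
  by (induction n arbitrary: u w) (auto simp: wpos_fixed)

lemma wpos_winv [simp]: "wpos (winv w) (wpos w x) = x" "wpos w (wpos (winv w) x) = x"
  by (induction w arbitrary: x) auto

lemma wsec_winv: "wsec (winv w) (wpos w x) = winv (wsec w x)"
  by (induction w arbitrary: x) (auto simp: lsec_flip)

lemma ker_depth_winv: "ker_depth n w \<Longrightarrow> ker_depth n (winv w)"
proof (induction n arbitrary: w)
  case 0
  then show ?case using act_winv[of "[]" w] by simp
next
  case (Suc n)
  then have "wpos (winv w) One = One" using wpos_winv(1)[of w One] by simp
  moreover have "ker_depth n (wsec (winv w) x)" for x
    using Suc wsec_winv[of w x] by (simp add: wpos_fixed)
  ultimately show ?case by simp
qed

lemma ker_depth_conj: "ker_depth n w \<Longrightarrow> ker_depth n (u @ w @ winv u)"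
proof (induction n arbitrary: w u)
  case 0
  then have "act_free w v = v" if "reduced v" for v
    using act_assoc[OF that, of w "[]"] by simp
  then show ?case using act_winv[of "[]" "winv u"] by (simp add: reduced_act winv_def rev_map comp_def)
next
  case (Suc n)
  then have "ker_depth n (wsec (u @ w @ winv u) x)" for x
    by (simp add: wpos_fixed wsec_winv)
  then show ?case using Suc.prems by (simp add: wpos_fixed)
qed

lemma ker_depth_mono: "m \<le> n \<Longrightarrow> ker_depth m w \<Longrightarrow> ker_depth n w"
proof -
  have step: "ker_depth n w \<Longrightarrow> ker_depth (Suc n) w" for n w
  proof (induction n arbitrary: w)
    case 0
    then show ?case using ker_depth_act_free[of 1 w "[]"] by simp
  qed auto
  have "ker_depth m w \<longrightarrow> ker_depth n w" if "m \<le> n"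
    using that by (induction n rule: dec_induct) (use step in blast)+
  then show "m \<le> n \<Longrightarrow> ker_depth m w \<Longrightarrow> ker_depth n w" by blast
qed

lemma ker_depth_exists:
  assumes "act w = id"
  shows "\<exists>n. ker_depth n w"
  using assms
proof (induction rule: kernel_induct)
  case (sections w)
  then obtain i j where "ker_depth i (wsec w One)" "ker_depth j (wsec w Two)" by blast
  then have "ker_depth (max i j) (wsec w x)" for x
    using ker_depth_mono[of i "max i j"] ker_depth_mono[of j "max i j"] by (cases x) auto
  then have "ker_depth (Suc (max i j)) w" using sections act_eq_id_iff[of w] by auto
  then show ?case by blast
qed (auto simp: ker_depth_cancel intro: ker_depth_Nil)

lemma ker_depth_act: "ker_depth n w \<Longrightarrow> act w = id"
proof (induction n arbitrary: w)
  case 0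
  have "weval Gamma gam (act_free w []) = weval Gamma gam w"
    using group.weval_act[OF group_Gamma gam_in_Gamma, of w "[]"] by simp
  then show ?case using 0 by (simp add: weval_Gamma)
next
  case (Suc n)
  then show ?case unfolding act_eq_id_iff[of w] ker_depth.simps by blast
qed

lemma weval_free_group': "weval (free_group UNIV) free_gen w = act_free w []"
proof -
  interpret F: group "free_group (UNIV :: 'x set)" by (rule group_free_group)
  have "weval (free_group UNIV) free_gen w = weval (free_group UNIV) free_gen (act_free w [])"
    using F.weval_act[OF free_gen_funcset, of w "[]"] F.weval_closed[OF free_gen_funcset, of w] by (simp add: act_reduced)
  then show ?thesis using weval_free_group[of "act_free w []" UNIV] by (simp add: reduced_act)
qed

text \<open>The section of \<open>phi w\<close> at \<open>One\<close> is \<open>w\<close>, and the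
  one at \<open>Two\<close> is a word in b alone with exponent 0, hence freely trivial.\<close>

lemma ker_depth_phi:
  assumes "ker_depth n w"
  shows "ker_depth (Suc n) (phi w)"
proof -
  interpret F: group "free_group (UNIV :: ab set)" by (rule group_free_group)
  have *: "ex Lb (filter (\<lambda>l. fst l = Lb) w) = ex Lb w" by (induction w) auto
  have f: "fst ` set (filter (\<lambda>l. fst l = Lb) w) \<subseteq> {Lb}" by auto
  have "weval (free_group UNIV) free_gen (filter (\<lambda>l. fst l = Lb) w) = \<one>\<^bsub>free_group UNIV\<^esub>"
    using F.weval_single[OF free_gen_funcset f] ex_kernel[OF ker_depth_act[OF assms], of Lb] * by simp
  then have "ker_depth 0 (filter (\<lambda>l. fst l = Lb) w)" by (simp add: weval_free_group')
  then have "ker_depth n (filter (\<lambda>l. fst l = Lb) w)" using ker_depth_mono by blast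
  then show ?thesis using assms by (simp add: All_digit)
qed

lemma ker_depth_strict: "\<exists>w. ker_depth (Suc n) w \<and> \<not> ker_depth n w"
proof (induction n)
  case 0
  \<comment> \<open>The commutator of b with a^-1 b a. The two act below different vertices of the
    first level, so the sections of the commutator cancel freely, while the word itself is reduced.
    Applying \<open>phi\<close> then yields a witness at every later depth.\<close>
  let ?w = "[(Lb, False), (La, False), (Lb, False), (La, True), (Lb, True), (La, False), (Lb, True), (La, True)]"
  have "ker_depth (Suc 0) ?w \<and> \<not> ker_depth 0 ?w" by (simp add: All_digit)
  then show ?case by blast
next
  case (Suc n)
  then obtain w where w: "ker_depth (Suc n) w" "\<not> ker_depth n w" by blast
  have "\<not> ker_depth n (wsec (phi w) One)" using w(2) by simp
  then have "\<not> ker_depth (Suc n) (phi w)" unfolding ker_depth.simps by blast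
  then show ?case using ker_depth_phi[OF w(1)] by blast
qed

text \<open>A finite presentation on generators X is carried over to the generators a and b: their
  relations would all follow from a finite set \<open>T\<close>. Such a set has bounded depth n, and
  depth n defines a normal subgroup, so all relations would have depth n, against
  \<open>ker_depth_strict\<close>.\<close>

lemma not_finitely_presented_Gamma: "\<not> finitely_presented Gamma"
proof
  assume "finitely_presented Gamma"
  then obtain X :: "nat set" and R \<theta> where fin: "finite R" and R: "R \<subseteq> carrier (free_group X)"
    and finX: "finite X" and \<theta>: "\<theta> \<in> iso (presented_group X R) Gamma"
    by (auto simp: finitely_presented_def finite_presentation_def is_iso_def)
  let ?P = "presented_group X R" and ?F = "free_group (UNIV :: ab set)" and ?gen = "presented_gen X R"
  interpret P: group ?P by (rule group_presented_group[OF R])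
  interpret Gam: group Gamma by (rule group_Gamma)
  interpret F: group ?F by (rule group_free_group)
  interpret FX: group "free_group X" by (rule group_free_group)
  have \<theta>_hom: "\<theta> \<in> hom ?P Gamma" and \<theta>_inj: "inj_on \<theta> (carrier ?P)" and \<theta>_surj: "\<theta> ` carrier ?P = carrier Gamma"
    using \<theta> by (auto simp: iso_def bij_betw_def)
  interpret \<theta>: group_hom ?P Gamma \<theta> using \<theta>_hom by unfold_locales
  have gen: "?gen \<in> X \<rightarrow> carrier ?P" by (rule presented_gen_closed[OF R])
  have "\<exists>u. reduced u \<and> act u = \<theta> (?gen x)" if x: "x \<in> X" for x
  proof -
    have "\<theta> (?gen x) \<in> carrier Gamma" using gen x by (auto intro: \<theta>.hom_closed)
    then obtain v where v: "\<theta> (?gen x) = act v" by (rule Gamma_cases)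
    have "act (act_free v []) = act v"
      using Gam.weval_act[OF gam_in_Gamma, of v "[]"] by (simp add: weval_Gamma)
    then show ?thesis using v reduced_act[of "[]" v] by force
  qed
  then obtain u where u: "\<And>x. x \<in> X \<Longrightarrow> reduced (u x) \<and> act (u x) = \<theta> (?gen x)" by metis
  then have uF: "u \<in> X \<rightarrow> carrier ?F" by auto
  define \<beta> where "\<beta> = weval ?F u"
  interpret \<beta>: group_hom "free_group X" ?F \<beta>
    unfolding \<beta>_def using F.weval_hom[OF uF] by unfold_locales
  have act_hom: "act \<in> hom ?F Gamma"
    using Gam.weval_hom[OF gam_in_Gamma] by (simp add: weval_Gamma[abs_def])
  have act_\<beta>: "act (\<beta> w) = \<theta> (weval ?P ?gen w)" if "w \<in> words X" for w
  proof -
    have "act (\<beta> w) = weval Gamma (act \<circ> u) w"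
      unfolding \<beta>_def by (rule F.hom_weval[OF group_Gamma act_hom uF that])
    also have "\<dots> = weval Gamma (\<theta> \<circ> ?gen) w" using that u by (intro weval_cong[of _ X]) auto
    also have "\<dots> = \<theta> (weval ?P ?gen w)"
      by (rule P.hom_weval[OF group_Gamma \<theta>_hom gen that, symmetric])
    finally show ?thesis .
  qed
  have "\<exists>v. v \<in> words X \<and> \<theta> (weval ?P ?gen v) = gam g" for g
  proof -
    have "gam g \<in> \<theta> ` carrier ?P" using \<theta>_surj gam_in_Gamma by auto
    then obtain p where p: "gam g = \<theta> p" "p \<in> carrier ?P" by (rule imageE)
    obtain v where "v \<in> words X" "p = weval ?P ?gen v" using presented_surj[OF R p(2)] .
    then show ?thesis using p(1) by auto
  qed
  then obtain v where v: "\<And>g. v g \<in> words X \<and> \<theta> (weval ?P ?gen (v g)) = gam g" by metis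
  define \<alpha>0 where "\<alpha>0 g = act_free (v g) []" for g
  have \<alpha>0F: "\<alpha>0 \<in> UNIV \<rightarrow> carrier (free_group X)"
    using v by (auto simp: \<alpha>0_def reduced_act intro!: act_words)
  define \<alpha> where "\<alpha> = weval (free_group X) \<alpha>0"
  interpret \<alpha>: group_hom ?F "free_group X" \<alpha>
    unfolding \<alpha>_def using FX.weval_hom[OF \<alpha>0F] by unfold_locales auto
  have \<alpha>0_eq: "\<theta> (weval ?P ?gen (\<alpha>0 g)) = gam g" for g
    using v[of g] P.weval_act[OF gen, of "v g" "[]"] P.weval_closed[OF gen] by (simp add: \<alpha>0_def)
  \<comment> \<open>The transported relators, and for each generator the word that equates it with
    its rewriting through X.\<close>
  define T where "T = \<beta> ` R \<union> range (\<lambda>g. (g, False) # \<beta> (\<alpha>0 g))"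
  have "finite (UNIV :: ab set)"
    by (rule finite_subset[of _ "{La, Lb}"]) (use ab.exhaust in blast, simp)
  then have "finite T" using fin by (simp add: T_def)
  have words_R: "r \<in> words X" if "r \<in> R" for r using R that by auto
  have words_\<alpha>0: "\<alpha>0 g \<in> words X" for g using \<alpha>0F by auto
  have "act s = id" if "s \<in> T" for s
  proof -
    have "act (\<beta> r) = id" if "r \<in> R" for r
      using act_\<beta>[OF words_R[OF that]] weval_relator[OF R that] \<theta>.hom_one by simp
    moreover have "act ((g, False) # \<beta> (\<alpha>0 g)) = id" for g
      using act_\<beta>[OF words_\<alpha>0[of g]] lact_flip[of "(g, False)"] by (auto simp: \<alpha>0_eq gam_lact)
    ultimately show ?thesis using that by (auto simp: T_def)
  qed
  then have "\<forall>s\<in>T. \<exists>n. ker_depth n s" using ker_depth_exists by blast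
  then obtain d where d: "\<And>s. s \<in> T \<Longrightarrow> ker_depth (d s) s" by metis
  define n where "n = Max (d ` T)"
  have n: "ker_depth n s" if "s \<in> T" for s
    using ker_depth_mono[OF _ d[OF that], of n] \<open>finite T\<close> that by (simp add: n_def)
  define N where "N = {w \<in> carrier ?F. ker_depth n w}"
  have inv_F: "inv\<^bsub>?F\<^esub> w = act_free (winv w) []" if "w \<in> carrier ?F" for w
    using that act_winv[of "[]" w] by (intro F.inv_equality) (auto simp: act_assoc act_reduced reduced_act)
  have N: "N \<lhd> ?F"
    unfolding F.normal_inv_iff
  proof (intro conjI ballI F.subgroupI)
    fix w x assume w: "w \<in> carrier ?F" "x \<in> N"
    have "ker_depth n (w @ x @ winv w)" using w by (intro ker_depth_conj) (simp add: N_def)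
    then have "ker_depth n (act_free (act_free w x) (act_free (winv w) []))"
      using ker_depth_act_free'[of n "act_free w x" "winv w" "[]" "[]"]
        ker_depth_act_free'[of n "[]" w x "winv w"] by (simp add: ker_depth_act_free)
    then show "w \<otimes>\<^bsub>?F\<^esub> x \<otimes>\<^bsub>?F\<^esub> inv\<^bsub>?F\<^esub> w \<in> N"
      using w inv_F[OF w(1)] by (auto simp: N_def reduced_act)
  next
    fix x y assume "x \<in> N" "y \<in> N"
    then show "x \<otimes>\<^bsub>?F\<^esub> y \<in> N"
      using ker_depth_act_free[of n x y] by (auto simp: N_def reduced_act ker_depth_append)
  next
    fix x assume "x \<in> N"
    then show "inv\<^bsub>?F\<^esub> x \<in> N"
      using ker_depth_act_free[of n "winv x" "[]"] inv_F[of x]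
      by (auto simp: N_def reduced_act ker_depth_winv)
  qed (auto simp: N_def intro!: exI[of _ "[]"])
  interpret N: normal N ?F by (rule N)
  have "normal_closure (free_group X) R \<subseteq> {w \<in> carrier (free_group X). \<beta> w \<in> N}"
  proof (rule normal_closure_minimal[OF \<beta>.vimage_normal[OF N]])
    show "R \<subseteq> {w \<in> carrier (free_group X). \<beta> w \<in> N}"
      using R n \<beta>.hom_closed by (fastforce simp: N_def T_def)
  qed
  then have \<beta>N: "\<beta> w \<in> N" if "w \<in> carrier (free_group X)" "weval ?P ?gen w = \<one>\<^bsub>?P\<^esub>" for w
    using presented_eq_one[OF R that] by blast
  interpret Q: group "?F Mod N" by (rule N.factorgroup_is_group)
  have \<kappa>: "(#>\<^bsub>?F\<^esub>) N \<in> hom ?F (?F Mod N)" by (rule N.r_coset_hom_Mod)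
  have "ker_depth n w" if w: "act w = id" for w
  proof -
    let ?w = "act_free w []"
    have wF: "?w \<in> carrier ?F" by (simp add: reduced_act)
    have \<alpha>w: "\<alpha> ?w \<in> carrier (free_group X)" using \<alpha>.hom_closed[OF wF] .
    have "weval ?P ?gen (\<alpha> ?w) = weval ?P (weval ?P ?gen \<circ> \<alpha>0) ?w"
      unfolding \<alpha>_def by (rule FX.hom_weval[OF P.is_group P.weval_hom[OF gen] \<alpha>0F]) simp
    moreover have "weval ?P ?gen \<circ> \<alpha>0 \<in> UNIV \<rightarrow> carrier ?P"
      using P.weval_closed[OF gen words_\<alpha>0] by auto
    note P.hom_weval[OF group_Gamma \<theta>_hom this, of ?w]
    ultimately have "\<theta> (weval ?P ?gen (\<alpha> ?w)) = weval Gamma (\<theta> \<circ> (weval ?P ?gen \<circ> \<alpha>0)) ?w"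
      by simp
    also have "\<dots> = act ?w"
      unfolding weval_Gamma[symmetric] by (rule weval_cong[of _ UNIV]) (auto simp: \<alpha>0_eq)
    also have "\<dots> = id"
      using w Gam.weval_act[OF gam_in_Gamma, of w "[]"] by (simp add: weval_Gamma)
    finally have "\<theta> (weval ?P ?gen (\<alpha> ?w)) = \<theta> \<one>\<^bsub>?P\<^esub>" using \<theta>.hom_one by simp
    then have "weval ?P ?gen (\<alpha> ?w) = \<one>\<^bsub>?P\<^esub>"
      using \<alpha>w by (intro inj_onD[OF \<theta>_inj] P.weval_closed[OF gen]) auto
    then have \<beta>\<alpha>: "\<beta> (\<alpha> ?w) \<in> N" using \<beta>N \<alpha>w by blast
    \<comment> \<open>By the second kind of words in \<open>T\<close>, the composite of \<alpha> and
      \<beta> fixes the generators modulo \<open>N\<close>, hence is the identity there; this brings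
      \<open>?w\<close> itself into \<open>N\<close>.\<close>
    have gens: "N #>\<^bsub>?F\<^esub> \<beta> (\<alpha>0 g) = N #>\<^bsub>?F\<^esub> free_gen g" for g
    proof -
      let ?m = "push (g, False) (\<beta> (\<alpha>0 g))"
      have b: "\<beta> (\<alpha>0 g) \<in> carrier ?F" using \<alpha>0F by (intro \<beta>.hom_closed) blast
      have "ker_depth n ?m"
        using n[of "(g, False) # \<beta> (\<alpha>0 g)"] ker_depth_push[of n "[]" "(g, False)" "\<beta> (\<alpha>0 g)" "[]"]
        by (auto simp: T_def)
      then have m: "?m \<in> N" using b by (simp add: N_def reduced_push)
      have "free_gen g \<otimes>\<^bsub>?F\<^esub> ?m = \<beta> (\<alpha>0 g)"
        using push_flip'[of "\<beta> (\<alpha>0 g)" "(g, True)"] b by (simp add: free_gen_def)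
      moreover have "N #>\<^bsub>?F\<^esub> (free_gen g \<otimes>\<^bsub>?F\<^esub> ?m) = (N #>\<^bsub>?F\<^esub> free_gen g) \<otimes>\<^bsub>?F Mod N\<^esub> (N #>\<^bsub>?F\<^esub> ?m)"
        using m free_gen_carrier[of g UNIV] by (intro hom_mult[OF \<kappa>]) (auto simp: N_def)
      moreover have "N #>\<^bsub>?F\<^esub> ?m = \<one>\<^bsub>?F Mod N\<^esub>" using m N.rcos_const by simp
      ultimately show ?thesis
        using Q.r_one[OF hom_in_carrier[OF \<kappa> free_gen_carrier[of g UNIV]]] by simp
    qed
    have \<beta>\<alpha>0: "\<beta> \<circ> \<alpha>0 \<in> UNIV \<rightarrow> carrier ?F"
      using \<alpha>0F by (auto simp del: free_group_simps intro!: \<beta>.hom_closed)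
    have "\<beta> (\<alpha> ?w) = weval ?F (\<beta> \<circ> \<alpha>0) ?w"
      unfolding \<alpha>_def by (rule FX.hom_weval[OF F.is_group \<beta>.homh \<alpha>0F]) simp
    then have "N #>\<^bsub>?F\<^esub> \<beta> (\<alpha> ?w) = weval (?F Mod N) ((#>\<^bsub>?F\<^esub>) N \<circ> (\<beta> \<circ> \<alpha>0)) ?w"
      using F.hom_weval[OF Q.is_group \<kappa> \<beta>\<alpha>0, of ?w] by simp
    also have "\<dots> = weval (?F Mod N) ((#>\<^bsub>?F\<^esub>) N \<circ> free_gen) ?w"
      by (rule weval_cong[of _ UNIV]) (auto simp: gens)
    also have "\<dots> = N #>\<^bsub>?F\<^esub> weval ?F free_gen ?w"
      by (rule F.hom_weval[OF Q.is_group \<kappa> free_gen_funcset, symmetric]) simp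
    also have "weval ?F free_gen ?w = ?w" using wF by (intro weval_free_group)
    finally have "N #>\<^bsub>?F\<^esub> ?w = N" using N.rcos_const[OF F.is_group \<beta>\<alpha>] by simp
    then have "?w \<in> N" using F.rcos_self[OF wF N.subgroup_axioms] by simp
    then show ?thesis using ker_depth_act_free[of n w "[]"] by (simp add: N_def)
  qed
  then show False using ker_depth_strict[of n] ker_depth_act by blast
qed

subsection \<open>An endomorphic presentation\<close>

definition (in group) cm :: "'a \<Rightarrow> 'a \<Rightarrow> bool" where
  "cm x y \<longleftrightarrow> x \<otimes> y = y \<otimes> x"

context group
begin

lemma inv_cancel:
  assumes "x \<in> carrier G" "y \<in> carrier G"
  shows "x \<otimes> (inv x \<otimes> y) = y" "inv x \<otimes> (x \<otimes> y) = y"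
  using assms by (simp_all add: m_assoc[symmetric])

lemma cm_sym: "cm x y \<Longrightarrow> cm y x"
  by (simp add: cm_def)

lemma cm_mult:
  "cm x y \<Longrightarrow> cm x z \<Longrightarrow> x \<in> carrier G \<Longrightarrow> y \<in> carrier G \<Longrightarrow> z \<in> carrier G \<Longrightarrow> cm x (y \<otimes> z)"
  unfolding cm_def by (metis m_assoc)

lemma cm_inv: "cm x y \<Longrightarrow> x \<in> carrier G \<Longrightarrow> y \<in> carrier G \<Longrightarrow> cm x (inv y)"
  unfolding cm_def by (metis inv_closed inv_solve_left inv_solve_right m_assoc m_closed)

lemma cm_pow: "cm x y \<Longrightarrow> x \<in> carrier G \<Longrightarrow> y \<in> carrier G \<Longrightarrow> cm x (y [^] (n :: nat))"
  by (induction n) (auto simp: cm_mult, simp add: cm_def)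

lemma cm_conj:
  assumes "cm x y" "x \<in> carrier G" "y \<in> carrier G" "g \<in> carrier G"
  shows "cm (g \<otimes> x \<otimes> inv g) (g \<otimes> y \<otimes> inv g)"
proof -
  have *: "(g \<otimes> x \<otimes> inv g) \<otimes> (g \<otimes> y \<otimes> inv g) = g \<otimes> (x \<otimes> y) \<otimes> inv g"
    if "x \<in> carrier G" "y \<in> carrier G" for x y
    using that assms(4) by (simp add: m_assoc inv_cancel)
  show ?thesis using assms *[of x y] *[of y x] by (simp add: cm_def)
qed

end

section \<open>Rebuilding an element from its two sections\<close>

primrec gen2 :: "'a \<Rightarrow> 'a \<Rightarrow> ab \<Rightarrow> 'a" where
  "gen2 a b La = a"
| "gen2 a b Lb = b"

text \<open>\<open>p i\<close> stands for the i-th power of a; keeping it abstract lets powers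
  normalise by adding exponents. The last assumption collects the relations that the rewriting by
  sections consumes.\<close>

locale power_family = group +
  fixes p :: "int \<Rightarrow> 'a" and b :: 'a
  assumes p_closed [simp]: "p i \<in> carrier G"
    and p_add: "p i \<otimes> p j = p (i + j)"
    and p_0: "p 0 = \<one>"
    and b_closed [simp]: "b \<in> carrier G"
    and b_cm: "odd m \<Longrightarrow> cm b (p m \<otimes> b \<otimes> p (- m))"
begin

abbreviation V :: "word \<Rightarrow> 'a" where
  "V \<equiv> weval G (gen2 (p 1) b)"

lemma gen2_closed: "gen2 (p 1) b \<in> UNIV \<rightarrow> carrier G"
proof
  fix x show "gen2 (p 1) b x \<in> carrier G" by (cases x) auto
qed

lemma V_closed [simp]: "V w \<in> carrier G"
  using weval_closed[OF gen2_closed] by simp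

lemma V_append [simp]: "V (u @ w) = V u \<otimes> V w"
  using weval_append[OF gen2_closed] by simp

lemma p_add': "x \<in> carrier G \<Longrightarrow> p i \<otimes> (p j \<otimes> x) = p (i + j) \<otimes> x"
  by (simp add: m_assoc[symmetric] p_add)

lemma p_inv: "inv p i = p (- i)"
  by (rule inv_equality) (auto simp: p_add p_0)

lemmas p_simps = m_assoc p_add p_add' p_0 p_inv inv_cancel inv_mult_group

lemma leval_simps [simp]:
  "leval G (gen2 (p 1) b) (La, e) = p (if e then 1 else - 1)"
  "leval G (gen2 (p 1) b) (Lb, e) = (if e then b else inv b)"
  by (simp_all add: leval_def p_inv)

text \<open>\<open>phi x\<close> is a word in b and a^2. Once its exponent of a is cancelled it is a
  product of conjugates of b^+-1 by even powers of a, and the outer conjugation makes these powers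
  odd. In the induction a letter a of \<open>x\<close> adds one such factor, and a letter b shifts
  \<open>m\<close> by 2.\<close>

lemma cm_section:
  "odd m \<Longrightarrow> cm b (p m \<otimes> p (- 2 * ex Lb x) \<otimes> V (phi x) \<otimes> p (- m))"
proof (induction x arbitrary: m rule: rev_induct)
  case Nil
  then show ?case by (simp add: p_simps cm_def)
next
  case (snoc l x)
  obtain g e where l: "l = (g, e)" by fastforce
  show ?case
  proof (cases g)
    case La
    let ?u = "p m \<otimes> p (- 2 * ex Lb x) \<otimes> V (phi x) \<otimes> p (- m)"
    have "cm b (?u \<otimes> (p m \<otimes> b \<otimes> p (- m)))" "cm b (?u \<otimes> inv (p m \<otimes> b \<otimes> p (- m)))"
      by (rule cm_mult[OF snoc.IH[OF snoc.prems] b_cm[OF snoc.prems]], simp_all)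
        (rule cm_mult[OF snoc.IH[OF snoc.prems, simplified] cm_inv[OF b_cm[OF snoc.prems]]], simp_all)
    then show ?thesis using l La by (cases e) (simp_all add: p_simps)
  next
    case Lb
    have "cm b (p (m - 2) \<otimes> p (- 2 * ex Lb x) \<otimes> V (phi x) \<otimes> p (- (m - 2)))"
      "cm b (p (m + 2) \<otimes> p (- 2 * ex Lb x) \<otimes> V (phi x) \<otimes> p (- (m + 2)))"
      using snoc.IH[of "m - 2"] snoc.IH[of "m + 2"] snoc.prems by auto
    then show ?thesis using l Lb by (cases e) (simp_all add: p_simps algebra_simps)
  qed
qed

text \<open>This models the element with section 1 at \<open>One\<close> and y b^-k at
  \<open>Two\<close>, where k = \<open>ex Lb y\<close>: conjugated by a, \<open>phi y\<close> has
  sections b^k and y, and a^(-2k) has both sections b^-k.\<close>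

definition S :: "word \<Rightarrow> 'a" where
  "S y = p 1 \<otimes> V (phi y) \<otimes> p (- 1 - 2 * ex Lb y)"

lemma S_B [simp]: "S (y @ [(Lb, e)]) = S y"
  by (cases e) (simp_all add: S_def p_simps algebra_simps)

text \<open>In \<Gamma> both sides have the same sections and the same action on the first level.
  The point is that the equation already follows from the assumptions of the locale, letter by
  letter.\<close>

lemma V_sections:
  "(wpos w One = One \<longrightarrow> V w = S (wsec w Two) \<otimes> V (phi (wsec w One))) \<and>
   (wpos w One = Two \<longrightarrow> V w = S (wsec w Two) \<otimes> V (phi (wsec w One)) \<otimes> p (- 1))"
proof (induction w rule: rev_induct)
  case Nil
  then show ?case by (simp add: S_def p_simps)
next
  case (snoc l w)
  have S_closed: "S y \<in> carrier G" for y by (simp add: S_def)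
  note simps = p_simps S_closed
  obtain g e where l: "l = (g, e)" by fastforce
  define x y where "x = wsec w One" and "y = wsec w Two"
  consider "wpos w One = One" "wpos w Two = Two" | "wpos w One = Two" "wpos w Two = One"
    using wpos_inj[of w One Two] by (cases "wpos w One"; cases "wpos w Two") auto
  then show ?case
  proof cases
    case 1
    then have IH: "V w = S y \<otimes> V (phi x)" using snoc by (simp add: x_def y_def)
    show ?thesis
      using 1 IH l by (cases g; cases e) (simp_all add: simps flip: x_def y_def)
  next
    case 2
    then have IH: "V w = S y \<otimes> V (phi x) \<otimes> p (- 1)" using snoc by (simp add: x_def y_def)
    show ?thesis
    proof (cases g)
      case La
      then show ?thesis using 2 IH l by (cases e) (simp_all add: simps flip: x_def y_def)
    next
      case Lb
      \<comment> \<open>Here alone the commutation is used: the letter b is read by the vertex that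
        started at \<open>Two\<close>, so it extends \<open>y\<close> and has to move left past the
        factor contributed by \<open>x\<close>. The exponents differ by one because the two vertices
        are exchanged.\<close>
      have e: "ex Lb x = ex Lb y + 1"
        using ex_A[of w One] ex_A[of w Two] 2 by (simp add: x_def y_def)
      have *: "cm b (p 1 \<otimes> p (- 2 * ex Lb x) \<otimes> V (phi x) \<otimes> p (- 1))"
        using cm_section[of 1 x] by simp
      have "cm (inv b) (p 1 \<otimes> p (- 2 * ex Lb x) \<otimes> V (phi x) \<otimes> p (- 1))"
        by (intro cm_sym[OF cm_inv[OF cm_sym[OF *]]]) simp_all
      with * have c: "cm \<beta> (p 1 \<otimes> p (- 2 * ex Lb x) \<otimes> V (phi x) \<otimes> p (- 1))"
        "\<beta> \<in> carrier G" if "\<beta> = V [(Lb, e)]" for \<beta>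
        using that by (cases e; simp)+
      define \<beta> where "\<beta> = V [(Lb, e)]"
      have S': "S (y @ [(La, e)]) = p 1 \<otimes> V (phi y) \<otimes> \<beta> \<otimes> p (- 1 - 2 * ex Lb y)"
        by (simp add: S_def \<beta>_def p_simps)
      have "V (w @ [l]) = p 1 \<otimes> V (phi y) \<otimes> ((p 1 \<otimes> p (- 2 * ex Lb x) \<otimes> V (phi x) \<otimes> p (- 1)) \<otimes> \<beta>)"
        using IH l Lb e by (simp add: S_def simps \<beta>_def)
      also have "\<dots> = S (y @ [(La, e)]) \<otimes> V (phi x) \<otimes> p (- 1)"
        using c[OF \<beta>_def] e unfolding cm_def S' by (simp add: simps)
      finally show ?thesis using 2 l Lb by (simp add: flip: x_def y_def)
    qed
  qed
qed

end

context group
begin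

text \<open>The hypotheses give \<open>d\<close> commuting with \<open>a\<^sup>2\<close> such that \<open>a\<^sup>2\<^sup>j b a\<^sup>-\<^sup>2\<^sup>j = d\<^sup>j b\<close>.\<close>

lemma cm_odd_conj:
  assumes [simp]: "a \<in> carrier G" "b \<in> carrier G"
    and c1: "cm b (a \<otimes> b \<otimes> inv a)" and c2: "cm (a \<otimes> a) (b \<otimes> (a \<otimes> a) \<otimes> inv b)"
    and m: "odd (m :: int)"
  shows "cm b (a [^] m \<otimes> b \<otimes> a [^] (- m))"
proof -
  define c where "c i = a [^] i \<otimes> b \<otimes> a [^] (- i)" for i :: int
  have c_closed [simp]: "c i \<in> carrier G" for i by (simp add: c_def)
  have conj_c: "a [^] k \<otimes> c i \<otimes> inv (a [^] k) = c (k + i)" for i k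
    by (simp add: c_def m_assoc int_pow_mult[symmetric] flip: int_pow_neg)
      (simp add: m_assoc[symmetric] int_pow_mult[symmetric] minus_diff_commute)
  have shift: "cm (c (k + i)) (c (k + j))" if "cm (c i) (c j)" for i j k
    using cm_conj[OF that, of "a [^] k"] by (simp add: conj_c)
  have c_0: "c 0 = b" and c_1: "c 1 = a \<otimes> b \<otimes> inv a"
    by (simp_all add: c_def int_pow_neg)
  define q where "q = a \<otimes> a"
  have [simp]: "q \<in> carrier G" by (simp add: q_def)
  have q: "q = a [^] (2::int)" using int_pow_mult[of a 1 1] by (simp add: q_def)
  define d where "d = q \<otimes> inv (b \<otimes> q \<otimes> inv b)"
  have [simp]: "d \<in> carrier G" by (simp add: d_def)
  have qd: "cm q d"
    unfolding d_def using cm_mult[OF _ cm_inv[OF c2[folded q_def]], of q]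
    by (simp add: cm_def)
  have c_2: "c 2 = d \<otimes> b"
    by (simp add: c_def d_def int_pow_neg m_assoc inv_mult_group flip: q)
  have c_even: "c (2 * int j) = d [^] j \<otimes> b" for j
  proof (induction j)
    case (Suc j)
    have "c (2 * int (Suc j)) = q \<otimes> c (2 * int j) \<otimes> inv q"
      using conj_c[of 2 "2 * int j"] by (simp add: q algebra_simps)
    also have "\<dots> = d [^] j \<otimes> (q \<otimes> b \<otimes> inv q)"
      using Suc cm_pow[OF qd, of j] by (simp add: cm_def m_assoc) (simp add: m_assoc[symmetric])
    also have "q \<otimes> b \<otimes> inv q = d \<otimes> b"
      using conj_c[of 2 0] by (simp add: c_0 c_2 q)
    finally show ?case by (simp add: m_assoc)
  qed (simp add: c_0)
  have c01: "cm (c 0) (c 1)" using c1 by (simp add: c_0 c_1)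
  \<comment> \<open>\<open>c 1\<close> commutes with its neighbours \<open>c 0\<close>, which is b,
    and \<open>c 2\<close>, which is d b; hence it commutes with d and with all even
    \<open>c\<close>.\<close>
  have "cm (c 1) d"
  proof -
    have "cm (c 1) (c 2)" "cm (c 1) (inv b)"
      using shift[OF c01, of 1] cm_inv[OF cm_sym[OF c01]] by (simp_all add: c_0)
    then have "cm (c 1) (c 2 \<otimes> inv b)" by (rule cm_mult) auto
    then show ?thesis by (simp add: c_2 m_assoc)
  qed
  then have "cm (c 1) (c (2 * int j))" for j
    unfolding c_even using cm_sym[OF c01] by (intro cm_mult cm_pow) (auto simp: c_0)
  then have *: "cm (c 0) (c (2 * int j - 1))" for j
    using shift[of 1 "2 * int j" "- 1"] by (simp add: algebra_simps)
  have pos: "cm (c 0) (c i)" if "odd i" "i > 0" for i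
  proof -
    have "i = 2 * ((i + 1) div 2) - 1" using that(1) by presburger
    then have "i = 2 * int (nat ((i + 1) div 2)) - 1" using that(2) by simp
    then show ?thesis using * by metis
  qed
  have "cm (c 0) (c m)"
  proof (cases "m > 0")
    case False
    then have "cm (c 0) (c (- m))" using m by (intro pos) (auto intro: odd_pos, presburger)
    then show ?thesis using shift[of 0 "- m" m] cm_sym by simp
  qed (use pos m in blast)
  then show ?thesis by (simp add: c_0) (simp add: c_def)
qed

text \<open>By \<open>V_sections\<close> a relation equals an expression in \<open>phi\<close> of
  its two sections, and \<open>phi\<close> acts on values as conjugation by t. The sections have
  value 1 by induction and exponents 0 by \<open>ex_kernel\<close>, so the expression collapses to
  1.\<close>

lemma kernel_relations:
  assumes [simp]: "a \<in> carrier G" "b \<in> carrier G" "t \<in> carrier G"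
    and at: "inv t \<otimes> a \<otimes> t = b" and bt: "inv t \<otimes> b \<otimes> t = a \<otimes> a"
    and cm: "cm b (a \<otimes> b \<otimes> inv a)" and w: "act w = id"
  shows "weval G (gen2 a b) w = \<one>"
proof -
  have conj_mult: "inv t \<otimes> (x \<otimes> y) \<otimes> t = (inv t \<otimes> x \<otimes> t) \<otimes> (inv t \<otimes> y \<otimes> t)"
    if "x \<in> carrier G" "y \<in> carrier G" for x y
    using that by (simp add: m_assoc inv_cancel)
  have conj_inv: "inv t \<otimes> inv x \<otimes> t = inv (inv t \<otimes> x \<otimes> t)" if "x \<in> carrier G" for x
    using that by (simp add: m_assoc inv_mult_group)
  \<comment> \<open>Conjugating the given commutation by t yields the second one that
    \<open>cm_odd_conj\<close> asks for; the two together yield all odd conjugates.\<close>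
  have "cm (inv t \<otimes> b \<otimes> inv (inv t)) (inv t \<otimes> (a \<otimes> b \<otimes> inv a) \<otimes> inv (inv t))"
    by (rule cm_conj[OF cm]) simp_all
  also have "inv t \<otimes> (a \<otimes> b \<otimes> inv a) \<otimes> inv (inv t) = b \<otimes> (a \<otimes> a) \<otimes> inv b"
    by (simp add: conj_mult conj_inv at bt)
  finally have cm2: "cm (a \<otimes> a) (b \<otimes> (a \<otimes> a) \<otimes> inv b)" by (simp add: bt)
  interpret power_family G "\<lambda>i. a [^] i" b
    using cm_odd_conj[OF _ _ cm cm2]
    by unfold_locales (simp_all add: int_pow_mult)
  have V_phi: "V (phi w) = inv t \<otimes> V w \<otimes> t" for w
  proof (induction w)
    case (Cons l w)
    have "V (phil l) = inv t \<otimes> V [l] \<otimes> t"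
      using at bt conj_inv[of a] conj_inv[of b] int_pow_mult[of a 1 1] int_pow_mult[of a "- 1" "- 1"]
      by (cases l; cases "fst l"; cases "snd l") (simp_all add: int_pow_neg leval_def inv_mult_group)
    then show ?case using Cons conj_mult[OF V_closed[of "[l]"] V_closed[of w]] V_append[of "[l]" w] V_append[of "phil l" "phi w"]
      by (simp del: weval.simps V_append)
  qed simp
  have "V w = \<one>"
    using w
  proof (induction rule: kernel_induct)
    case (cancel u l v)
    have "V [l, flip l] = \<one>"
      using leval_flip[OF gen2_closed, of l] leval_closed[OF gen2_closed, of l] by simp
    then have "V ([l, flip l] @ v) = V v" using V_append[of "[l, flip l]" v] V_closed[of v] by (simp del: weval.simps)
    then show ?case using cancel V_append[of u "[l, flip l] @ v"] V_append[of u v] by simp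
  next
    case (sections w)
    then have "wpos w One = One" "act (wsec w Two) = id" using act_eq_id_iff[of w] by auto
    then show ?case
      using sections V_sections[of w] ex_kernel[of "wsec w Two" Lb]
        V_phi[of "wsec w One"] V_phi[of "wsec w Two"]
      by (simp add: S_def int_pow_neg)
  qed simp
  then show ?thesis by simp
qed

end

section \<open>The group \<open>\<Delta>\<close>\<close>

lemma (in group_hom) hom_conj_by:
  "x \<in> carrier G \<Longrightarrow> y \<in> carrier G \<Longrightarrow> h (conj_by G x y) = conj_by H (h x) (h y)"
  by (simp add: conj_by_def)

lemma (in group_hom) hom_commutator:
  "x \<in> carrier G \<Longrightarrow> y \<in> carrier G \<Longrightarrow> h (commutator G x y) = commutator H (h x) (h y)"
  by (simp add: commutator_def)

context group
begin

lemma conj_by_closed [simp]: "x \<in> carrier G \<Longrightarrow> y \<in> carrier G \<Longrightarrow> conj_by G x y \<in> carrier G"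
  by (simp add: conj_by_def)

lemma commutator_closed [simp]:
  "x \<in> carrier G \<Longrightarrow> y \<in> carrier G \<Longrightarrow> commutator G x y \<in> carrier G"
  by (simp add: commutator_def)

lemma cm_inv_iff: "x \<in> carrier G \<Longrightarrow> y \<in> carrier G \<Longrightarrow> cm (inv x) y \<longleftrightarrow> cm x y"
  by (metis cm_sym cm_inv inv_inv inv_closed)

lemma commutator_eq_one_iff:
  assumes "x \<in> carrier G" "y \<in> carrier G"
  shows "commutator G x y = \<one> \<longleftrightarrow> cm x y"
proof -
  have "commutator G x y = inv (y \<otimes> x) \<otimes> (x \<otimes> y)"
    using assms by (simp add: commutator_def inv_mult_group m_assoc)
  moreover have "inv (y \<otimes> x) \<otimes> (x \<otimes> y) = \<one> \<longleftrightarrow> x \<otimes> y = y \<otimes> x"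
    using assms inv_solve_left[of \<one> "y \<otimes> x" "x \<otimes> y"] by auto
  ultimately show ?thesis by (simp add: cm_def)
qed

lemma mult_inv_eq_one_iff: "x \<in> carrier G \<Longrightarrow> y \<in> carrier G \<Longrightarrow> x \<otimes> inv y = \<one> \<longleftrightarrow> x = y"
  using inv_solve_right[of \<one> x y] by auto

lemma weval_group_hom: "f \<in> X \<rightarrow> carrier G \<Longrightarrow> group_hom (free_group X) G (weval G f)"
  using group_free_group[of X] weval_hom[of f X] is_group
  unfolding group_hom_def group_hom_axioms_def by blast

end

subsection \<open>Adjoining a letter\<close>

context
  fixes G :: "('a, 'b) monoid_scheme" and R
  assumes G: "group G" and R: "R \<subseteq> carrier (letter_free G)"
begin

interpretation G: group G by (rule G)
interpretation F: group "letter_free G" unfolding letter_free_def by (rule group_free_group)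

lemma letter_gen_closed:
  "free_gen None \<in> carrier (letter_free G)" "g \<in> carrier G \<Longrightarrow> free_gen (Some g) \<in> carrier (letter_free G)"
  unfolding letter_free_def by (intro free_gen_carrier; simp add: letter_gens_def)+

lemma adjoin_relators: "mult_table G \<union> R \<subseteq> carrier (free_group (letter_gens G))"
proof -
  have "mult_table G \<subseteq> carrier (letter_free G)"
    using letter_gen_closed by (auto simp: mult_table_def simp del: free_group_simps)
  then show ?thesis using R by (simp add: letter_free_def)
qed

lemma group_adjoin_letter: "group (adjoin_letter G R)"
  unfolding adjoin_letter_def by (rule group_presented_group[OF adjoin_relators])

lemma adjoin_gen_closed: "adjoin_gen G R \<in> letter_gens G \<rightarrow> carrier (adjoin_letter G R)"
  using presented_gen_closed[OF adjoin_relators] by (simp add: adjoin_letter_def adjoin_gen_def[abs_def])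

lemma adjoin_gen_hom: "(\<lambda>g. adjoin_gen G R (Some g)) \<in> hom G (adjoin_letter G R)"
proof (rule homI)
  interpret D: group "adjoin_letter G R" by (rule group_adjoin_letter)
  interpret e: group_hom "letter_free G" "adjoin_letter G R" "weval (adjoin_letter G R) (adjoin_gen G R)"
    unfolding letter_free_def by (rule D.weval_group_hom[OF adjoin_gen_closed])
  show closed: "adjoin_gen G R (Some g) \<in> carrier (adjoin_letter G R)" if "g \<in> carrier G" for g
    using adjoin_gen_closed that by (auto simp: letter_gens_def)
  have e: "weval (adjoin_letter G R) (adjoin_gen G R) (free_gen (Some g)) = adjoin_gen G R (Some g)"
    if "g \<in> carrier G" for g
    using that by (intro D.weval_gen[OF adjoin_gen_closed]) (simp add: letter_gens_def)
  fix g h assume gh: "g \<in> carrier G" "h \<in> carrier G"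
  let ?r = "free_gen (Some g) \<otimes>\<^bsub>letter_free G\<^esub> free_gen (Some h)
       \<otimes>\<^bsub>letter_free G\<^esub> inv\<^bsub>letter_free G\<^esub> free_gen (Some (g \<otimes>\<^bsub>G\<^esub> h))"
  have "?r \<in> mult_table G \<union> R" using gh by (auto simp: mult_table_def)
  from weval_relator[OF adjoin_relators this]
  have "weval (adjoin_letter G R) (adjoin_gen G R) ?r = \<one>\<^bsub>adjoin_letter G R\<^esub>"
    by (simp add: adjoin_letter_def adjoin_gen_def[abs_def])
  then have "adjoin_gen G R (Some g) \<otimes>\<^bsub>adjoin_letter G R\<^esub> adjoin_gen G R (Some h)
       \<otimes>\<^bsub>adjoin_letter G R\<^esub> inv\<^bsub>adjoin_letter G R\<^esub> adjoin_gen G R (Some (g \<otimes>\<^bsub>G\<^esub> h)) = \<one>\<^bsub>adjoin_letter G R\<^esub>"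
    using gh letter_gen_closed by (simp add: e)
  then show "adjoin_gen G R (Some (g \<otimes>\<^bsub>G\<^esub> h)) =
      adjoin_gen G R (Some g) \<otimes>\<^bsub>adjoin_letter G R\<^esub> adjoin_gen G R (Some h)"
    using closed gh by (simp add: D.mult_inv_eq_one_iff)
qed

lemma adjoin_hom_exists:
  assumes "group H" "h \<in> hom G H" "t \<in> carrier H"
    and "\<And>r. r \<in> R \<Longrightarrow> weval H (case_option t h) r = \<one>\<^bsub>H\<^esub>"
  obtains k where "k \<in> hom (adjoin_letter G R) H"
    "k (adjoin_gen G R None) = t" "\<And>g. g \<in> carrier G \<Longrightarrow> k (adjoin_gen G R (Some g)) = h g"
proof -
  interpret H: group H by fact
  interpret h: group_hom G H h using assms by unfold_locales
  have f: "case_option t h \<in> letter_gens G \<rightarrow> carrier H"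
    using assms(3) by (auto simp: letter_gens_def)
  interpret e: group_hom "letter_free G" H "weval H (case_option t h)"
    unfolding letter_free_def by (rule H.weval_group_hom[OF f])
  have e: "weval H (case_option t h) (free_gen (Some g)) = h g" if "g \<in> carrier G" for g
    using H.weval_gen[OF f, of "Some g"] that by (simp add: letter_gens_def)
  have "weval H (case_option t h) r = \<one>\<^bsub>H\<^esub>" if "r \<in> mult_table G \<union> R" for r
    using that assms(4) letter_gen_closed by (auto simp: mult_table_def e)
  from presented_hom_exists[OF adjoin_relators assms(1) f this]
  obtain k where k: "k \<in> hom (adjoin_letter G R) H"
    "\<And>x. x \<in> letter_gens G \<Longrightarrow> k (adjoin_gen G R x) = case_option t h x"
    by (auto simp: adjoin_letter_def adjoin_gen_def)
  show thesis
    by (rule that[OF k(1)]) (simp_all add: k(2) letter_gens_def)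
qed

lemma weval_adjoin:
  assumes "group H" "h \<in> hom G H" "t \<in> carrier H"
  shows "group_hom (letter_free G) H (weval H (case_option t h))"
    "weval H (case_option t h) (free_gen None) = t"
    "g \<in> carrier G \<Longrightarrow> weval H (case_option t h) (free_gen (Some g)) = h g"
proof -
  interpret H: group H by fact
  interpret h: group_hom G H h using assms by unfold_locales
  have f: "case_option t h \<in> letter_gens G \<rightarrow> carrier H"
    using assms(3) by (auto simp: letter_gens_def)
  show "group_hom (letter_free G) H (weval H (case_option t h))"
    unfolding letter_free_def by (rule H.weval_group_hom[OF f])
  show "weval H (case_option t h) (free_gen None) = t"
    "g \<in> carrier G \<Longrightarrow> weval H (case_option t h) (free_gen (Some g)) = h g"
    using H.weval_gen[OF f] by (simp_all add: letter_gens_def)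
qed

lemma adjoin_eta: "adjoin_gen G R = case_option (adjoin_gen G R None) (\<lambda>g. adjoin_gen G R (Some g))"
  by (auto split: option.splits)

lemma adjoin_relator_iff:
  assumes "r \<in> carrier (letter_free G)"
  shows "r \<in> normal_closure (letter_free G) (mult_table G \<union> R) \<longleftrightarrow>
    weval (adjoin_letter G R) (adjoin_gen G R) r = \<one>\<^bsub>adjoin_letter G R\<^esub>" 
proof
  let ?N = "normal_closure (letter_free G) (mult_table G \<union> R)"
  interpret N: normal ?N "letter_free G"
    using F.normal_closure_normal adjoin_relators by (simp add: letter_free_def)
  assume "r \<in> ?N"
  moreover have "weval (adjoin_letter G R) (adjoin_gen G R) r = ?N #>\<^bsub>letter_free G\<^esub> r"
    using weval_presented[OF adjoin_relators] assms
    by (simp add: adjoin_letter_def adjoin_gen_def[abs_def] letter_free_def)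
  ultimately show "weval (adjoin_letter G R) (adjoin_gen G R) r = \<one>\<^bsub>adjoin_letter G R\<^esub>"
    using N.rcos_const[OF F.is_group] by (simp add: adjoin_letter_def presented_group_def letter_free_def)
next
  assume "weval (adjoin_letter G R) (adjoin_gen G R) r = \<one>\<^bsub>adjoin_letter G R\<^esub>"
  then show "r \<in> normal_closure (letter_free G) (mult_table G \<union> R)"
    using presented_eq_one[OF adjoin_relators] assms
    by (simp add: adjoin_letter_def adjoin_gen_def[abs_def] letter_free_def)
qed

end

text \<open>Both groups are quotients of the same free group, so equal normal closures give equality
  and not just an isomorphism.\<close>

lemma adjoin_letter_eqI:
  assumes "group G" "R \<subseteq> carrier (letter_free G)" "R' \<subseteq> carrier (letter_free G)"
    and "\<And>r. r \<in> R \<Longrightarrow> weval (adjoin_letter G R') (adjoin_gen G R') r = \<one>\<^bsub>adjoin_letter G R'\<^esub>"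
    and "\<And>r. r \<in> R' \<Longrightarrow> weval (adjoin_letter G R) (adjoin_gen G R) r = \<one>\<^bsub>adjoin_letter G R\<^esub>"
  shows "adjoin_letter G R = adjoin_letter G R'"
proof -
  have *: "normal_closure (letter_free G) (mult_table G \<union> R) \<subseteq> normal_closure (letter_free G) (mult_table G \<union> R')"
    if "R \<subseteq> carrier (letter_free G)" "R' \<subseteq> carrier (letter_free G)"
      "\<And>r. r \<in> R \<Longrightarrow> weval (adjoin_letter G R') (adjoin_gen G R') r = \<one>\<^bsub>adjoin_letter G R'\<^esub>" for R R'
  proof (rule normal_closure_minimal)
    show "normal_closure (letter_free G) (mult_table G \<union> R') \<lhd> letter_free G"
      using group.normal_closure_normal[OF group_free_group adjoin_relators[OF assms(1) that(2)]]
      by (simp add: letter_free_def)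
    show "mult_table G \<union> R \<subseteq> normal_closure (letter_free G) (mult_table G \<union> R')"
      using that adjoin_relator_iff[OF assms(1) that(2)]
        normal_closure_superset[of "mult_table G \<union> R'" "letter_free G"] by blast
  qed
  have "normal_closure (letter_free G) (mult_table G \<union> R) = normal_closure (letter_free G) (mult_table G \<union> R')"
    using *[OF assms(2,3,4)] *[OF assms(3,2,5)] by blast
  then show ?thesis by (simp add: adjoin_letter_def presented_group_def letter_free_def)
qed

subsection \<open>The relations of \<open>\<Delta>\<close>\<close>

interpretation LF: group "letter_free Gamma" unfolding letter_free_def by (rule group_free_group)

lemma aut_in_Gamma [simp]: "aut_a \<in> carrier Gamma" "aut_b \<in> carrier Gamma"
  using gam_in_Gamma Pi_mem[of gam UNIV _ La] Pi_mem[of gam UNIV _ Lb] by auto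

lemmas letter_Gamma = letter_gen_closed[OF group_Gamma empty_subsetI]

lemma Delta_relators_closed: "Delta_relators \<subseteq> carrier (letter_free Gamma)"
  using letter_Gamma by (simp add: Delta_relators_def Let_def)

lemma group_Delta: "group Delta"
  unfolding Delta_def by (rule group_adjoin_letter[OF group_Gamma Delta_relators_closed])

interpretation Del: group Delta by (rule group_Delta)

lemma Delta_of_Gamma_hom: "Delta_of_Gamma \<in> hom Gamma Delta"
  unfolding Delta_def Delta_of_Gamma_def[abs_def] by (rule adjoin_gen_hom[OF group_Gamma Delta_relators_closed])

lemma Delta_t_closed [simp]: "Delta_t \<in> carrier Delta"
  using adjoin_gen_closed[OF group_Gamma Delta_relators_closed]
  by (auto simp: Delta_def Delta_t_def letter_gens_def)

interpretation iota: group_hom Gamma Delta Delta_of_Gamma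
  using Delta_of_Gamma_hom by unfold_locales

lemma eval_Delta_relators:
  assumes "group H" "h \<in> hom Gamma H" "t \<in> carrier H"
  shows "(\<forall>r\<in>Delta_relators. weval H (case_option t h) r = \<one>\<^bsub>H\<^esub>) \<longleftrightarrow>
    conj_by H (h aut_a) t = h aut_b \<and> conj_by H (h aut_b) t = h aut_a \<otimes>\<^bsub>H\<^esub> h aut_a"
proof -
  interpret H: group H by fact
  interpret h: group_hom Gamma H h using assms by unfold_locales
  note e = weval_adjoin[OF group_Gamma empty_subsetI assms]
  interpret e: group_hom "letter_free Gamma" H "weval H (case_option t h)" by (rule e(1))
  have "h aut_a [^]\<^bsub>H\<^esub> (2::nat) = h aut_a \<otimes>\<^bsub>H\<^esub> h aut_a" by (simp add: numeral_2_eq_2)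
  then show ?thesis
    using letter_Gamma assms
    by (simp add: Delta_relators_def Let_def e.hom_conj_by e.hom_nat_pow e(2,3) H.mult_inv_eq_one_iff)
qed

lemma Delta_hom_exists:
  assumes "group H" "h \<in> hom Gamma H" "t \<in> carrier H"
    and "conj_by H (h aut_a) t = h aut_b" "conj_by H (h aut_b) t = h aut_a \<otimes>\<^bsub>H\<^esub> h aut_a"
  obtains k where "k \<in> hom Delta H" "k Delta_t = t"
    "\<And>g. g \<in> carrier Gamma \<Longrightarrow> k (Delta_of_Gamma g) = h g"
proof (rule adjoin_hom_exists[OF group_Gamma Delta_relators_closed assms(1-3)])
  show "weval H (case_option t h) r = \<one>\<^bsub>H\<^esub>" if "r \<in> Delta_relators" for r
    using eval_Delta_relators[OF assms(1-3)] assms(4,5) that by blast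
qed (erule that[unfolded Delta_def Delta_t_def Delta_of_Gamma_def])

lemma Delta_gen_eta: "adjoin_gen Gamma Delta_relators = case_option Delta_t Delta_of_Gamma"
  by (auto simp: Delta_t_def Delta_of_Gamma_def split: option.splits)

lemma Delta_relations:
  "conj_by Delta (Delta_of_Gamma aut_a) Delta_t = Delta_of_Gamma aut_b"
  "conj_by Delta (Delta_of_Gamma aut_b) Delta_t = Delta_of_Gamma aut_a \<otimes>\<^bsub>Delta\<^esub> Delta_of_Gamma aut_a"
proof -
  have "weval Delta (case_option Delta_t Delta_of_Gamma) r = \<one>\<^bsub>Delta\<^esub>" if "r \<in> Delta_relators" for r
    using weval_relator[OF adjoin_relators[OF group_Gamma Delta_relators_closed], of r] that Delta_gen_eta
    by (simp add: Delta_def adjoin_letter_def adjoin_gen_def[abs_def])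
  then show "conj_by Delta (Delta_of_Gamma aut_a) Delta_t = Delta_of_Gamma aut_b"
  "conj_by Delta (Delta_of_Gamma aut_b) Delta_t = Delta_of_Gamma aut_a \<otimes>\<^bsub>Delta\<^esub> Delta_of_Gamma aut_a"
    using eval_Delta_relators[OF group_Delta Delta_of_Gamma_hom Delta_t_closed] by blast+
qed

lemma Gamma_hom_eqI:
  assumes "group H" "h \<in> hom Gamma H" "k \<in> hom Gamma H" "h aut_a = k aut_a" "h aut_b = k aut_b"
    and "g \<in> carrier Gamma"
  shows "h g = k g"
proof -
  obtain w where w: "g = act w" using assms(6) by (rule Gamma_cases)
  have eq: "h \<circ> gam = k \<circ> gam"
  proof
    fix x show "(h \<circ> gam) x = (k \<circ> gam) x" using assms(4,5) by (cases x) auto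
  qed
  show ?thesis
    using Gam.hom_weval[OF assms(1,2) gam_in_Gamma, of w] Gam.hom_weval[OF assms(1,3) gam_in_Gamma, of w]
    by (simp add: weval_Gamma eq w)
qed

lemma (in group) conj_by_hom: "t \<in> carrier G \<Longrightarrow> (\<lambda>x. conj_by G x t) \<in> hom G G"
  by (rule homI) (simp_all add: conj_by_def m_assoc inv_cancel)

lemma sig_in_Gamma [simp]: "sig g \<in> carrier Gamma"
  by (simp add: sig_def)

text \<open>Both sides are homomorphisms in g that agree on a and b. Thus the two relators of
  \<Delta> imply all relators of the HNN extension.\<close>

lemma conj_by_t:
  assumes "g \<in> carrier Gamma"
  shows "conj_by Delta (Delta_of_Gamma g) Delta_t = Delta_of_Gamma (sig g)"
proof -
  have "(\<lambda>x. conj_by Delta x Delta_t) \<circ> Delta_of_Gamma \<in> hom Gamma Delta"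
    "Delta_of_Gamma \<circ> sig \<in> hom Gamma Delta"
    by (rule hom_compose[OF Delta_of_Gamma_hom Del.conj_by_hom], simp)
      (rule hom_compose[OF sig_hom Delta_of_Gamma_hom])
  from Gamma_hom_eqI[OF group_Delta this _ _ assms] show ?thesis
    using Delta_relations iota.hom_mult[of aut_a aut_a] by (simp add: sig_gens numeral_2_eq_2)
qed

lemma Delta_eq_hnn: "Delta = hnn_extension Gamma (carrier Gamma) sig"
  unfolding Delta_def hnn_extension_def
proof (rule adjoin_letter_eqI[OF group_Gamma Delta_relators_closed])
  let ?R = "{conj_by (letter_free Gamma) (free_gen (Some g)) (free_gen None)
       \<otimes>\<^bsub>letter_free Gamma\<^esub> inv\<^bsub>letter_free Gamma\<^esub> free_gen (Some (sig g)) | g. g \<in> carrier Gamma}"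
  show R: "?R \<subseteq> carrier (letter_free Gamma)"
    using letter_Gamma by (auto simp del: free_group_simps)
  let ?D = "adjoin_letter Gamma ?R" and ?gen = "adjoin_gen Gamma ?R"
  have D: "group ?D" by (rule group_adjoin_letter[OF group_Gamma R])
  interpret D: group ?D by (rule D)
  have hom: "(\<lambda>g. ?gen (Some g)) \<in> hom Gamma ?D" by (rule adjoin_gen_hom[OF group_Gamma R])
  interpret h: group_hom Gamma ?D "\<lambda>g. ?gen (Some g)" using hom by unfold_locales
  have t: "?gen None \<in> carrier ?D"
    using adjoin_gen_closed[OF group_Gamma R] by (auto simp: letter_gens_def)
  note e = weval_adjoin[OF group_Gamma empty_subsetI D hom t, folded adjoin_eta[OF group_Gamma R]]
  interpret e: group_hom "letter_free Gamma" ?D "weval ?D ?gen" by (rule e(1))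
  have conj: "conj_by ?D (?gen (Some g)) (?gen None) = ?gen (Some (sig g))" if g: "g \<in> carrier Gamma" for g
  proof -
    let ?r = "conj_by (letter_free Gamma) (free_gen (Some g)) (free_gen None)
       \<otimes>\<^bsub>letter_free Gamma\<^esub> inv\<^bsub>letter_free Gamma\<^esub> free_gen (Some (sig g))"
    have "?r \<in> mult_table Gamma \<union> ?R" using g by blast
    from weval_relator[OF adjoin_relators[OF group_Gamma R] this]
    have "weval ?D ?gen ?r = \<one>\<^bsub>?D\<^esub>" unfolding adjoin_letter_def adjoin_gen_def[abs_def] .
    then show ?thesis
      using letter_Gamma g t by (simp add: e.hom_conj_by e(2,3) D.mult_inv_eq_one_iff)
  qed
  show "weval ?D ?gen r = \<one>\<^bsub>?D\<^esub>" if "r \<in> Delta_relators" for r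
    using that eval_Delta_relators[OF D hom t, folded adjoin_eta[OF group_Gamma R]]
      conj[of aut_a] conj[of aut_b] h.hom_mult[of aut_a aut_a]
    by (simp add: sig_gens numeral_2_eq_2)
  note e' = weval_adjoin[OF group_Gamma empty_subsetI group_Delta Delta_of_Gamma_hom Delta_t_closed,
      folded Delta_gen_eta]
  interpret e': group_hom "letter_free Gamma" Delta "weval Delta (adjoin_gen Gamma Delta_relators)"
    by (rule e'(1))
  show "weval (adjoin_letter Gamma Delta_relators) (adjoin_gen Gamma Delta_relators) r =
      \<one>\<^bsub>adjoin_letter Gamma Delta_relators\<^esub>" if r: "r \<in> ?R" for r
    unfolding Delta_def[symmetric]
  proof -
    obtain g where g: "g \<in> carrier Gamma" "r = conj_by (letter_free Gamma) (free_gen (Some g)) (free_gen None)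
       \<otimes>\<^bsub>letter_free Gamma\<^esub> inv\<^bsub>letter_free Gamma\<^esub> free_gen (Some (sig g))" using r by blast
    then show "weval Delta (adjoin_gen Gamma Delta_relators) r = \<one>\<^bsub>Delta\<^esub>"
      using letter_Gamma by (simp add: e'.hom_conj_by e'(2,3) conj_by_t)
  qed
qed

subsection \<open>The finite presentation of \<open>\<Delta>\<close>\<close>

primrec bt_case :: "'a \<Rightarrow> 'a \<Rightarrow> bt \<Rightarrow> 'a" where
  "bt_case b t Gen_b = b"
| "bt_case b t Gen_t = t"

interpretation FB: group "free_group {Gen_b, Gen_t}" by (rule group_free_group)

lemma bt_relators_closed: "bt_relators \<subseteq> carrier (free_group {Gen_b, Gen_t})"
  using free_gen_carrier[of _ "{Gen_b, Gen_t}"] unfolding bt_relators_def Let_def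
  by (simp del: free_group_simps)

context group
begin

text \<open>With a = t b t^-1, the first relator is b^t = a^2 conjugated once more by t. In the
  second, [b, t^-1] = b^-1 a and [b^-1 a, b] = a^-1 b^-1 a b; so it says that a^-1 b^-1 a commutes
  with b, and conjugation by a gives the form used in \<open>kernel_relations\<close>.\<close>

lemma eval_bt_relators:
  assumes [simp]: "b \<in> carrier G" "t \<in> carrier G"
  defines "a \<equiv> t \<otimes> b \<otimes> inv t"
  shows "(\<forall>r\<in>bt_relators. weval G (bt_case b t) r = \<one>) \<longleftrightarrow>
    inv t \<otimes> b \<otimes> t = a \<otimes> a \<and> cm b (a \<otimes> b \<otimes> inv a)"
proof -
  have a [simp]: "a \<in> carrier G" by (simp add: a_def)
  have f: "bt_case b t \<in> {Gen_b, Gen_t} \<rightarrow> carrier G" by auto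
  interpret e: group_hom "free_group {Gen_b, Gen_t}" G "weval G (bt_case b t)"
    by (rule weval_group_hom[OF f])
  have e: "weval G (bt_case b t) (free_gen Gen_b) = b" "weval G (bt_case b t) (free_gen Gen_t) = t"
    using weval_gen[OF f] by auto
  have c: "free_gen Gen_b \<in> carrier (free_group {Gen_b, Gen_t})"
    "free_gen Gen_t \<in> carrier (free_group {Gen_b, Gen_t})" by (intro free_gen_carrier; simp)+
  have "(\<forall>r\<in>bt_relators. weval G (bt_case b t) r = \<one>) \<longleftrightarrow>
     conj_by G b (t [^] (2::nat)) = b [^] (2::nat) \<and>
     cm (commutator G (commutator G b (inv t)) b) b"
    using c unfolding bt_relators_def Let_def
    by (simp del: free_group_simps add: e.hom_conj_by e.hom_commutator e.hom_nat_pow e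
        mult_inv_eq_one_iff commutator_eq_one_iff)
  moreover have "conj_by G b (t [^] (2::nat)) = b [^] (2::nat) \<longleftrightarrow> inv t \<otimes> b \<otimes> t = a \<otimes> a"
  proof -
    have "conj_by G b (t [^] (2::nat)) = inv t \<otimes> (inv t \<otimes> b \<otimes> t) \<otimes> t"
      by (simp add: conj_by_def numeral_2_eq_2 inv_mult_group m_assoc)
    moreover have "b [^] (2::nat) = inv t \<otimes> (a \<otimes> a) \<otimes> t"
      by (simp add: a_def numeral_2_eq_2 m_assoc inv_cancel)
    ultimately show ?thesis by simp
  qed
  moreover have "cm (commutator G (commutator G b (inv t)) b) b \<longleftrightarrow> cm b (a \<otimes> b \<otimes> inv a)"
  proof -
    have eq: "commutator G (commutator G b (inv t)) b = inv a \<otimes> inv b \<otimes> a \<otimes> b"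
      by (simp add: commutator_def a_def inv_mult_group m_assoc inv_cancel)
    have "cm (inv a \<otimes> inv b \<otimes> a \<otimes> b) b \<longleftrightarrow> cm (inv a \<otimes> inv b \<otimes> a) b"
    proof
      have bb: "cm b (inv b)" "cm b b" by (simp_all add: cm_def)
      show "cm (inv a \<otimes> inv b \<otimes> a) b" if "cm (inv a \<otimes> inv b \<otimes> a \<otimes> b) b"
        using cm_mult[OF cm_sym[OF that] bb(1)] by (simp add: m_assoc inv_cancel cm_sym)
      show "cm (inv a \<otimes> inv b \<otimes> a \<otimes> b) b" if "cm (inv a \<otimes> inv b \<otimes> a) b"
        using cm_mult[OF cm_sym[OF that] bb(2)] by (simp add: cm_sym)
    qed
    also have "\<dots> \<longleftrightarrow> cm (inv b) (a \<otimes> b \<otimes> inv a)"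
      using cm_conj[of "inv a \<otimes> inv b \<otimes> a" b a] cm_conj[of "inv b" "a \<otimes> b \<otimes> inv a" "inv a"]
      by (auto simp: m_assoc inv_cancel)
    also have "\<dots> \<longleftrightarrow> cm b (a \<otimes> b \<otimes> inv a)"
      by (rule cm_inv_iff) simp_all
    finally show ?thesis by (simp add: eq)
  qed
  ultimately show ?thesis by simp
qed

end

text \<open>b moves only words below \<open>One\<close>, and a b a^-1 only words below
  \<open>Two\<close>.\<close>

lemma Gamma_cm: "Gam.cm aut_b (aut_a \<otimes>\<^bsub>Gamma\<^esub> aut_b \<otimes>\<^bsub>Gamma\<^esub> inv\<^bsub>Gamma\<^esub> aut_a)"
proof -
  let ?u = "[(Lb, True), (La, True), (Lb, True), (La, False)]"
  let ?v = "[(La, True), (Lb, True), (La, False), (Lb, True)]"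
  have "wpos ?u x = wpos ?v x \<and> act (wsec ?u x) = act (wsec ?v x)" for x
    by (cases x) (auto simp: fun_eq_iff)
  then have "act ?u = act ?v" using act_eq_iff[of ?u ?v] by blast
  moreover have "inv\<^bsub>Gamma\<^esub> aut_a = inv_a" using inv_Gamma[of "[(La, True)]"] by simp
  ultimately show ?thesis by (simp add: Gam.cm_def comp_assoc)
qed

lemma presentation_iso:
  "\<exists>\<phi> \<in> iso (presented_group {Gen_b, Gen_t} bt_relators) Delta.
     \<phi> (presented_gen {Gen_b, Gen_t} bt_relators Gen_b) = Delta_of_Gamma aut_b \<and>
     \<phi> (presented_gen {Gen_b, Gen_t} bt_relators Gen_t) = Delta_t"
proof -
  let ?P = "presented_group {Gen_b, Gen_t} bt_relators" and ?gen = "presented_gen {Gen_b, Gen_t} bt_relators"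
  interpret P: group ?P by (rule group_presented_group[OF bt_relators_closed])
  define b t where "b = ?gen Gen_b" and "t = ?gen Gen_t"
  have gen: "?gen = bt_case b t"
  proof
    fix x show "?gen x = bt_case b t x" by (cases x) (auto simp: b_def t_def)
  qed
  have [simp]: "b \<in> carrier ?P" "t \<in> carrier ?P"
    using presented_gen_closed[OF bt_relators_closed] by (auto simp: b_def t_def)
  define a where "a = t \<otimes>\<^bsub>?P\<^esub> b \<otimes>\<^bsub>?P\<^esub> inv\<^bsub>?P\<^esub> t"
  have [simp]: "a \<in> carrier ?P" by (simp add: a_def)
  have rel: "inv\<^bsub>?P\<^esub> t \<otimes>\<^bsub>?P\<^esub> b \<otimes>\<^bsub>?P\<^esub> t = a \<otimes>\<^bsub>?P\<^esub> a" "P.cm b (a \<otimes>\<^bsub>?P\<^esub> b \<otimes>\<^bsub>?P\<^esub> inv\<^bsub>?P\<^esub> a)"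
    using P.eval_bt_relators[of b t] weval_relator[OF bt_relators_closed] gen by (simp_all add: a_def)
  have at: "inv\<^bsub>?P\<^esub> t \<otimes>\<^bsub>?P\<^esub> a \<otimes>\<^bsub>?P\<^esub> t = b" by (simp add: a_def P.m_assoc P.inv_cancel)
  have g2: "gen2 a b \<in> UNIV \<rightarrow> carrier ?P"
  proof
    fix x show "gen2 a b x \<in> carrier ?P" by (cases x) auto
  qed
  \<comment> \<open>The relators make a, b, t satisfy the hypotheses of
    \<open>kernel_relations\<close>, so evaluating words gives a well-defined map from \<Gamma> to
    the presented group.\<close>
  have kill: "weval ?P (gen2 a b) w = \<one>\<^bsub>?P\<^esub>" if "act w = id" for w
    using P.kernel_relations[OF _ _ _ at rel that] by simp
  define h where "h g = weval ?P (gen2 a b) (SOME w. act w = g)" for g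
  have h: "h (act w) = weval ?P (gen2 a b) w" for w
  proof -
    define u where "u = (SOME u. act u = act w)"
    have u: "act u = act w" unfolding u_def by (rule someI[of _ w]) simp
    then have "act (u @ winv w) = id" by (auto simp: fun_eq_iff)
    from kill[OF this] have "weval ?P (gen2 a b) u \<otimes>\<^bsub>?P\<^esub> inv\<^bsub>?P\<^esub> weval ?P (gen2 a b) w = \<one>\<^bsub>?P\<^esub>"
      by (simp add: P.weval_append[OF g2] P.weval_winv[OF g2])
    then show ?thesis
      using P.weval_closed[OF g2] by (simp add: P.mult_inv_eq_one_iff h_def flip: u_def)
  qed
  have h_hom: "h \<in> hom Gamma ?P"
  proof (rule homI)
    fix x assume "x \<in> carrier Gamma"
    then obtain u where u: "x = act u" by (rule Gamma_cases)
    then show "h x \<in> carrier ?P" using h P.weval_closed[OF g2] by simp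
    fix y assume "y \<in> carrier Gamma"
    then obtain w where "y = act w" by (rule Gamma_cases)
    then show "h (x \<otimes>\<^bsub>Gamma\<^esub> y) = h x \<otimes>\<^bsub>?P\<^esub> h y"
      using u h[of u] h[of w] h[of "u @ w"] P.weval_append[OF g2] by simp
  qed
  have hab: "h aut_a = a" "h aut_b = b"
    using h[of "[(La, True)]"] h[of "[(Lb, True)]"] by (simp_all add: leval_def)
  have "conj_by ?P (h aut_a) t = h aut_b" "conj_by ?P (h aut_b) t = h aut_a \<otimes>\<^bsub>?P\<^esub> h aut_a"
    using at rel by (simp_all add: hab conj_by_def)
  from Delta_hom_exists[OF P.is_group h_hom \<open>t \<in> carrier ?P\<close> this]
  obtain \<psi> where \<psi>: "\<psi> \<in> hom Delta ?P" "\<psi> Delta_t = t"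
      "\<And>g. g \<in> carrier Gamma \<Longrightarrow> \<psi> (Delta_of_Gamma g) = h g" by blast
  let ?\<iota> = Delta_of_Gamma
  have conj: "Delta_t \<otimes>\<^bsub>Delta\<^esub> ?\<iota> aut_b \<otimes>\<^bsub>Delta\<^esub> inv\<^bsub>Delta\<^esub> Delta_t = ?\<iota> aut_a"
    using iota.hom_closed[of aut_a]
    by (simp add: Delta_relations(1)[symmetric] conj_by_def Del.m_assoc Del.inv_cancel)
  have "Del.cm (?\<iota> aut_b) (?\<iota> aut_a \<otimes>\<^bsub>Delta\<^esub> ?\<iota> aut_b \<otimes>\<^bsub>Delta\<^esub> inv\<^bsub>Delta\<^esub> ?\<iota> aut_a)"
    using arg_cong[OF Gamma_cm[unfolded Gam.cm_def], of ?\<iota>]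
    by (simp del: Gamma_simps add: Del.cm_def)
  then have "\<forall>r\<in>bt_relators. weval Delta (bt_case (?\<iota> aut_b) Delta_t) r = \<one>\<^bsub>Delta\<^esub>"
    using Del.eval_bt_relators[of "?\<iota> aut_b" Delta_t] Delta_relations(2)
    by (simp add: conj conj_by_def)
  moreover have "bt_case (?\<iota> aut_b) Delta_t \<in> {Gen_b, Gen_t} \<rightarrow> carrier Delta" by auto
  ultimately obtain \<phi> where \<phi>: "\<phi> \<in> hom ?P Delta" "\<And>x. x \<in> {Gen_b, Gen_t} \<Longrightarrow> \<phi> (?gen x) = bt_case (?\<iota> aut_b) Delta_t x"
    using presented_hom_exists[OF bt_relators_closed group_Delta] by metis
  have \<phi>_b: "\<phi> b = ?\<iota> aut_b" and \<phi>_t: "\<phi> t = Delta_t" using \<phi>(2) by (simp_all add: b_def t_def)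
  interpret \<phi>: group_hom ?P Delta \<phi> using \<phi>(1) by unfold_locales
  have inv1: "\<psi> (\<phi> p) = p" if "p \<in> carrier ?P" for p
  proof -
    have "(\<psi> \<circ> \<phi>) p = id p"
    proof (rule presented_hom_eqI[OF bt_relators_closed P.is_group hom_compose[OF \<phi>(1) \<psi>(1)] _ _ that])
      show "id \<in> hom ?P ?P" by (auto simp: hom_def)
      fix x assume "x \<in> {Gen_b, Gen_t}"
      then show "(\<psi> \<circ> \<phi>) (?gen x) = id (?gen x)"
        using \<phi>_b \<phi>_t \<psi>(2,3) hab by (auto simp flip: b_def t_def)
    qed
    then show ?thesis by simp
  qed
  have \<phi>_a: "\<phi> a = ?\<iota> aut_a" by (simp add: a_def \<phi>_b \<phi>_t conj)
  have \<phi>_h: "\<phi> (h g) = ?\<iota> g" if "g \<in> carrier Gamma" for g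
    using Gamma_hom_eqI[OF group_Delta hom_compose[OF h_hom \<phi>(1)] Delta_of_Gamma_hom _ _ that]
    by (simp add: hab \<phi>_a \<phi>_b)
  have inv2: "\<phi> (\<psi> d) = d" if "d \<in> carrier Delta" for d
  proof -
    note rels = adjoin_relators[OF group_Gamma Delta_relators_closed]
    have "(\<phi> \<circ> \<psi>) d = id d"
    proof (rule presented_hom_eqI[OF rels group_Delta, folded adjoin_letter_def, folded Delta_def, OF hom_compose[OF \<psi>(1) \<phi>(1)] _ _ that])
      show "id \<in> hom Delta Delta" by (auto simp: hom_def)
      fix x assume "x \<in> letter_gens Gamma"
      then show "(\<phi> \<circ> \<psi>) (presented_gen (letter_gens Gamma) (mult_table Gamma \<union> Delta_relators) x) =
         id (presented_gen (letter_gens Gamma) (mult_table Gamma \<union> Delta_relators) x)"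
        using \<psi>(2,3) \<phi>_h \<phi>_t
        unfolding adjoin_gen_def[symmetric] Delta_gen_eta by (auto simp: letter_gens_def)
    qed
    then show ?thesis by simp
  qed
  have "bij_betw \<phi> (carrier ?P) (carrier Delta)"
    using inv1 inv2 \<phi>.hom_closed hom_in_carrier[OF \<psi>(1)] by (intro bij_betw_byWitness[where f' = \<psi>]) auto
  then have "\<phi> \<in> iso ?P Delta" using \<phi>(1) by (simp add: iso_def)
  then show ?thesis using \<phi>_b \<phi>_t by (auto simp: b_def t_def)
qed

text \<open>The relators form a set, so the count needs that the two are different reduced words;
  rewriting inverses as words lets the products be computed.\<close>

lemma card_bt_relators: "card bt_relators = card {Gen_b, Gen_t}"
proof -
  have i: "inv\<^bsub>free_group {Gen_b, Gen_t}\<^esub> w = act_free (winv w) []"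
    if "w \<in> carrier (free_group {Gen_b, Gen_t})" for w
    using that act_winv[of "[]" w]
    by (intro FB.inv_equality) (auto simp: act_assoc act_reduced reduced_act intro!: act_words winv_words)
  show ?thesis
    by (simp add: bt_relators_def Let_def conj_by_def commutator_def free_gen_def i numeral_2_eq_2 winv_def)
qed

subsection \<open>\<open>\<Gamma>\<close> embeds in \<open>\<Delta>\<close>\<close>

definition perm_group :: "('a \<Rightarrow> 'a) monoid" where
  "perm_group = \<lparr>carrier = {f. bij f}, mult = (\<lambda>f g. g \<circ> f), one = id\<rparr>"

lemma perm_group_simps [simp]:
  "carrier perm_group = {f. bij f}" "f \<otimes>\<^bsub>perm_group\<^esub> g = g \<circ> f" "\<one>\<^bsub>perm_group\<^esub> = id"
  by (simp_all add: perm_group_def)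

lemma group_perm_group: "group perm_group"
proof (rule groupI)
  fix f :: "'a \<Rightarrow> 'a" assume "f \<in> carrier perm_group"
  then have "inv_into UNIV f \<in> carrier perm_group" "inv_into UNIV f \<otimes>\<^bsub>perm_group\<^esub> f = \<one>\<^bsub>perm_group\<^esub>"
    by (simp_all add: bij_imp_bij_inv bij_is_surj surj_iff[symmetric])
  then show "\<exists>g\<in>carrier perm_group. g \<otimes>\<^bsub>perm_group\<^esub> f = \<one>\<^bsub>perm_group\<^esub>" by blast
qed (auto simp: bij_comp)

interpretation perm: group "perm_group :: ('a \<Rightarrow> 'a) monoid" by (rule group_perm_group)

text \<open>A set \<open>Y\<close> on which \<open>\<Gamma>\<close> acts faithfully and which is isomorphic, as a \<open>\<Gamma>\<close>-set, to itself
  with the action twisted by \<open>\<sigma>\<close>. Since \<open>\<sigma> g\<close> has sections \<open>g\<close> and \<open>\<pi> g\<close>, one adds to the tree a copy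
  \<open>Suc j\<close> of it on which \<open>g\<close> acts by \<open>\<pi> (\<sigma>\<^sup>j g)\<close>, for each \<open>j\<close>; the fixed points \<open>Inr j\<close> make room
  for the root.\<close>

type_synonym hnn_point = "nat \<times> digit list + nat"

definition sec_Two :: "(digit list \<Rightarrow> digit list) \<Rightarrow> digit list \<Rightarrow> digit list" where
  "sec_Two g v = tl (sig g (Two # v))"

fun hnn_act :: "(digit list \<Rightarrow> digit list) \<Rightarrow> hnn_point \<Rightarrow> hnn_point" where
  "hnn_act g (Inl (0, v)) = Inl (0, g v)"
| "hnn_act g (Inl (Suc j, v)) = Inl (Suc j, sec_Two ((sig ^^ j) g) v)"
| "hnn_act g (Inr j) = Inr j"

fun hnn_shift :: "hnn_point \<Rightarrow> hnn_point" where
  "hnn_shift (Inl (0, One # v)) = Inl (0, v)"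
| "hnn_shift (Inl (0, Two # v)) = Inl (1, v)"
| "hnn_shift (Inl (0, [])) = Inr 0"
| "hnn_shift (Inl (Suc j, v)) = Inl (Suc (Suc j), v)"
| "hnn_shift (Inr j) = Inr (Suc j)"

fun hnn_unshift :: "hnn_point \<Rightarrow> hnn_point" where
  "hnn_unshift (Inl (0, v)) = Inl (0, One # v)"
| "hnn_unshift (Inl (Suc 0, v)) = Inl (0, Two # v)"
| "hnn_unshift (Inl (Suc (Suc j), v)) = Inl (Suc j, v)"
| "hnn_unshift (Inr 0) = Inl (0, [])"
| "hnn_unshift (Inr (Suc j)) = Inr j"

lemma hnn_shift_unshift [simp]: "hnn_shift (hnn_unshift y) = y" "hnn_unshift (hnn_shift y) = y"
  by (cases y rule: hnn_unshift.cases; simp)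
    (cases y rule: hnn_shift.cases; simp)

lemma sig_act_Cons: "sig (act w) (One # v) = One # act w v" "sig (act w) (Two # v) = Two # sec_Two (act w) v"
  by (simp_all add: sig_act sec_Two_def act_Cons)

lemma sig_pow_in_Gamma: "g \<in> carrier Gamma \<Longrightarrow> (sig ^^ j) g \<in> carrier Gamma"
  by (cases j) auto

lemma sec_Two_mult:
  "g \<in> carrier Gamma \<Longrightarrow> h \<in> carrier Gamma \<Longrightarrow> sec_Two (h \<circ> g) v = sec_Two h (sec_Two g v)"
proof -
  assume gh: "g \<in> carrier Gamma" "h \<in> carrier Gamma"
  then obtain u w where uw: "g = act u" "h = act w" by (metis Gamma_cases)
  have "sig (h \<circ> g) (Two # v) = sig h (sig g (Two # v))"
    using hom_mult[OF sig_hom gh] by simp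
  then show ?thesis by (simp add: sec_Two_def[of "h \<circ> g"]) (simp add: uw sig_act_Cons)
qed

lemma sig_pow_hom: "sig ^^ j \<in> hom Gamma Gamma"
proof (induction j)
  case (Suc j)
  then show ?case using hom_compose[OF Suc sig_hom] by (simp add: comp_def)
qed (auto simp: hom_def)

lemma hnn_act_mult:
  assumes "g \<in> carrier Gamma" "h \<in> carrier Gamma"
  shows "hnn_act (h \<circ> g) y = hnn_act h (hnn_act g y)"
  using hom_mult[OF sig_pow_hom assms] assms
  by (cases "(g, y)" rule: hnn_act.cases) (simp_all add: sec_Two_mult sig_pow_in_Gamma)

lemma hnn_act_id: "hnn_act id y = y"
proof -
  have "(sig ^^ j) id = id" for j
    using group_hom.hom_one[of Gamma Gamma "sig ^^ j"] sig_pow_hom group_Gamma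
    by (simp add: group_hom_def group_hom_axioms_def)
  moreover have "sig id = id" using sig_act[of "[]"] by simp
  ultimately show ?thesis by (cases "(id :: digit list \<Rightarrow> digit list, y)" rule: hnn_act.cases) (simp_all add: sec_Two_def)
qed

lemma hnn_act_hom: "hnn_act \<in> hom Gamma perm_group"
proof (rule homI)
  fix g assume g: "g \<in> carrier Gamma"
  then obtain w where w: "g = act w" by (rule Gamma_cases)
  have *: "act w \<circ> act (winv w) = id" "act (winv w) \<circ> act w = id" by auto
  have "bij (hnn_act g)"
    using hnn_act_mult[of g "act (winv w)"] hnn_act_mult[of "act (winv w)" g] g w
    by (intro bij_betw_byWitness[where f' = "hnn_act (act (winv w))"]) (auto simp: * hnn_act_id)
  then show "hnn_act g \<in> carrier perm_group" by simp
qed (auto simp: hnn_act_mult)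

lemma hnn_shift_act: "g \<in> carrier Gamma \<Longrightarrow> hnn_shift (hnn_act (sig g) y) = hnn_act g (hnn_shift y)"
proof -
  assume g: "g \<in> carrier Gamma"
  then obtain w where w: "g = act w" by (rule Gamma_cases)
  have "sig g [] = []" by (simp add: sig_def)
  then show ?thesis
    by (cases y rule: hnn_shift.cases) (simp_all add: w sig_act_Cons funpow_swap1)
qed

text \<open>By \<open>hnn_shift_act\<close>, \<Delta> acts on the points with t as
  \<open>hnn_unshift\<close>; restricted to \<Gamma> this action is faithful already on the copy of
  the tree with index 0.\<close>

lemma Delta_of_Gamma_inj: "inj_on Delta_of_Gamma (carrier Gamma)"
proof -
  have bij: "bij hnn_unshift" "bij hnn_shift"
    by (rule bij_betw_byWitness[where f' = hnn_shift]; auto)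
      (rule bij_betw_byWitness[where f' = hnn_unshift]; auto)
  have inv: "inv\<^bsub>perm_group\<^esub> hnn_unshift = hnn_shift"
    using bij by (intro perm.inv_equality) auto
  have conj: "conj_by perm_group (hnn_act g) hnn_unshift = hnn_act (sig g)" if "g \<in> carrier Gamma" for g
    using hnn_shift_act[OF that, symmetric] by (auto simp: conj_by_def inv)
  have "conj_by perm_group (hnn_act aut_a) hnn_unshift = hnn_act aut_b"
    "conj_by perm_group (hnn_act aut_b) hnn_unshift = hnn_act aut_a \<otimes>\<^bsub>perm_group\<^esub> hnn_act aut_a"
    using conj[of aut_a] conj[of aut_b] hom_mult[OF hnn_act_hom, of aut_a aut_a]
    by (simp_all add: sig_gens numeral_2_eq_2)
  from Delta_hom_exists[OF group_perm_group hnn_act_hom _ this] bij(1)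
  obtain k where "\<And>g. g \<in> carrier Gamma \<Longrightarrow> k (Delta_of_Gamma g) = hnn_act g" by auto
  moreover have "g = h" if "hnn_act g = hnn_act h" for g h
  proof
    fix v show "g v = h v" using fun_cong[OF that, of "Inl (0, v)"] by simp
  qed
  ultimately show ?thesis by (metis inj_onI)
qed

section \<open>The class \<open>BG\<close>\<close>

subsection \<open>Normal subgroups of \<open>\<Gamma>\<close>\<close>

lemma act_length [simp]: "length (act w v) = length v"
proof -
  have "length (aut_a v) = length v \<and> length (aut_b v) = length v \<and>
    length (inv_a v) = length v \<and> length (inv_b v) = length v" for v
  proof (induction v)
    case (Cons x v)
    then show ?case by (cases x) auto
  qed simp
  then have "length (lact l v) = length v" for l v
    by (cases l; cases "fst l"; cases "snd l") auto
  then show ?thesis by (induction w arbitrary: v) auto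
qed

text \<open>An element acting as \<open>w\<close> below the vertex \<open>v\<close> and trivially elsewhere, if \<open>w\<close> has exponent sums 0.\<close>

primrec rist :: "digit list \<Rightarrow> word \<Rightarrow> word" where
  "rist [] w = w"
| "rist (x # v) w = (case x of One \<Rightarrow> phi (rist v w) | Two \<Rightarrow> (La, True) # phi (rist v w) @ [(La, False)])"

lemma ex_phi: "ex La (phi w) = 2 * ex Lb w" "ex Lb (phi w) = ex La w"
proof (induction w)
  case (Cons l w)
  { case 1 show ?case using Cons by (cases l; cases "fst l"; cases "snd l") auto }
  { case 2 show ?case using Cons by (cases l; cases "fst l"; cases "snd l") auto }
qed simp_all

lemma ex_rist: "ex La w = 0 \<Longrightarrow> ex Lb w = 0 \<Longrightarrow> ex La (rist v w) = 0 \<and> ex Lb (rist v w) = 0"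
  by (induction v) (auto simp: ex_phi split: digit.splits)

lemma act_phi_Cons:
  assumes "ex Lb w = 0"
  shows "act (phi w) (One # v) = One # act w v" "act (phi w) (Two # v) = Two # v"
  using act_filter_B[of w] assms by (simp_all add: act_Cons)

lemma act_rist:
  assumes "ex La w = 0" "ex Lb w = 0"
  shows "act (rist v w) (v @ x) = v @ act w x"
proof (induction v)
  case (Cons d v)
  then show ?case using act_phi_Cons[OF conjunct2[OF ex_rist[OF assms, of v]]] by (cases d) auto
qed simp

lemma act_rist_outside:
  assumes "ex La w = 0" "ex Lb w = 0" "length y = length v" "y \<noteq> v"
  shows "act (rist v w) (y @ x) = y @ x"
  using assms(3,4)
proof (induction v arbitrary: y)
  case (Cons d v)
  note ex0 = conjunct2[OF ex_rist[OF assms(1,2), of v]]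
  obtain e z where "y = e # z" using Cons.prems by (cases y) auto
  then show ?case using Cons act_phi_Cons[OF ex0] by (cases d; cases e) auto
qed simp

text \<open>A vertex v moved by \<open>act g\<close> gives, through commutators with elements
  supported below v, elements of M with prescribed action below v. Exponents 0 are what allows
  \<open>rist\<close> to put a word below v alone.\<close>

lemma Gamma_normal_section:
  assumes M: "M \<lhd> Gamma" and g: "act g \<in> M" "act g \<noteq> id"
  obtains u na nb where "na \<in> M" "nb \<in> M" "\<And>v. na (u @ v) = u @ aut_a v" "\<And>v. nb (u @ v) = u @ aut_b v"
proof -
  interpret M: normal M Gamma by fact
  obtain v where v: "act g v \<noteq> v" using g(2) by fastforce
  have v': "act (winv g) v \<noteq> v" using v by (metis act_winv_act(2))
  have mult_M: "act (u @ w) \<in> M" if "act u \<in> M" "act w \<in> M" for u w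
    using M.m_closed[OF that] by simp
  have inv_M: "act (winv w) \<in> M" if "act w \<in> M" for w
    using M.m_inv_closed[OF that] by simp
  define cc where "cc u w = winv u @ winv w @ u @ w" for u w :: word
  have cc_M: "act (cc u w) \<in> M" if "act u \<in> M" for u w
  proof -
    have "act (winv w @ u @ w) \<in> M"
      using M.inv_op_closed1[OF act_in_Gamma that, of w] by (simp add: comp_assoc)
    from mult_M[OF inv_M[OF that] this] show ?thesis by (simp only: cc_def)
  qed
  have below_v: "\<exists>n\<in>M. \<forall>x. n (v @ x) = v @ act (cc h k) x"
    if h: "ex La h = 0" "ex Lb h = 0" and k: "ex La k = 0" "ex Lb k = 0" for h k
  proof -
    note r1 = act_rist[OF h, of v] act_rist_outside[OF h, of _ v] and r2 = act_rist[OF k, of v]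
    have w1: "act (winv (rist v h)) (v @ x) = v @ act (winv h) x" for x
      using r1(1)[of "act (winv h) x"] by (metis act_winv_act)
    have w2: "act (winv (rist v k)) (v @ x) = v @ act (winv k) x" for x
      using r2[of "act (winv k) x"] by (metis act_winv_act)
    have w1': "act (winv (rist v h)) (y @ x) = y @ x" if "length y = length v" "y \<noteq> v" for x y
      using r1(2)[OF that, of x] by (metis act_winv_act(1))
    \<comment> \<open>Since \<open>act g\<close> moves v, conjugation by g carries the inverse of
      \<open>rist v h\<close> off v. Below v only the factor \<open>rist v h\<close> of this
      commutator remains.\<close>
    define c where "c = cc g (rist v h)"
    have app: "\<exists>z. act w (y @ x) = act w y @ z \<and> length z = length x" for w x y
    proof (induction y arbitrary: w)
      case (Cons d y)
      then show ?case by (simp add: act_Cons)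
    qed simp
    have c: "act c (v @ x) = v @ act h x" for x
    proof -
      obtain z where z: "act (winv g) (v @ x) = act (winv g) v @ z" using app by blast
      have "act (winv (rist v h)) (act (winv g) (v @ x)) = act (winv g) (v @ x)"
        unfolding z by (rule w1') (use v' in auto)
      then show ?thesis by (simp add: c_def cc_def r1(1))
    qed
    have c': "act (winv c) (v @ x) = v @ act (winv h) x" for x
      using c[of "act (winv h) x"] by (metis act_winv_act)
    have "act (cc c (rist v k)) \<in> M" by (intro cc_M) (simp add: c_def cc_M g)
    moreover have "act (cc c (rist v k)) (v @ x) = v @ act (cc h k) x" for x
      by (simp add: cc_def c c' w2 r2)
    ultimately show ?thesis by blast
  qed
  \<comment> \<open>[a, b] and its conjugate by a have exponents 0. They are chosen so that the
    commutators with their images under \<open>phi\<close> have, at the vertex 112, the sections a b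
    and b^-1, from which a and b are recovered.\<close>
  define c where "c = cc [(La, True)] [(Lb, True)]"
  define c' where "c' = (La, False) # c @ [(La, True)]"
  have e: "ex g c = 0" "ex g c' = 0" for g by (simp_all add: c_def c'_def cc_def)
  have e_phi: "ex g (phi c) = 0" "ex g (phi c') = 0" for g
    using e by (cases g; simp add: ex_phi)+
  obtain n1 where n1: "n1 \<in> M" "\<And>x. n1 (v @ x) = v @ act (cc c (phi c)) x"
    using below_v[OF e(1) e(1) e_phi(1) e_phi(1)] by blast
  obtain n2 where n2: "n2 \<in> M" "\<And>x. n2 (v @ x) = v @ act (cc c (phi c')) x"
    using below_v[OF e(1) e(1) e_phi(2) e_phi(2)] by blast
  have a1: "act (cc c (phi c)) (One # One # Two # x) = One # One # Two # aut_b (aut_a x)" for x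
    by (simp add: c_def cc_def)
  have a2: "act (cc c (phi c')) (One # One # Two # x) = One # One # Two # inv_b x" for x
    by (simp add: c_def c'_def cc_def)
  let ?u = "v @ [One, One, Two]"
  have s: "n1 (?u @ x) = ?u @ aut_b (aut_a x)" "n2 (?u @ x) = ?u @ inv_b x" for x
    using n1(2)[of "[One, One, Two] @ x"] n2(2)[of "[One, One, Two] @ x"] by (simp_all add: a1 a2)
  obtain w2 where w2: "n2 = act w2" using n2(1) M.subset by (blast elim: Gamma_cases)
  have "act (winv w2) (?u @ x) = ?u @ aut_b x" for x
    using s(2)[of "aut_b x"] unfolding w2 by (metis act_winv_act(1) inv_aut(2))
  moreover have "(n2 \<circ> n1) (?u @ x) = ?u @ aut_a x" for x
    unfolding comp_def s by simp
  moreover have "n2 \<circ> n1 \<in> M" using M.m_closed[OF n1(1) n2(1)] by simp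
  moreover have "act (winv w2) \<in> M" using inv_M n2(1) w2 by simp
  ultimately show thesis using that by blast
qed

subsection \<open>The positive words are distinct\<close>

abbreviation pos_word :: "ab list \<Rightarrow> word" where
  "pos_word u \<equiv> map (\<lambda>x. (x, True)) u"

fun pos_sec :: "ab list \<Rightarrow> digit \<Rightarrow> ab list" where
  "pos_sec [] x = []"
| "pos_sec (La # u) One = Lb # pos_sec u Two"
| "pos_sec (La # u) Two = pos_sec u One"
| "pos_sec (Lb # u) One = La # pos_sec u One"
| "pos_sec (Lb # u) Two = pos_sec u Two"

lemma wsec_pos: "wsec (pos_word u) x = pos_word (pos_sec u x)"
  by (induction u x rule: pos_sec.induct) auto

text \<open>The section at \<open>One\<close> starts with b if the word starts with a, and with a if
  it starts with b. So the first letter can be read off, and what remains are the sections of the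
  rest.\<close>

lemma pos_sec_inj: "pos_sec u One = pos_sec w One \<Longrightarrow> pos_sec u Two = pos_sec w Two \<Longrightarrow> u = w"
proof (induction u arbitrary: w)
  case Nil
  then show ?case by (cases w; cases "hd w") auto
next
  case (Cons x u)
  then obtain y z where w: "w = y # z" by (cases w; cases x) auto
  then show ?case using Cons by (cases x; cases y) auto
qed

lemma length_pos_sec: "length (pos_sec u One) + length (pos_sec u Two) = length u"
  using length_wsec[of One Two "pos_word u"] by (simp add: wsec_pos)

lemma pos_sec_One_empty: "pos_sec u One = [] \<Longrightarrow> u = []"
  by (cases u; cases "hd u") auto

lemma pos_sec_Two_empty: "pos_sec u Two = [] \<Longrightarrow> \<exists>k. u = replicate k Lb \<or> u = replicate k Lb @ [La]"
proof (induction u)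
  case (Cons x u)
  show ?case
  proof (cases x)
    case La
    then have "u = []" using Cons.prems pos_sec_One_empty by simp
    then show ?thesis using La by (intro exI[of _ 0]) simp
  next
    case Lb
    then obtain k where "u = replicate k Lb \<or> u = replicate k Lb @ [La]" using Cons by auto
    then show ?thesis using Lb by (intro exI[of _ "Suc k"]) auto
  qed
qed simp

lemma ex_pos: "ex x (pos_word u) = int (count_list u x)"
  by (induction u) auto

text \<open>Equal elements have equal sections, which are again positive words of smaller total
  length, so induction applies. The exceptions are the words b^k and b^k a, whose section at
  \<open>Two\<close> is empty; exponent sums separate them.\<close>

lemma pos_word_inj: "act (pos_word u) = act (pos_word w) \<Longrightarrow> u = w"
proof (induction "length u + length w" arbitrary: u w rule: less_induct)
  case less
  have eq: "act (pos_word (pos_sec u x)) = act (pos_word (pos_sec w x))" for x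
    using less.prems unfolding act_eq_iff[of "pos_word u"] wsec_pos by blast
  note len = length_pos_sec[of u] length_pos_sec[of w]
  have cnt: "count_list u x = count_list w x" for x
    using ex_cong[OF less.prems, of x] by (simp add: ex_pos)
  show ?case
  proof (cases "pos_sec u Two = [] \<and> pos_sec w Two = []")
    case True
    then obtain i j where "u = replicate i Lb \<or> u = replicate i Lb @ [La]" "w = replicate j Lb \<or> w = replicate j Lb @ [La]"
      using pos_sec_Two_empty by meson
    moreover have rep: "count_list (replicate k x) y = (if x = y then k else 0)" for k x y
      by (induction k) auto
    ultimately show ?thesis using cnt[of La] cnt[of Lb] by (auto simp: rep)
  next
    case False
    then have "length (pos_sec u One) + length (pos_sec w One) < length u + length w"
      using len by (cases "pos_sec u Two"; cases "pos_sec w Two") auto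
    then have One: "pos_sec u One = pos_sec w One" by (rule less.hyps[OF _ eq])
    show ?thesis
    proof (cases "u = [] \<and> w = []")
      case False
      then have "length (pos_sec u Two) + length (pos_sec w Two) < length u + length w"
        using len pos_sec_One_empty[of u] pos_sec_One_empty[of w] by (cases "pos_sec u One"; cases "pos_sec w One") auto
      then have "pos_sec u Two = pos_sec w Two" by (rule less.hyps[OF _ eq])
      then show ?thesis using One pos_sec_inj by blast
    qed simp
  qed
qed

subsection \<open>Groups with \<open>\<Gamma>\<close> as a subquotient\<close>

text \<open>Equivalently, some subgroup of \<open>G\<close> has \<open>\<Gamma>\<close> as a quotient, for \<open>a\<close> and \<open>b\<close> generate \<open>\<Gamma>\<close>.\<close>

definition involves_Gamma :: "('a, 'b) monoid_scheme \<Rightarrow> bool" where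
  "involves_Gamma G \<longleftrightarrow> (\<exists>x\<in>carrier G. \<exists>y\<in>carrier G.
    \<forall>w. weval G (gen2 x y) w = \<one>\<^bsub>G\<^esub> \<longrightarrow> act w = id)"

lemma gen2_funcset: "x \<in> S \<Longrightarrow> y \<in> S \<Longrightarrow> gen2 x y \<in> UNIV \<rightarrow> S"
proof
  fix z assume "x \<in> S" "y \<in> S" then show "gen2 x y z \<in> S" by (cases z) auto
qed

lemma hom_gen2:
  assumes "group G" "group H" "h \<in> hom G H" "x \<in> carrier G" "y \<in> carrier G"
  shows "h (weval G (gen2 x y) w) = weval H (gen2 (h x) (h y)) w"
proof -
  have "h \<circ> gen2 x y = gen2 (h x) (h y)"
  proof
    fix z show "(h \<circ> gen2 x y) z = gen2 (h x) (h y) z" by (cases z) auto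
  qed
  then show ?thesis
    using group.hom_weval[OF assms(1,2,3) gen2_funcset[OF assms(4,5)], of w] by simp
qed

lemma involves_inj_hom:
  assumes "group G" "group H" "h \<in> hom G H" "inj_on h (carrier G)" "involves_Gamma G"
  shows "involves_Gamma H"
proof -
  interpret h: group_hom G H h using assms by (simp add: group_hom_def group_hom_axioms_def)
  obtain x y where xy: "x \<in> carrier G" "y \<in> carrier G" "\<And>w. weval G (gen2 x y) w = \<one>\<^bsub>G\<^esub> \<Longrightarrow> act w = id"
    using assms(5) by (auto simp: involves_Gamma_def)
  have "act w = id" if "weval H (gen2 (h x) (h y)) w = \<one>\<^bsub>H\<^esub>" for w
  proof (rule xy(3), rule inj_onD[OF assms(4)])
    show "h (weval G (gen2 x y) w) = h \<one>\<^bsub>G\<^esub>"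
      using hom_gen2[OF assms(1,2,3) xy(1,2), of w] that by simp
    show "weval G (gen2 x y) w \<in> carrier G"
      using h.G.weval_closed[OF gen2_funcset[OF xy(1,2)]] by simp
  qed simp
  then show ?thesis using xy(1,2) unfolding involves_Gamma_def by (metis h.hom_closed)
qed

lemma involves_lift:
  assumes "group G" "group H" "h \<in> hom G H" "x \<in> carrier G" "y \<in> carrier G"
    "\<And>w. weval H (gen2 (h x) (h y)) w = \<one>\<^bsub>H\<^esub> \<Longrightarrow> act w = id"
  shows "involves_Gamma G"
proof -
  interpret h: group_hom G H h using assms by (simp add: group_hom_def group_hom_axioms_def)
  have "act w = id" if "weval G (gen2 x y) w = \<one>\<^bsub>G\<^esub>" for w
    using hom_gen2[OF assms(1-5), of w] that by (intro assms(6)) simp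
  then show ?thesis using assms(4,5) by (auto simp: involves_Gamma_def)
qed

lemma involves_Gamma_Gamma: "involves_Gamma Gamma"
proof -
  have eq: "gen2 aut_a aut_b = gam"
  proof
    fix z show "gen2 aut_a aut_b z = gam z" by (cases z) auto
  qed
  show ?thesis
    unfolding involves_Gamma_def
    by (rule bexI[of _ aut_a], rule bexI[of _ aut_b]) (simp_all only: eq weval_Gamma Gamma_simps aut_in_Gamma simp_thms)
qed

lemma involves_Gamma_Delta: "involves_Gamma Delta"
  by (rule involves_inj_hom[OF group_Gamma group_Delta Delta_of_Gamma_hom Delta_of_Gamma_inj involves_Gamma_Gamma])

subsection \<open>Growth\<close>

context group
begin

lemma set_pow_closed: "S \<subseteq> carrier G \<Longrightarrow> set_pow G S n \<subseteq> carrier G"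
  by (induction n) (auto simp: set_mult_def)

lemma finite_set_pow: "finite S \<Longrightarrow> finite (set_pow G S n)"
  by (induction n) (auto simp: set_mult_def)

lemma card_set_pow:
  assumes "finite S"
  shows "card (set_pow G S n) \<le> card S ^ n"
proof (induction n)
  case (Suc n)
  have "set_pow G S n <#> S = (\<lambda>(x, y). x \<otimes> y) ` (set_pow G S n \<times> S)"
    by (auto simp: set_mult_def)
  moreover have "card ((\<lambda>(x, y). x \<otimes> y) ` (set_pow G S n \<times> S)) \<le> card (set_pow G S n \<times> S)"
    using assms finite_set_pow[OF assms, of n] by (intro card_image_le) simp
  ultimately have "card (set_pow G S (Suc n)) \<le> card (set_pow G S n \<times> S)" by simp
  also have "\<dots> \<le> card S ^ n * card S" using Suc by (simp add: card_cartesian_product)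
  finally show ?case by (simp add: mult.commute)
qed simp

lemma set_pow_mult:
  assumes "S \<subseteq> carrier G" "x \<in> set_pow G S m" "y \<in> set_pow G S n"
  shows "x \<otimes> y \<in> set_pow G S (m + n)"
  using assms(3)
proof (induction n arbitrary: y)
  case 0
  then show ?case using assms set_pow_closed[OF assms(1), of m] by auto
next
  case (Suc n)
  then obtain z s where z: "z \<in> set_pow G S n" "s \<in> S" "y = z \<otimes> s" by (auto simp: set_mult_def)
  then have "x \<otimes> y = (x \<otimes> z) \<otimes> s"
    using assms set_pow_closed[OF assms(1), of m] set_pow_closed[OF assms(1), of n]
    by (metis m_assoc subsetD)
  then show ?case using Suc.IH[OF z(1)] z(2) by (auto simp: set_mult_def)
qed

lemma set_pow_mono:
  assumes "S \<subseteq> carrier G" "\<one> \<in> S" "m \<le> n"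
  shows "set_pow G S m \<subseteq> set_pow G S n"
  using assms(3)
proof (induction n rule: dec_induct)
  case (step n)
  have "set_pow G S n \<subseteq> set_pow G S (Suc n)"
  proof
    fix x assume x: "x \<in> set_pow G S n"
    then have "x = x \<otimes> \<one>" using set_pow_closed[OF assms(1), of n] by auto
    then show "x \<in> set_pow G S (Suc n)" using x assms(2) by (auto simp: set_mult_def)
  qed
  then show ?case using step by blast
qed simp

lemma growth_generators_exhaust:
  assumes "growth_generators G S" "x \<in> carrier G"
  obtains n where "x \<in> set_pow G S n"
proof -
  have S: "S \<subseteq> carrier G" "\<one> \<in> S" "\<And>s. s \<in> S \<Longrightarrow> inv s \<in> S" "generate G S = carrier G"
    using assms by (auto simp: growth_generators_def)
  have one: "s \<in> set_pow G S 1" if "s \<in> S" for s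
    using that S(1) by (auto simp: set_mult_def intro!: bexI[of _ s])
  have "x \<in> generate G S" using assms S by simp
  then have "\<exists>n. x \<in> set_pow G S n"
  proof (induction rule: generate.induct)
    case one
    then show ?case by (intro exI[of _ 0]) simp
  next
    case (incl h)
    then show ?case using one by blast
  next
    case (inv h)
    then show ?case using one S(3) by blast
  next
    case (eng h1 h2)
    then show ?case using set_pow_mult[OF S(1)] by blast
  qed
  then show thesis using that by blast
qed

text \<open>The 2^n positive words of length n in x and y have different values, since they differ
  already in \<Gamma>, and all lie in the ball of radius C n.\<close>

lemma growth_exponential:
  assumes S: "growth_generators G S"
    and xy: "x \<in> carrier G" "y \<in> carrier G" "\<And>w. weval G (gen2 x y) w = \<one> \<Longrightarrow> act w = id"
  shows "growth_equiv (growth G S) (\<lambda>n. 2 ^ n)"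
proof -
  have S': "finite S" "S \<subseteq> carrier G" "\<one> \<in> S" using S by (auto simp: growth_generators_def)
  have "growth G S n \<le> 2 ^ (card S * n)" for n
  proof -
    have "card S ^ n \<le> (2 ^ card S) ^ n" by (intro power_mono) (auto intro: less_imp_le less_exp)
    then show ?thesis using card_set_pow[OF S'(1), of n] by (simp add: growth_def power_mult)
  qed
  then have "growth_le (growth G S) (\<lambda>n. 2 ^ n)" by (auto simp: growth_le_def)
  moreover have "growth_le (\<lambda>n. 2 ^ n) (growth G S)"
  proof -
    obtain i j where ij: "x \<in> set_pow G S i" "y \<in> set_pow G S j"
      using growth_generators_exhaust[OF S] xy(1,2) by metis
    define C where "C = max i j"
    have C: "gen2 x y z \<in> set_pow G S C" for z
      using ij set_pow_mono[OF S'(2,3), of i C] set_pow_mono[OF S'(2,3), of j C]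
      by (cases z) (auto simp: C_def)
    note g = gen2_funcset[OF xy(1,2)]
    let ?e = "\<lambda>u. weval G (gen2 x y) (pos_word u)"
    have e: "?e u \<in> set_pow G S (C * length u)" for u
    proof (induction u)
      case (Cons z u)
      then show ?case using set_pow_mult[OF S'(2) C Cons, of z] by (simp add: leval_def)
    qed simp
    have inj: "inj ?e"
    proof (rule injI)
      fix u w assume "?e u = ?e w"
      then have "weval G (gen2 x y) (pos_word u @ winv (pos_word w)) = \<one>"
        using weval_append[OF g] weval_winv[OF g] weval_closed[OF g] by simp
      then have "act (pos_word u @ winv (pos_word w)) = id" by (rule xy(3))
      then have "act (winv (pos_word w)) (act (pos_word u) v) = v" for v by (simp add: fun_eq_iff)
      then have "act (pos_word u) = act (pos_word w)" by (metis act_winv_act(2) ext)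
      then show "u = w" by (rule pos_word_inj)
    qed
    have "2 ^ n \<le> growth G S (C * n)" for n
    proof -
      have ab: "(UNIV :: ab set) = {La, Lb}" using ab.exhaust by blast
      have "finite (UNIV :: ab set)" "card (UNIV :: ab set) = 2" unfolding ab by simp_all
      then have "2 ^ n = card {u :: ab list. length u = n}"
        using card_lists_length_eq[of "UNIV :: ab set" n] by simp
      also have "\<dots> = card (?e ` {u. length u = n})"
        using inj by (intro card_image[symmetric]) (auto intro: inj_on_subset)
      also have "\<dots> \<le> card (set_pow G S (C * n))"
        using e by (intro card_mono finite_set_pow S') auto
      finally show ?thesis by (simp add: growth_def)
    qed
    then show ?thesis by (auto simp: growth_le_def)
  qed
  ultimately show ?thesis by (simp add: growth_equiv_def)
qed

lemma weval_subgroup: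
  assumes "subgroup H G" "f \<in> UNIV \<rightarrow> H"
  shows "weval (G\<lparr>carrier := H\<rparr>) f w = weval G f w"
proof (induction w)
  case (Cons l w)
  have "leval (G\<lparr>carrier := H\<rparr>) f l = leval G f l"
    using assms by (auto simp: leval_def m_inv_consistent Pi_iff)
  then show ?case using Cons by simp
qed simp

end

lemma locally_subexponential_not_involves:
  assumes "locally_subexponential G"
  shows "\<not> involves_Gamma G"
proof
  interpret G: group G using assms by (simp add: locally_subexponential_def)
  assume "involves_Gamma G"
  then obtain x y where xy: "x \<in> carrier G" "y \<in> carrier G" "\<And>w. weval G (gen2 x y) w = \<one>\<^bsub>G\<^esub> \<Longrightarrow> act w = id"
    by (auto simp: involves_Gamma_def)
  let ?H = "generate G {x, y}"
  have K: "subgroup_generated G {x, y} = G\<lparr>carrier := ?H\<rparr>"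
    using xy by (simp add: subgroup_generated_def Int_absorb1)
  have H: "subgroup ?H G" using xy by (intro G.generate_is_subgroup) auto
  have xyH: "x \<in> ?H" "y \<in> ?H" by (auto intro: generate.incl)
  have "subexponential_growth (subgroup_generated G {x, y})"
    using assms xy unfolding locally_subexponential_def by simp
  then obtain S where S: "group (G\<lparr>carrier := ?H\<rparr>)" "growth_generators (G\<lparr>carrier := ?H\<rparr>) S"
     "\<not> growth_equiv (growth (G\<lparr>carrier := ?H\<rparr>) S) (\<lambda>n. 2 ^ n)"
    unfolding subexponential_growth_def K by blast
  have w: "act w = id" if "weval (G\<lparr>carrier := ?H\<rparr>) (gen2 x y) w = \<one>\<^bsub>G\<lparr>carrier := ?H\<rparr>\<^esub>" for w
    using that xy(3) G.weval_subgroup[OF H gen2_funcset[OF xyH]] by simp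
  from group.growth_exponential[OF S(1,2) _ _ w] S(3) xyH show False by simp
qed

text \<open>If the part of N in the subgroup generated by x and y had trivial image in \<Gamma>, the
  images of x and y would witness that G Mod N involves \<Gamma>. Otherwise the image is a
  nontrivial normal subgroup of \<Gamma>, and elements of N over its members with sections a and b
  at one vertex are the witness.\<close>

lemma involves_extension:
  assumes "group G" "N \<lhd> G" "involves_Gamma G" "\<not> involves_Gamma (G Mod N)"
  shows "involves_Gamma (G\<lparr>carrier := N\<rparr>)"
proof -
  interpret G: group G by fact
  interpret N: normal N G by fact
  obtain x y where xy: "x \<in> carrier G" "y \<in> carrier G" "\<And>w. weval G (gen2 x y) w = \<one>\<^bsub>G\<^esub> \<Longrightarrow> act w = id"
    using assms by (auto simp: involves_Gamma_def)
  note g = gen2_funcset[OF xy(1,2)]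
  let ?V = "weval G (gen2 x y)"
  note V_simps = G.weval_append[OF g] G.weval_winv[OF g] G.weval_closed[OF g]
  have V_cong: "?V u = ?V w \<Longrightarrow> act u = act w" for u w
  proof -
    assume "?V u = ?V w"
    then have "?V (u @ winv w) = \<one>\<^bsub>G\<^esub>" by (simp add: V_simps)
    then have "act (u @ winv w) = id" by (rule xy(3))
    then have "act (winv w) (act u v) = v" for v by (simp add: fun_eq_iff)
    then show "act u = act w" by (metis act_winv_act(2) ext)
  qed
  \<comment> \<open>The image of N, intersected with the subgroup generated by x and y, under the
    homomorphism x to a, y to b; it exists because every relation of x and y holds in
    \<Gamma>.\<close>
  define M where "M = {act w | w. ?V w \<in> N}"
  have M: "M \<lhd> Gamma"
    unfolding Gam.normal_inv_iff
  proof (intro conjI ballI Gam.subgroupI)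
    show "M \<noteq> {}" using N.one_closed by (auto simp: M_def intro!: exI[of _ "[]"])
    show "inv\<^bsub>Gamma\<^esub> f \<in> M" if f: "f \<in> M" for f
    proof -
      obtain w where "f = act w" "?V w \<in> N" using f by (auto simp: M_def)
      then show ?thesis by (auto simp: M_def V_simps N.m_inv_closed intro!: exI[of _ "winv w"])
    qed
    show "f \<otimes>\<^bsub>Gamma\<^esub> h \<in> M" if fh: "f \<in> M" "h \<in> M" for f h
    proof -
      obtain u w where "f = act u" "?V u \<in> N" "h = act w" "?V w \<in> N" using fh by (auto simp: M_def)
      then show ?thesis by (auto simp: M_def V_simps N.m_closed intro!: exI[of _ "u @ w"])
    qed
    show "f \<otimes>\<^bsub>Gamma\<^esub> h \<otimes>\<^bsub>Gamma\<^esub> inv\<^bsub>Gamma\<^esub> f \<in> M" if f: "f \<in> carrier Gamma" "h \<in> M" for f h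
    proof -
      obtain u where u: "f = act u" using f(1) by (rule Gamma_cases)
      obtain w where w: "h = act w" "?V w \<in> N" using f(2) by (auto simp: M_def)
      have "?V (u @ w @ winv u) \<in> N"
        using N.inv_op_closed2[OF _ w(2), of "?V u"] by (simp add: V_simps G.m_assoc)
      then show ?thesis unfolding M_def u w by (auto intro!: exI[of _ "u @ w @ winv u"])
    qed
  qed (auto simp: M_def)
  have "\<exists>w. ?V w \<in> N \<and> act w \<noteq> id"
  proof (rule ccontr)
    assume *: "\<nexists>w. ?V w \<in> N \<and> act w \<noteq> id"
    let ?q = "\<lambda>z. N #>\<^bsub>G\<^esub> z"
    have q: "?q \<in> hom G (G Mod N)" by (rule N.r_coset_hom_Mod)
    have "act w = id" if "weval (G Mod N) (gen2 (?q x) (?q y)) w = \<one>\<^bsub>G Mod N\<^esub>" for w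
    proof -
      have "?q (?V w) = N"
        using that hom_gen2[OF assms(1) N.factorgroup_is_group q xy(1,2), of w] by simp
      then have "?V w \<in> N" using G.rcos_self[OF _ N.subgroup_axioms, of "?V w"] by (simp add: V_simps)
      then show ?thesis using * by blast
    qed
    then have "involves_Gamma (G Mod N)"
      using hom_in_carrier[OF q] xy(1,2) unfolding involves_Gamma_def by blast
    then show False using assms(4) by blast
  qed
  then obtain g where g': "act g \<in> M" "act g \<noteq> id" by (auto simp: M_def)
  obtain u na nb where "na \<in> M" "nb \<in> M" and
    sec: "\<And>v. na (u @ v) = u @ aut_a v" "\<And>v. nb (u @ v) = u @ aut_b v"
    by (rule Gamma_normal_section[OF M g']) (rule that)
  then obtain wa wb where w: "na = act wa" "nb = act wb" "?V wa \<in> N" "?V wb \<in> N"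
    by (auto simp: M_def)
  \<comment> \<open>A word in \<open>na\<close> and \<open>nb\<close> acts below u as the same word
    in a and b, so it can only be trivial if that word is; its action elsewhere does not
    matter.\<close>
  have act_gen2: "weval Gamma (gen2 na nb) w (u @ v) = u @ act w v" for w v
  proof (induction w arbitrary: v)
    case (Cons l w)
    have "leval Gamma (gen2 na nb) l (u @ v) = u @ lact l v"
    proof (cases l)
      case (Pair g e)
      have "act (winv wa) (u @ v) = u @ inv_a v"
        using sec(1)[of "inv_a v"] unfolding w by (metis act_winv_act(1) aut_inv(1))
      moreover have "act (winv wb) (u @ v) = u @ inv_b v"
        using sec(2)[of "inv_b v"] unfolding w by (metis act_winv_act(1) aut_inv(2))
      ultimately show ?thesis using Pair sec w by (cases g; cases e) (simp_all add: leval_def)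
    qed
    then show ?case using Cons by simp
  qed simp
  have conv: "\<exists>z. weval G (gen2 (?V wa) (?V wb)) w = ?V z \<and> weval Gamma (gen2 na nb) w = act z" for w
  proof (induction w)
    case Nil
    then show ?case by (intro exI[of _ "[]"]) simp
  next
    case (Cons l w)
    then obtain z where z: "weval G (gen2 (?V wa) (?V wb)) w = ?V z" "weval Gamma (gen2 na nb) w = act z" by blast
    obtain g e where l: "l = (g, e)" by fastforce
    define w0 where "w0 = (if g = La then wa else wb)"
    have "leval G (gen2 (?V wa) (?V wb)) l = ?V (if e then w0 else winv w0)"
      "leval Gamma (gen2 na nb) l = act (if e then w0 else winv w0)"
      using l by (cases g; simp add: leval_def w0_def V_simps w)+
    then show ?case using z by (intro exI[of _ "(if e then w0 else winv w0) @ z"]) (simp add: V_simps)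
  qed
  have "act w = id" if "weval (G\<lparr>carrier := N\<rparr>) (gen2 (?V wa) (?V wb)) w = \<one>\<^bsub>G\<lparr>carrier := N\<rparr>\<^esub>" for w
  proof -
    have "weval G (gen2 (?V wa) (?V wb)) w = \<one>\<^bsub>G\<^esub>"
      using that G.weval_subgroup[OF N.subgroup_axioms gen2_funcset[OF w(3,4)]] by simp
    then have "weval Gamma (gen2 na nb) w = id" using conv[of w] xy(3) by metis
    then have "act w v = v" for v using act_gen2[of w v] by simp
    then show ?thesis by auto
  qed
  then show ?thesis using w(3,4) by (auto simp: involves_Gamma_def)
qed

section \<open>The canonical maps into a direct limit\<close>

context
  fixes I r \<G> f E
  assumes dir: "directed_system I r \<G> f"
  defines "E \<equiv> eventually_equal I r \<G> f"
begin

lemma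
  shows dir_grp: "i \<in> I \<Longrightarrow> group (\<G> i)"
    and dir_hom: "i \<in> I \<Longrightarrow> j \<in> I \<Longrightarrow> (i, j) \<in> r \<Longrightarrow> f i j \<in> hom (\<G> i) (\<G> j)"
    and dir_comp: "i \<in> I \<Longrightarrow> j \<in> I \<Longrightarrow> k \<in> I \<Longrightarrow> x \<in> carrier (\<G> i) \<Longrightarrow>
       (i, j) \<in> r \<Longrightarrow> (j, k) \<in> r \<Longrightarrow> f j k (f i j x) = f i k x"
    and dir_ub: "i \<in> I \<Longrightarrow> j \<in> I \<Longrightarrow> \<exists>k\<in>I. (i, k) \<in> r \<and> (j, k) \<in> r"
    and dir_id: "i \<in> I \<Longrightarrow> x \<in> carrier (\<G> i) \<Longrightarrow> f i i x = x"
  using dir unfolding directed_system_def by blast+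

lemma dir_trans: "(i, j) \<in> r \<Longrightarrow> (j, k) \<in> r \<Longrightarrow> (i, k) \<in> r"
  using dir unfolding directed_system_def preorder_on_def by (meson transD)

lemma dir_refl: "i \<in> I \<Longrightarrow> (i, i) \<in> r"
  using dir unfolding directed_system_def preorder_on_def refl_on_def by blast

lemma eventually_equal_sym: "(q, p) \<in> E" if "(p, q) \<in> E" for p q
  using that unfolding E_def eventually_equal_def by fastforce

lemma eventually_equal_trans: "(p, s) \<in> E" if pq: "(p, q) \<in> E" "(q, s) \<in> E" for p q s
proof -
  obtain i x j y k z where p: "p = (i, x)" "q = (j, y)" "s = (k, z)" by (cases p; cases q; cases s) auto
  have I: "i \<in> I" "j \<in> I" "k \<in> I" "x \<in> carrier (\<G> i)" "y \<in> carrier (\<G> j)" "z \<in> carrier (\<G> k)"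
    using pq unfolding p E_def eventually_equal_def by auto
  obtain m where m: "m \<in> I" "(i, m) \<in> r" "(j, m) \<in> r" "f i m x = f j m y"
    using pq(1) unfolding p E_def eventually_equal_def by auto
  obtain n where n: "n \<in> I" "(j, n) \<in> r" "(k, n) \<in> r" "f j n y = f k n z"
    using pq(2) unfolding p E_def eventually_equal_def by auto
  obtain l where l: "l \<in> I" "(m, l) \<in> r" "(n, l) \<in> r" using dir_ub[OF m(1) n(1)] by blast
  have "f i l x = f k l z"
    using dir_comp[OF I(1) m(1) l(1) I(4) m(2) l(2)] dir_comp[OF I(2) m(1) l(1) I(5) m(3) l(2)]
      dir_comp[OF I(2) n(1) l(1) I(5) n(2) l(3)] dir_comp[OF I(3) n(1) l(1) I(6) n(3) l(3)] m(4) n(4) by simp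
  then show ?thesis
    using I l dir_trans[OF m(2) l(2)] dir_trans[OF n(3) l(3)] unfolding p E_def eventually_equal_def by blast
qed

lemma eventually_equal_refl: "((i, x), (i, x)) \<in> E" if "i \<in> I" "x \<in> carrier (\<G> i)" for i x
  using that dir_refl unfolding E_def eventually_equal_def by blast

lemma eventually_equal_class: "E `` {p} = E `` {q}" if "(p, q) \<in> E"
  using eventually_equal_sym[OF that] that eventually_equal_trans by blast

lemma direct_limit_shift:
  assumes i: "i \<in> I" and k: "k \<in> I" "(i, k) \<in> r" and x: "x \<in> carrier (\<G> i)"
  shows "eventually_equal I r \<G> f `` {(k, f i k x)} = eventually_equal I r \<G> f `` {(i, x)}"
proof -
  have fx: "f i k x \<in> carrier (\<G> k)" using hom_in_carrier[OF dir_hom[OF i k] x] .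
  have "((k, f i k x), (i, x)) \<in> E"
    using i k x fx dir_refl[OF k(1)] dir_id[OF k(1) fx] unfolding E_def eventually_equal_def by fastforce
  then show ?thesis using eventually_equal_class unfolding E_def by blast
qed

lemma hom_direct_limit:
  assumes i: "i \<in> I"
  shows "(\<lambda>x. eventually_equal I r \<G> f `` {(i, x)}) \<in> hom (\<G> i) (direct_limit I r \<G> f)"
  unfolding E_def[symmetric]
proof (rule homI)
  show "E `` {(i, x)} \<in> carrier (direct_limit I r \<G> f)" if "x \<in> carrier (\<G> i)" for x
    using that i by (auto simp: direct_limit_def quotient_def E_def)
  fix x y assume x: "x \<in> carrier (\<G> i)" and y: "y \<in> carrier (\<G> i)"
  let ?xy = "x \<otimes>\<^bsub>\<G> i\<^esub> y"
  let ?S = "{(j, u \<otimes>\<^bsub>\<G> j\<^esub> v) | j u v. (j, u) \<in> E `` {(i, x)} \<and> (j, v) \<in> E `` {(i, y)}}"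
  have xy: "?xy \<in> carrier (\<G> i)" using dir_grp[OF i] x y by (simp add: group.is_monoid monoid.m_closed)
  have in_S: "(i, ?xy) \<in> ?S" using eventually_equal_refl[OF i x] eventually_equal_refl[OF i y] by blast
  have S_E: "((i, ?xy), p) \<in> E" if p: "p \<in> ?S" for p
  proof -
    obtain j u v where j: "p = (j, u \<otimes>\<^bsub>\<G> j\<^esub> v)" "((i, x), (j, u)) \<in> E" "((i, y), (j, v)) \<in> E"
      using p by blast
    have I: "j \<in> I" "u \<in> carrier (\<G> j)" "v \<in> carrier (\<G> j)"
      using j unfolding E_def eventually_equal_def by auto
    obtain m where m: "m \<in> I" "(i, m) \<in> r" "(j, m) \<in> r" "f i m x = f j m u"
      using j(2) unfolding E_def eventually_equal_def by auto
    obtain n where n: "n \<in> I" "(i, n) \<in> r" "(j, n) \<in> r" "f i n y = f j n v"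
      using j(3) unfolding E_def eventually_equal_def by auto
    obtain l where l: "l \<in> I" "(m, l) \<in> r" "(n, l) \<in> r" using dir_ub[OF m(1) n(1)] by blast
    have il: "(i, l) \<in> r" "(j, l) \<in> r" using dir_trans m n l by blast+
    have "f i l x = f j l u"
      using dir_comp[OF i m(1) l(1) x m(2) l(2)] dir_comp[OF I(1) m(1) l(1) I(2) m(3) l(2)] m(4) by simp
    moreover have "f i l y = f j l v"
      using dir_comp[OF i n(1) l(1) y n(2) l(3)] dir_comp[OF I(1) n(1) l(1) I(3) n(3) l(3)] n(4) by simp
    ultimately have "f i l ?xy = f j l (u \<otimes>\<^bsub>\<G> j\<^esub> v)"
      using hom_mult[OF dir_hom[OF i l(1) il(1)] x y] hom_mult[OF dir_hom[OF I(1) l(1) il(2)] I(2,3)] by simp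
    moreover have "u \<otimes>\<^bsub>\<G> j\<^esub> v \<in> carrier (\<G> j)"
      using dir_grp[OF I(1)] I by (simp add: group.is_monoid monoid.m_closed)
    ultimately show ?thesis using i I l il xy unfolding j E_def eventually_equal_def by blast
  qed
  have "E `` ?S = E `` {(i, ?xy)}"
  proof
    show "E `` ?S \<subseteq> E `` {(i, ?xy)}" using S_E eventually_equal_trans by blast
    show "E `` {(i, ?xy)} \<subseteq> E `` ?S" using in_S by blast
  qed
  then show "E `` {(i, ?xy)} = E `` {(i, x)} \<otimes>\<^bsub>direct_limit I r \<G> f\<^esub> E `` {(i, y)}"
    by (simp add: direct_limit_def E_def)
qed

end

text \<open>Involving \<Gamma> is a condition on two elements. Hence a witness in a quotient lifts
  to the group, and one in a direct limit lifts to a single group of the system, at a common upper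
  bound of two indices. Growth excludes the base case.\<close>

theorem BG_not_involves: "BG G \<Longrightarrow> group G \<and> \<not> involves_Gamma G"
proof (induction rule: BG.induct)
  case (base G)
  then show ?case using locally_subexponential_not_involves by (auto simp: locally_subexponential_def)
next
  case (subgroup G H)
  then have G: "group G" by blast
  have H: "group (G\<lparr>carrier := H\<rparr>)" using subgroup.subgroup_is_group[OF subgroup(2) G] .
  have "id \<in> hom (G\<lparr>carrier := H\<rparr>) G" "inj_on id (carrier (G\<lparr>carrier := H\<rparr>))"
    using subgroup.subset[OF subgroup(2)] by (auto simp: hom_def)
  then show ?case using involves_inj_hom[OF H G] H subgroup by blast
next
  case (quotient G N Q)
  then have G: "group G" by blast
  interpret N: normal N G by fact
  obtain \<psi> where \<psi>: "\<psi> \<in> iso (G Mod N) Q" using quotient by (auto simp: is_iso_def)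
  let ?h = "\<psi> \<circ> (#>\<^bsub>G\<^esub>) N"
  have h: "?h \<in> hom G Q"
    using \<psi> by (intro hom_compose[OF N.r_coset_hom_Mod]) (auto simp: iso_def)
  have surj: "\<exists>x\<in>carrier G. ?h x = q" if "q \<in> carrier Q" for q
  proof -
    have "q \<in> \<psi> ` carrier (G Mod N)" using \<psi> that by (auto simp: iso_def bij_betw_def)
    then show ?thesis by (auto simp: FactGroup_def RCOSETS_def)
  qed
  have "\<not> involves_Gamma Q"
  proof
    assume "involves_Gamma Q"
    then obtain x y where xy: "x \<in> carrier Q" "y \<in> carrier Q" "\<And>w. weval Q (gen2 x y) w = \<one>\<^bsub>Q\<^esub> \<Longrightarrow> act w = id"
      by (auto simp: involves_Gamma_def)
    obtain x' y' where "x' \<in> carrier G" "y' \<in> carrier G" "?h x' = x" "?h y' = y" using surj xy by metis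
    then have "involves_Gamma G" using involves_lift[OF G quotient(3) h] xy(3) by blast
    then show False using quotient by blast
  qed
  then show ?case using quotient by blast
next
  case (extension G N Q)
  obtain \<psi> where \<psi>: "\<psi> \<in> iso (G Mod N) Q" using extension by (auto simp: is_iso_def)
  have "\<not> involves_Gamma (G Mod N)"
    using involves_inj_hom[of "G Mod N" Q \<psi>] \<psi> extension normal.factorgroup_is_group[OF extension(2)]
    by (auto simp: iso_def bij_betw_def)
  then show ?case using involves_extension[OF extension(1,2)] extension by blast
next
  case (limit I r \<G> f L)
  have system: "directed_system I r \<G> f" and L: "group L" and iso: "direct_limit I r \<G> f \<cong> L"
    and IH: "\<And>i. i \<in> I \<Longrightarrow> group (\<G> i) \<and> \<not> involves_Gamma (\<G> i)"
    using limit by blast+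
  let ?D = "direct_limit I r \<G> f"
  obtain \<psi> where \<psi>: "\<psi> \<in> iso ?D L" using iso by (auto simp: is_iso_def)
  let ?c = "\<lambda>i x. eventually_equal I r \<G> f `` {(i, x)}"
  have h: "\<psi> \<circ> ?c i \<in> hom (\<G> i) L" if "i \<in> I" for i
    using \<psi> hom_direct_limit[OF system that] by (intro hom_compose) (auto simp: iso_def)
  have surj: "\<exists>i\<in>I. \<exists>x\<in>carrier (\<G> i). \<psi> (?c i x) = q" if "q \<in> carrier L" for q
  proof -
    have "q \<in> \<psi> ` carrier ?D" using \<psi> that by (auto simp: iso_def bij_betw_def)
    then show ?thesis by (auto simp: direct_limit_def quotient_def)
  qed
  have "\<not> involves_Gamma L"
  proof
    assume "involves_Gamma L"
    then obtain x y where xy: "x \<in> carrier L" "y \<in> carrier L" "\<And>w. weval L (gen2 x y) w = \<one>\<^bsub>L\<^esub> \<Longrightarrow> act w = id"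
      by (auto simp: involves_Gamma_def)
    obtain i x' j y' where ij: "i \<in> I" "x' \<in> carrier (\<G> i)" "\<psi> (?c i x') = x"
       "j \<in> I" "y' \<in> carrier (\<G> j)" "\<psi> (?c j y') = y" using surj xy(1,2) by meson
    have dir: "\<And>i j. i \<in> I \<Longrightarrow> j \<in> I \<Longrightarrow> \<exists>k\<in>I. (i, k) \<in> r \<and> (j, k) \<in> r"
      "\<And>i j. i \<in> I \<Longrightarrow> j \<in> I \<Longrightarrow> (i, j) \<in> r \<Longrightarrow> f i j \<in> hom (\<G> i) (\<G> j)"
      using system unfolding directed_system_def by blast+
    obtain k where k: "k \<in> I" "(i, k) \<in> r" "(j, k) \<in> r" using dir(1)[OF ij(1,4)] by blast
    have "f i k x' \<in> carrier (\<G> k)" "f j k y' \<in> carrier (\<G> k)"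
      using hom_in_carrier[OF dir(2)] ij k by blast+
    moreover have "\<psi> (?c k (f i k x')) = x" "\<psi> (?c k (f j k y')) = y"
      using direct_limit_shift[OF system ij(1) k(1,2) ij(2)]
        direct_limit_shift[OF system ij(4) k(1,3) ij(5)] ij by simp_all
    ultimately have "involves_Gamma (\<G> k)"
      using involves_lift[OF _ L h[OF k(1)], of "f i k x'" "f j k y'"] xy(3) IH[OF k(1)] by auto
    then show False using IH[OF k(1)] by blast
  qed
  then show ?case using L by blast
qed

lemma not_in_BG:
  assumes "group G" "involves_Gamma G"
  shows "\<not> in_BG TYPE('u) G"
proof
  assume "in_BG TYPE('u) G"
  then obtain H :: "'u monoid" and h where h: "h \<in> iso G H" and H: "BG H"
    by (auto simp: in_BG_def is_iso_def)
  have "involves_Gamma H"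
    using involves_inj_hom[OF assms(1) _ _ _ assms(2), of H h] h BG_not_involves[OF H]
    by (auto simp: iso_def bij_betw_def)
  then show False using BG_not_involves[OF H] by blast
qed

section \<open>Amenability\<close>

definition finitely_additive :: "('a, 'b) monoid_scheme \<Rightarrow> ('a set \<Rightarrow> real) \<Rightarrow> bool" where
  "finitely_additive G \<mu> \<longleftrightarrow> (\<forall>A. A \<subseteq> carrier G \<longrightarrow> 0 \<le> \<mu> A) \<and> \<mu> (carrier G) = 1 \<and>
    (\<forall>A B. A \<subseteq> carrier G \<longrightarrow> B \<subseteq> carrier G \<longrightarrow> A \<inter> B = {} \<longrightarrow> \<mu> (A \<union> B) = \<mu> A + \<mu> B)"

lemma finitely_additive_le_1:
  assumes "finitely_additive G \<mu>" "A \<subseteq> carrier G"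
  shows "\<mu> A \<le> 1"
proof -
  let ?B = "carrier G - A"
  have "A \<inter> ?B = {}" "?B \<subseteq> carrier G" "A \<union> ?B = carrier G" using assms(2) by auto
  then have "\<mu> (carrier G) = \<mu> A + \<mu> ?B" "0 \<le> \<mu> ?B" "\<mu> (carrier G) = 1"
    using assms unfolding finitely_additive_def by metis+
  then show ?thesis by simp
qed

lemma compact_unit_cube: "compact {f :: 'a \<Rightarrow> real. \<forall>x. f x \<in> {0..1}}"
proof -
  have "compactin (product_topology (\<lambda>_::'a. euclidean :: real topology) UNIV) (PiE UNIV (\<lambda>_. {0..1}))"
    by (subst compactin_PiE) auto
  moreover have "PiE UNIV (\<lambda>_. {0..1}) = {f :: 'a \<Rightarrow> real. \<forall>x. f x \<in> {0..1}}"
    by (auto simp: PiE_def Pi_def)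
  ultimately show ?thesis by (simp add: euclidean_product_topology)
qed

lemma continuous_on_coordinate: "continuous_on S (\<lambda>f :: 'a \<Rightarrow> real. f x)"
  by (rule continuous_on_subset[OF continuous_on_product_coordinates subset_UNIV])

context group
begin

lemma r_coset_eq: "g \<in> carrier G \<Longrightarrow> A \<subseteq> carrier G \<Longrightarrow> A #> g = {x \<in> carrier G. x \<otimes> inv g \<in> A}"
proof (intro equalityI subsetI)
  fix x assume g: "g \<in> carrier G" "A \<subseteq> carrier G" "x \<in> {x \<in> carrier G. x \<otimes> inv g \<in> A}"
  then have "x = (x \<otimes> inv g) \<otimes> g" by (simp add: m_assoc)
  then show "x \<in> A #> g" using g unfolding r_coset_def by blast
next
  fix x assume g: "g \<in> carrier G" "A \<subseteq> carrier G" "x \<in> A #> g"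
  then obtain a where "a \<in> A" "x = a \<otimes> g" by (auto simp: r_coset_def)
  moreover from this have "a \<in> carrier G" using g by blast
  ultimately show "x \<in> {x \<in> carrier G. x \<otimes> inv g \<in> A}" using g by (auto simp: m_assoc)
qed

lemma invariant_generate:
  assumes inv: "\<And>s A. s \<in> S \<Longrightarrow> A \<subseteq> carrier G \<Longrightarrow> \<mu> (A #> s) = \<mu> A"
    and S: "S \<subseteq> carrier G" and g: "g \<in> generate G S" and A: "A \<subseteq> carrier G"
  shows "\<mu> (A #> g) = \<mu> A"
  using g A
proof (induction arbitrary: A rule: generate.induct)
  case one
  then show ?case by (simp add: coset_mult_one)
next
  case (incl h)
  then show ?case by (rule inv)
next
  case (inv h)
  then have h: "h \<in> carrier G" using S by blast
  have "A #> inv h \<subseteq> carrier G" using r_coset_subset_G[OF inv(2)] h by simp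
  then have "\<mu> (A #> inv h #> h) = \<mu> (A #> inv h)" using inv(1) assms(1) by blast
  then show ?case using h inv(2) by (simp add: coset_mult_assoc coset_mult_one)
next
  case (eng h1 h2)
  then have h: "h1 \<in> carrier G" "h2 \<in> carrier G" using generate_in_carrier[OF S] by blast+
  have "A #> h1 \<subseteq> carrier G" using r_coset_subset_G[OF eng(5)] h by simp
  then have "\<mu> (A #> h1 #> h2) = \<mu> A" using eng by simp
  then show ?case using h eng(5) by (simp add: coset_mult_assoc)
qed

text \<open>Finitely additive measures are points of a cube, compact by Tychonoff. Each property of
  an invariant mean is a closed condition on finitely many coordinates, so a cluster point of ever
  more invariant measures has them all.\<close>

theorem amenable_criterion:
  assumes S: "S \<subseteq> carrier G" "generate G S = carrier G"
    and almost: "\<And>\<epsilon>. \<epsilon> > 0 \<Longrightarrow> \<exists>\<mu>. finitely_additive G \<mu> \<and>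
      (\<forall>s\<in>S. \<forall>A. A \<subseteq> carrier G \<longrightarrow> \<bar>\<mu> (A #> s) - \<mu> A\<bar> \<le> \<epsilon>)"
  shows "amenable G"
proof -
  have "\<forall>k::nat. \<exists>\<mu>. finitely_additive G \<mu> \<and>
      (\<forall>s\<in>S. \<forall>A. A \<subseteq> carrier G \<longrightarrow> \<bar>\<mu> (A #> s) - \<mu> A\<bar> \<le> 1 / (real k + 1))"
    using almost by simp
  then obtain \<nu> where \<nu>: "\<And>k. finitely_additive G (\<nu> k)"
    "\<And>k s A. s \<in> S \<Longrightarrow> A \<subseteq> carrier G \<Longrightarrow> \<bar>\<nu> k (A #> s) - \<nu> k A\<bar> \<le> 1 / (real k + 1)" by metis
  \<comment> \<open>Extending by intersection with the carrier gives points of the full cube,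
    indexed by all sets of the type.\<close>
  define \<phi> where "\<phi> k A = \<nu> k (A \<inter> carrier G)" for k A
  have \<phi>: "\<phi> k A = \<nu> k A" if "A \<subseteq> carrier G" for k A
    using that by (simp add: \<phi>_def Int_absorb2)
  define K where "K = {f :: 'a set \<Rightarrow> real. \<forall>x. f x \<in> {0..1}}"
  have "\<phi> k \<in> K" for k
  proof -
    have "\<phi> k A \<in> {0..1}" for A
      using finitely_additive_le_1[OF \<nu>(1), of "A \<inter> carrier G" k] \<nu>(1)[of k]
      by (auto simp: \<phi>_def finitely_additive_def)
    then show ?thesis by (simp add: K_def)
  qed
  then have "eventually (\<lambda>f. f \<in> K) (filtermap \<phi> sequentially)"
    by (simp add: eventually_filtermap)
  moreover have "filtermap \<phi> sequentially \<noteq> bot" by (simp add: filtermap_bot_iff)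
  ultimately obtain l where l: "inf (nhds l) (filtermap \<phi> sequentially) \<noteq> bot"
    using compact_unit_cube unfolding compact_filter K_def by metis
  \<comment> \<open>A cluster point lies in every closed set that contains a tail of the sequence;
    tails are needed because the invariance only improves with k.\<close>
  have closedI: "l \<in> C" if C: "closed C" "\<And>k. k \<ge> k0 \<Longrightarrow> \<phi> k \<in> C" for C k0
  proof (rule ccontr)
    assume "l \<notin> C"
    then have "eventually (\<lambda>f. f \<notin> C) (nhds l)"
      using C(1) eventually_nhds_in_open[of "- C" l] by (auto simp: open_Compl)
    moreover have "eventually (\<lambda>f. f \<in> C) (filtermap \<phi> sequentially)"
      using C(2) by (auto simp: eventually_filtermap eventually_sequentially)
    ultimately have "eventually (\<lambda>f. False) (inf (nhds l) (filtermap \<phi> sequentially))"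
      by (auto simp: eventually_inf)
    then show False using l by (simp add: trivial_limit_def)
  qed
  note closed = closed_Collect_le closed_Collect_eq
  note cont = continuous_on_coordinate continuous_on_const continuous_on_diff continuous_on_add continuous_on_rabs
  have nonneg: "0 \<le> l A" if A: "A \<subseteq> carrier G" for A
  proof -
    have "closed {f :: 'a set \<Rightarrow> real. 0 \<le> f A}" by (intro closed cont)
    from closedI[OF this, of 0] show ?thesis using A \<nu>(1) by (simp add: \<phi> finitely_additive_def)
  qed
  have total: "l (carrier G) = 1"
  proof -
    have "closed {f :: 'a set \<Rightarrow> real. f (carrier G) = 1}" by (intro closed cont)
    from closedI[OF this, of 0] show ?thesis using \<nu>(1) by (simp add: \<phi> finitely_additive_def)
  qed
  have additive: "l (A \<union> B) = l A + l B" if AB: "A \<subseteq> carrier G" "B \<subseteq> carrier G" "A \<inter> B = {}" for A B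
  proof -
    have "closed {f :: 'a set \<Rightarrow> real. f (A \<union> B) = f A + f B}" by (intro closed cont)
    from closedI[OF this, of 0] show ?thesis using AB \<nu>(1) by (simp add: \<phi> finitely_additive_def)
  qed
  have invariant: "l (A #> s) = l A" if s: "s \<in> S" and A: "A \<subseteq> carrier G" for s A
  proof -
    have "\<bar>l (A #> s) - l A\<bar> \<le> 1 / (real k0 + 1)" for k0
    proof -
      have As: "A #> s \<subseteq> carrier G" using A s S(1) r_coset_subset_G by blast
      have "closed {f :: 'a set \<Rightarrow> real. \<bar>f (A #> s) - f A\<bar> \<le> 1 / (real k0 + 1)}"
        by (intro closed cont)
      note closedI[OF this, of k0]
      moreover
        have "\<bar>\<phi> k (A #> s) - \<phi> k A\<bar> \<le> 1 / (real k0 + 1)" if "k0 \<le> k" for k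
        proof -
          have "1 / (real k + 1) \<le> 1 / (real k0 + 1)" using that by (simp add: frac_le)
          then show ?thesis using \<nu>(2)[OF s A, of k] by (simp add: \<phi>[OF A] \<phi>[OF As])
        qed
      ultimately show ?thesis by simp
    qed
    then have "\<bar>l (A #> s) - l A\<bar> \<le> 0"
      using LIMSEQ_le_const[OF LIMSEQ_Suc[OF lim_1_over_n], of "\<bar>l (A #> s) - l A\<bar>"] by (auto simp: add.commute)
    then show ?thesis by simp
  qed
  then have "l (A #> g) = l A" if "A \<subseteq> carrier G" "g \<in> carrier G" for A g
    using invariant_generate[of S l g A] S that by simp
  then show ?thesis
    unfolding amenable_def using is_group nonneg total additive by blast
qed

end

lemma amenableE:
  assumes "amenable G"
  obtains \<mu> where "finitely_additive G \<mu>"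
    "\<And>A g. A \<subseteq> carrier G \<Longrightarrow> g \<in> carrier G \<Longrightarrow> \<mu> (A #>\<^bsub>G\<^esub> g) = \<mu> A"
proof -
  have "\<exists>\<mu>. finitely_additive G \<mu> \<and>
      (\<forall>A g. A \<subseteq> carrier G \<longrightarrow> g \<in> carrier G \<longrightarrow> \<mu> (A #>\<^bsub>G\<^esub> g) = \<mu> A)"
    using assms unfolding amenable_def finitely_additive_def by (simp only: conj_assoc)
  then show thesis using that by (elim exE conjE) simp
qed

subsection \<open>From \<open>\<Gamma>\<close> to \<open>\<Delta>\<close>\<close>

lemma generate_Gamma: "generate Gamma {aut_a, aut_b} = carrier Gamma"
proof -
  have S: "{aut_a, aut_b} \<subseteq> carrier Gamma" by simp
  have "act w \<in> generate Gamma {aut_a, aut_b}" for w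
  proof (induction w)
    case Nil
    then show ?case using generate.one[of Gamma] unfolding Gamma_simps act.simps .
  next
    case (Cons l w)
    have "leval Gamma gam l \<in> generate Gamma {aut_a, aut_b}"
      by (cases l; cases "fst l") (auto simp: leval_def intro: generate.incl generate.inv)
    from generate.eng[OF this Cons.IH] show ?case
      using weval_Gamma[of "l # w"] weval_Gamma[of w] by (simp del: Gamma_simps act.simps)
  qed
  then show ?thesis using Gam.generate_in_carrier[OF S] by (auto simp: carrier_Gamma)
qed

lemma generate_Delta: "generate Delta {Delta_of_Gamma aut_b, Delta_t} = carrier Delta"
proof -
  let ?P = "presented_group {Gen_b, Gen_t} bt_relators" and ?gen = "presented_gen {Gen_b, Gen_t} bt_relators"
  obtain \<phi> where \<phi>: "\<phi> \<in> iso ?P Delta" "\<phi> (?gen Gen_b) = Delta_of_Gamma aut_b" "\<phi> (?gen Gen_t) = Delta_t"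
    using presentation_iso by blast
  then have hom: "\<phi> \<in> hom ?P Delta" and surj: "\<phi> ` carrier ?P = carrier Delta"
    by (auto simp: iso_def bij_betw_def)
  let ?T = "{Delta_of_Gamma aut_b, Delta_t}"
  have T: "?T \<subseteq> carrier Delta" by simp
  interpret P: group ?P by (rule group_presented_group[OF bt_relators_closed])
  have gen: "weval Delta (\<phi> \<circ> ?gen) w \<in> generate Delta ?T" for w
  proof (induction w)
    case Nil
    then show ?case by (simp add: generate.one)
  next
    case (Cons l w)
    have "leval Delta (\<phi> \<circ> ?gen) l \<in> generate Delta ?T"
      using \<phi>(2,3) by (cases l; cases "fst l") (auto simp: leval_def intro: generate.incl generate.inv)
    from generate.eng[OF this Cons.IH] show ?case by (simp only: weval.simps)
  qed
  have "d \<in> generate Delta ?T" if d: "d \<in> carrier Delta" for d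
  proof -
    obtain p where p: "p \<in> carrier ?P" "d = \<phi> p" using d surj by blast
    obtain w where "w \<in> words {Gen_b, Gen_t}" "p = weval ?P ?gen w"
      using presented_surj[OF bt_relators_closed p(1)] .
    then show ?thesis
      using gen[of w] P.hom_weval[OF group_Delta hom presented_gen_closed[OF bt_relators_closed]] p by simp
  qed
  then show ?thesis using Del.generate_in_carrier[OF T] by blast
qed

lemma conj_by_t_pow:
  assumes "g \<in> carrier Gamma"
  shows "Delta_of_Gamma g \<otimes>\<^bsub>Delta\<^esub> Delta_t [^]\<^bsub>Delta\<^esub> (n::nat) =
    Delta_t [^]\<^bsub>Delta\<^esub> n \<otimes>\<^bsub>Delta\<^esub> Delta_of_Gamma ((sig ^^ n) g)"
proof (induction n)
  case (Suc n)
  let ?h = "Delta_of_Gamma ((sig ^^ n) g)"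
  have h [simp]: "(sig ^^ n) g \<in> carrier Gamma" by (rule sig_pow_in_Gamma[OF assms])
  have "inv\<^bsub>Delta\<^esub> Delta_t \<otimes>\<^bsub>Delta\<^esub> (?h \<otimes>\<^bsub>Delta\<^esub> Delta_t) = Delta_of_Gamma (sig ((sig ^^ n) g))"
    using conj_by_t[OF h] by (simp add: conj_by_def Del.m_assoc)
  then have "?h \<otimes>\<^bsub>Delta\<^esub> Delta_t = Delta_t \<otimes>\<^bsub>Delta\<^esub> Delta_of_Gamma (sig ((sig ^^ n) g))"
    using Del.inv_solve_left[of "Delta_of_Gamma (sig ((sig ^^ n) g))" Delta_t "?h \<otimes>\<^bsub>Delta\<^esub> Delta_t"] by simp
  then show ?case using Suc assms
    by (simp add: Del.m_assoc[symmetric]) (simp add: Del.m_assoc)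
qed (use assms in simp)

text \<open>The mean averages, over \<open>i < n\<close>, the image of an invariant mean of \<open>\<Gamma>\<close> in
  \<open>t\<^sup>n \<Gamma> t\<^sup>-\<^sup>n t\<^sup>i\<close>.\<close>

theorem amenable_Delta:
  assumes "amenable Gamma"
  shows "amenable Delta"
proof (rule Del.amenable_criterion[OF _ generate_Delta])
  let ?b = "Delta_of_Gamma aut_b" and ?t = Delta_t and ?\<iota> = Delta_of_Gamma
  obtain m where m: "finitely_additive Gamma m"
    and m_inv: "\<And>A g. A \<subseteq> carrier Gamma \<Longrightarrow> g \<in> carrier Gamma \<Longrightarrow> m (A #>\<^bsub>Gamma\<^esub> g) = m A"
    using assms by (rule amenableE) (rule that)
  fix \<epsilon> :: real assume \<epsilon>: "\<epsilon> > 0"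
  obtain n :: nat where n: "n > 0" "2 / real n \<le> \<epsilon>"
  proof -
    obtain k :: nat where "k > 2 / \<epsilon>" using reals_Archimedean2 by blast
    moreover from this have "k > 0" using \<epsilon> by (metis divide_pos_pos gr0I of_nat_0 not_less_iff_gr_or_eq zero_less_numeral)
    ultimately show thesis using \<epsilon> that[of k] by (auto simp: field_simps)
  qed
  define e where "e i g = ?t [^]\<^bsub>Delta\<^esub> n \<otimes>\<^bsub>Delta\<^esub> ?\<iota> g \<otimes>\<^bsub>Delta\<^esub> inv\<^bsub>Delta\<^esub> (?t [^]\<^bsub>Delta\<^esub> (n - i))" for i g
  define X where "X i A = {g \<in> carrier Gamma. e i g \<in> A}" for i A
  define \<mu> where "\<mu> A = (\<Sum>i<n. m (X i A)) / n" for A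
  have e_closed: "e i g \<in> carrier Delta" if "g \<in> carrier Gamma" for i g
    using that by (simp add: e_def)
  have X_sub: "X i A \<subseteq> carrier Gamma" for i A by (auto simp: X_def)
  have m_X: "0 \<le> m (X i A)" "m (X i A) \<le> 1" for i A
    using m X_sub finitely_additive_le_1[OF m X_sub] by (auto simp: finitely_additive_def)
  have fa: "finitely_additive Delta \<mu>"
    unfolding finitely_additive_def
  proof (intro conjI allI impI)
    show "0 \<le> \<mu> A" for A using m_X by (simp add: \<mu>_def sum_nonneg)
    have "X i (carrier Delta) = carrier Gamma" for i using e_closed by (auto simp: X_def)
    then show "\<mu> (carrier Delta) = 1" using m n by (simp add: \<mu>_def finitely_additive_def)
    fix A B :: "((digit list \<Rightarrow> digit list) option \<times> bool) list set set" assume "A \<inter> B = {}"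
    then have "X i A \<inter> X i B = {}" "X i (A \<union> B) = X i A \<union> X i B" for i by (auto simp: X_def)
    then have "m (X i (A \<union> B)) = m (X i A) + m (X i B)" for i
      using m X_sub by (auto simp: finitely_additive_def)
    then show "\<mu> (A \<union> B) = \<mu> A + \<mu> B" by (simp add: \<mu>_def sum.distrib add_divide_distrib)
  qed
  have "\<mu> (A #>\<^bsub>Delta\<^esub> ?b) = \<mu> A" if A: "A \<subseteq> carrier Delta" for A
  proof -
    have "m (X i (A #>\<^bsub>Delta\<^esub> ?b)) = m (X i A)" if i: "i < n" for i
    proof -
      \<comment> \<open>Moving b across t^(n - i) replaces it by an element of \<Gamma>, so
        translation by b becomes translation inside \<Gamma> and the invariance under b is
        exact.\<close>
      define g where "g = (sig ^^ (n - i)) aut_b"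
      have g [simp]: "g \<in> carrier Gamma" by (simp add: g_def sig_pow_in_Gamma)
      define s where "s = ?t [^]\<^bsub>Delta\<^esub> (n - i)"
      have s [simp]: "s \<in> carrier Delta" by (simp add: s_def)
      have "?b \<otimes>\<^bsub>Delta\<^esub> s = s \<otimes>\<^bsub>Delta\<^esub> ?\<iota> g" using conj_by_t_pow[of aut_b "n - i"] by (simp add: g_def s_def)
      then have "inv\<^bsub>Delta\<^esub> (?b \<otimes>\<^bsub>Delta\<^esub> s) = inv\<^bsub>Delta\<^esub> (s \<otimes>\<^bsub>Delta\<^esub> ?\<iota> g)" by simp
      then have shift: "inv\<^bsub>Delta\<^esub> s \<otimes>\<^bsub>Delta\<^esub> inv\<^bsub>Delta\<^esub> ?b = inv\<^bsub>Delta\<^esub> ?\<iota> g \<otimes>\<^bsub>Delta\<^esub> inv\<^bsub>Delta\<^esub> s"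
        by (simp add: Del.inv_mult_group)
      have e: "e i x \<otimes>\<^bsub>Delta\<^esub> inv\<^bsub>Delta\<^esub> ?b = e i (x \<otimes>\<^bsub>Gamma\<^esub> inv\<^bsub>Gamma\<^esub> g)" if "x \<in> carrier Gamma" for x
        using that by (simp del: Gamma_simps add: e_def Del.m_assoc shift flip: s_def)
      have "X i (A #>\<^bsub>Delta\<^esub> ?b) = X i A #>\<^bsub>Gamma\<^esub> g"
        using A X_sub[of i A] by (auto simp del: Gamma_simps simp: Del.r_coset_eq Gam.r_coset_eq X_def e e_closed)
      then show ?thesis using m_inv[OF X_sub g] by simp
    qed
    then show ?thesis by (simp add: \<mu>_def)
  qed
  moreover have "\<bar>\<mu> (A #>\<^bsub>Delta\<^esub> ?t) - \<mu> A\<bar> \<le> \<epsilon>" if A: "A \<subseteq> carrier Delta" for A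
  proof -
    have shift: "X (Suc i) (A #>\<^bsub>Delta\<^esub> ?t) = X i A" if i: "i < n" for i
    proof -
      have "n - i = Suc (n - Suc i)" using i by simp
      then have "inv\<^bsub>Delta\<^esub> (?t [^]\<^bsub>Delta\<^esub> (n - Suc i)) \<otimes>\<^bsub>Delta\<^esub> inv\<^bsub>Delta\<^esub> ?t = inv\<^bsub>Delta\<^esub> (?t [^]\<^bsub>Delta\<^esub> (n - i))"
        by (simp only: Del.nat_pow_Suc2[OF Delta_t_closed] Del.inv_mult_group Del.nat_pow_closed Delta_t_closed)
      then have "e (Suc i) x \<otimes>\<^bsub>Delta\<^esub> inv\<^bsub>Delta\<^esub> ?t = e i x" if "x \<in> carrier Gamma" for x
        using that by (simp add: e_def Del.m_assoc)
      then show ?thesis using A by (auto simp: Del.r_coset_eq X_def e_closed)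
    qed
    obtain n' where n': "n = Suc n'" using n by (cases n) auto
    define x y where "x i = m (X i (A #>\<^bsub>Delta\<^esub> ?t))" and "y i = m (X i A)" for i
    \<comment> \<open>Translation by t moves the i-th term to the next one, so the two sums differ
      only in one term at each end, and both lie between 0 and 1.\<close>
    have "(\<Sum>i<n. x i) = x 0 + (\<Sum>i<n'. y i)"
      unfolding n' by (subst sum.lessThan_Suc_shift) (simp add: x_def y_def shift n')
    moreover have "(\<Sum>i<n. y i) = (\<Sum>i<n'. y i) + y n'" by (simp add: n')
    ultimately have "\<bar>(\<Sum>i<n. x i) - (\<Sum>i<n. y i)\<bar> \<le> 2"
      using m_X[of 0 "A #>\<^bsub>Delta\<^esub> ?t"] m_X[of n' A] by (simp add: x_def y_def)
    moreover have "\<mu> (A #>\<^bsub>Delta\<^esub> ?t) - \<mu> A = ((\<Sum>i<n. x i) - (\<Sum>i<n. y i)) / n"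
      by (simp add: \<mu>_def x_def y_def diff_divide_distrib)
    ultimately have "\<bar>\<mu> (A #>\<^bsub>Delta\<^esub> ?t) - \<mu> A\<bar> \<le> 2 / n" using n by (simp add: divide_right_mono)
    then show ?thesis using n by simp
  qed
  ultimately show "\<exists>\<mu>. finitely_additive Delta \<mu> \<and> (\<forall>s\<in>{?b, ?t}. \<forall>A. A \<subseteq> carrier Delta \<longrightarrow>
      \<bar>\<mu> (A #>\<^bsub>Delta\<^esub> s) - \<mu> A\<bar> \<le> \<epsilon>)" using fa \<epsilon> by auto
qed simp

subsection \<open>Entropy of random walks\<close>

text \<open>This is ln z <= z - 1 at z = sqrt (q / p). Summed over two probability vectors, the
  left-hand side becomes the sum of the squares (sqrt p - sqrt q)^2.\<close>

lemma kl_ge_hellinger: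
  fixes p q :: real
  assumes "p \<ge> 0" "q \<ge> 0" "p > 0 \<Longrightarrow> q > 0"
  shows "2 * p - 2 * (sqrt p * sqrt q) \<le> p * (ln p - ln q)"
proof (cases "p = 0")
  case False
  then have p: "p > 0" "q > 0" using assms by auto
  have "ln (sqrt q / sqrt p) \<le> sqrt q / sqrt p - 1" using p by (intro ln_le_minus_one) simp
  then have "(ln q - ln p) / 2 \<le> sqrt q / sqrt p - 1"
    using p by (simp add: ln_div ln_sqrt diff_divide_distrib)
  then have "p * ((ln q - ln p) / 2) \<le> p * (sqrt q / sqrt p - 1)"
    using p by (intro mult_left_mono) auto
  then have "p * (ln q - ln p) \<le> 2 * (p * (sqrt q / sqrt p - 1))"
    unfolding times_divide_eq_right by linarith
  moreover have "p * (sqrt q / sqrt p) = sqrt p * sqrt q"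
    using p by (simp add: field_simps flip: real_sqrt_mult) (simp add: real_sqrt_mult)
  ultimately show ?thesis unfolding right_diff_distrib by linarith
qed simp

text \<open>Factor |p - q| as |sqrt p - sqrt q| (sqrt p + sqrt q) and apply Cauchy-Schwarz; the
  second factor has square sum at most 4.\<close>

lemma sum_abs_le_hellinger:
  fixes p q :: "'a \<Rightarrow> real"
  assumes "\<And>x. x \<in> U \<Longrightarrow> p x \<ge> 0" "\<And>x. x \<in> U \<Longrightarrow> q x \<ge> 0" "sum p U = 1" "sum q U = 1"
    and h: "(\<Sum>x\<in>U. (sqrt (p x) - sqrt (q x))\<^sup>2) \<le> h"
  shows "(\<Sum>x\<in>U. \<bar>p x - q x\<bar>) \<le> 2 * sqrt h"
proof -
  let ?d = "\<lambda>x. \<bar>sqrt (p x) - sqrt (q x)\<bar>" and ?s = "\<lambda>x. sqrt (p x) + sqrt (q x)"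
  have "\<bar>p x - q x\<bar> = ?d x * ?s x" if "x \<in> U" for x
  proof -
    have "p x - q x = (sqrt (p x) - sqrt (q x)) * ?s x"
      using assms(1,2)[OF that] by (simp add: algebra_simps)
    moreover have "\<bar>?s x\<bar> = ?s x" using assms(1,2)[OF that] by simp
    ultimately show ?thesis by (metis abs_mult)
  qed
  then have "(\<Sum>x\<in>U. \<bar>p x - q x\<bar>) = (\<Sum>x\<in>U. ?d x * ?s x)" by simp
  also have "\<dots> \<le> sqrt (\<Sum>x\<in>U. (?d x)\<^sup>2) * sqrt (\<Sum>x\<in>U. (?s x)\<^sup>2)"
    using L2_set_mult_ineq[of ?d ?s U] assms(1,2) by (simp add: L2_set_def)
  also have "\<dots> \<le> sqrt h * sqrt 4"
  proof (intro mult_mono real_sqrt_le_mono)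
    show "(\<Sum>x\<in>U. (?d x)\<^sup>2) \<le> h" using h by simp
    have "(\<Sum>x\<in>U. (?s x)\<^sup>2) \<le> (\<Sum>x\<in>U. 2 * (p x + q x))"
    proof (rule sum_mono)
      fix x assume x: "x \<in> U"
      have "(?s x)\<^sup>2 = 2 * (p x + q x) - (sqrt (p x) - sqrt (q x))\<^sup>2"
        using assms(1,2)[OF x] by (simp add: power2_eq_square algebra_simps)
      then show "(?s x)\<^sup>2 \<le> 2 * (p x + q x)" by simp
    qed
    also have "\<dots> = 4"
      using assms(3,4) by (simp add: sum.distrib flip: sum_distrib_left)
    finally show "(\<Sum>x\<in>U. (?s x)\<^sup>2) \<le> 4" .
    have "0 \<le> (\<Sum>x\<in>U. (sqrt (p x) - sqrt (q x))\<^sup>2)" by (intro sum_nonneg) simp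
    then show "0 \<le> sqrt h" using h by simp
  qed (auto intro: sum_nonneg)
  finally show ?thesis by (simp add: real_sqrt_four mult.commute)
qed

text \<open>Steps are indexed by \<open>J\<close> with uniform weight, so trivial or repeated steps
  need no special treatment. The sets \<open>B n\<close> of reachable elements are finite, which
  makes all expectations finite sums.\<close>

locale random_walk = group +
  fixes J :: "'j set" and st :: "'j \<Rightarrow> 'a"
  assumes J: "finite J" "J \<noteq> {}" and st: "j \<in> J \<Longrightarrow> st j \<in> carrier G"
begin

primrec B :: "nat \<Rightarrow> 'a set" where
  "B 0 = {\<one>}"
| "B (Suc n) = (\<Union>j\<in>J. (\<lambda>x. x \<otimes> st j) ` B n)"

primrec \<mu> :: "nat \<Rightarrow> 'a \<Rightarrow> real" where
  "\<mu> 0 x = (if x = \<one> then 1 else 0)"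
| "\<mu> (Suc n) x = (\<Sum>j\<in>J. \<mu> n (x \<otimes> inv st j)) / card J"

definition E :: "nat \<Rightarrow> ('a \<Rightarrow> real) \<Rightarrow> real" where
  "E n f = (\<Sum>x\<in>B n. \<mu> n x * f x)"

definition H :: "nat \<Rightarrow> real" where
  "H n = (\<Sum>x\<in>B n. - (\<mu> n x * ln (\<mu> n x)))"

definition P :: "('a \<Rightarrow> real) \<Rightarrow> 'a \<Rightarrow> real" where
  "P f x = (\<Sum>j\<in>J. f (x \<otimes> st j)) / card J"

lemma card_J [simp]: "card J > 0"
  using J by (simp add: card_gt_0_iff)

lemma finite_B [simp]: "finite (B n)"
  using J by (induction n) auto

lemma B_closed: "B n \<subseteq> carrier G"
  using st by (induction n) auto

lemma B_D [dest]: "x \<in> B n \<Longrightarrow> x \<in> carrier G"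
  using B_closed by blast

lemma \<mu>_nonneg [simp]: "\<mu> n x \<ge> 0"
  by (induction n arbitrary: x) (auto intro!: divide_nonneg_nonneg sum_nonneg)

lemma \<mu>_outside: "x \<in> carrier G \<Longrightarrow> x \<notin> B n \<Longrightarrow> \<mu> n x = 0"
proof (induction n arbitrary: x)
  case (Suc n)
  have "x \<otimes> inv st j \<notin> B n" if "j \<in> J" for j
  proof
    assume "x \<otimes> inv st j \<in> B n"
    then have "x \<otimes> inv st j \<otimes> st j \<in> B (Suc n)" using that by auto
    then show False using Suc.prems st[OF that] by (simp add: m_assoc)
  qed
  then show ?case using Suc st by simp
qed auto

text \<open>Translation by \<open>st j\<close> maps \<open>B n\<close> injectively into
  \<open>B (Suc n)\<close>; off its image the argument of F is 0, so those terms vanish.\<close>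

lemma sum_translate:
  assumes j: "j \<in> J" and zero: "\<And>x. F 0 x = 0"
  shows "(\<Sum>x\<in>B (Suc n). F (\<mu> n (x \<otimes> inv st j)) x) = (\<Sum>y\<in>B n. F (\<mu> n y) (y \<otimes> st j))"
proof -
  let ?T = "(\<lambda>y. y \<otimes> st j) ` B n"
  have "(\<Sum>x\<in>B (Suc n). F (\<mu> n (x \<otimes> inv st j)) x) = (\<Sum>x\<in>?T. F (\<mu> n (x \<otimes> inv st j)) x)"
  proof (rule sum.mono_neutral_right)
    show "\<forall>x\<in>B (Suc n) - ?T. F (\<mu> n (x \<otimes> inv st j)) x = 0"
    proof
      fix x assume x: "x \<in> B (Suc n) - ?T"
      then have xc: "x \<in> carrier G" by blast
      have "x \<otimes> inv st j \<notin> B n"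
      proof
        assume "x \<otimes> inv st j \<in> B n"
        then have "x \<otimes> inv st j \<otimes> st j \<in> ?T" by blast
        then show False using x xc st[OF j] by (simp add: m_assoc)
      qed
      then show "F (\<mu> n (x \<otimes> inv st j)) x = 0" using \<mu>_outside xc st[OF j] zero by simp
    qed
  qed (use j J in auto)
  also have "\<dots> = (\<Sum>y\<in>B n. F (\<mu> n (y \<otimes> st j \<otimes> inv st j)) (y \<otimes> st j))"
  proof (subst sum.reindex)
    show "inj_on (\<lambda>y. y \<otimes> st j) (B n)"
      by (rule inj_onI) (metis B_D right_cancel st[OF j])
  qed simp
  also have "\<dots> = (\<Sum>y\<in>B n. F (\<mu> n y) (y \<otimes> st j))"
    using st[OF j] B_closed by (intro sum.cong) (auto simp: m_assoc)
  finally show ?thesis .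
qed

lemma E_Suc: "E (Suc n) f = E n (P f)"
proof -
  have "E (Suc n) f = (\<Sum>j\<in>J. \<Sum>x\<in>B (Suc n). \<mu> n (x \<otimes> inv st j) * f x) / card J"
    unfolding E_def by (simp add: sum_distrib_right sum_divide_distrib) (rule sum.swap)
  also have "(\<Sum>j\<in>J. \<Sum>x\<in>B (Suc n). \<mu> n (x \<otimes> inv st j) * f x) = (\<Sum>j\<in>J. \<Sum>y\<in>B n. \<mu> n y * f (y \<otimes> st j))"
    by (intro sum.cong refl sum_translate[where F = "\<lambda>p x. p * f x"]) auto
  also have "\<dots> / card J = E n (P f)"
    unfolding E_def P_def by (subst sum.swap) (simp add: sum_distrib_left sum_divide_distrib)
  finally show ?thesis .
qed

declare \<mu>.simps(2) [simp del] B.simps(2) [simp del]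

lemma E_const: "E n (\<lambda>_. c) = c"
proof (induction n)
  case (Suc n)
  have "P (\<lambda>_. c) = (\<lambda>_. c)" by (auto simp: P_def fun_eq_iff J)
  then show ?case using Suc by (simp add: E_Suc)
qed (simp add: E_def)

lemma sum_\<mu>: "(\<Sum>x\<in>B n. \<mu> n x) = 1"
  using E_const[of n 1] by (simp add: E_def)

lemma E_mono: "(\<And>x. x \<in> carrier G \<Longrightarrow> f x \<le> g x) \<Longrightarrow> E n f \<le> E n g"
  unfolding E_def by (intro sum_mono mult_left_mono) auto

text \<open>The assumption makes s^n \<Phi>, evaluated along the walk, lose at least s^n f on
  average in step n. The losses telescope against the initial value.\<close>

lemma discounted_sum_le:
  assumes s: "0 \<le> s" and \<Phi>: "\<And>x. x \<in> carrier G \<Longrightarrow> 0 \<le> \<Phi> x" "\<And>x. x \<in> carrier G \<Longrightarrow> f x + s * P \<Phi> x \<le> \<Phi> x"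
  shows "(\<Sum>n<N. s ^ n * E n f) \<le> \<Phi> \<one>"
proof -
  have "(\<Sum>n<N. s ^ n * E n f) + s ^ N * E N \<Phi> \<le> \<Phi> \<one>"
  proof (induction N)
    case (Suc N)
    have "E N (\<lambda>x. f x + s * P \<Phi> x) \<le> E N \<Phi>" by (rule E_mono) (rule \<Phi>)
    moreover have "E N (\<lambda>x. f x + s * P \<Phi> x) = E N f + s * E (Suc N) \<Phi>"
      by (simp add: E_Suc) (simp add: E_def sum.distrib sum_distrib_left algebra_simps)
    ultimately have "s ^ N * (E N f + s * E (Suc N) \<Phi>) \<le> s ^ N * E N \<Phi>"
      using s by (intro mult_left_mono) auto
    then show ?case using Suc by (simp add: algebra_simps)
  qed (simp add: E_def)
  moreover have "0 \<le> s ^ N * E N \<Phi>"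
    using s E_mono[of "\<lambda>_. 0" \<Phi> N] \<Phi>(1) E_const[of N 0] by simp
  ultimately show ?thesis by linarith
qed

text \<open>Relative entropy with respect to the Gibbs distribution proportional to exp (- c \<rho>)
  is nonnegative; \<open>W\<close> is its partition function.\<close>

lemma entropy_le:
  assumes Z: "(\<Sum>x\<in>B n. exp (- (c * \<rho> x))) \<le> Z"
  shows "H n \<le> c * E n \<rho> + ln Z"
proof -
  define W where "W = (\<Sum>x\<in>B n. exp (- (c * \<rho> x)))"
  have ne: "B n \<noteq> {}" using sum_\<mu>[of n] by auto
  then have W: "W > 0" unfolding W_def by (intro sum_pos) auto
  define r where "r x = exp (- (c * \<rho> x)) / W" for x
  have r: "r x > 0" for x using W by (simp add: r_def)
  have "(\<Sum>x\<in>B n. \<mu> n x * ln (r x) - \<mu> n x * ln (\<mu> n x)) \<le> (\<Sum>x\<in>B n. r x - \<mu> n x)"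
  proof (rule sum_mono)
    fix x
    show "\<mu> n x * ln (r x) - \<mu> n x * ln (\<mu> n x) \<le> r x - \<mu> n x"
    proof (cases "\<mu> n x = 0")
      case False
      then have m: "\<mu> n x > 0" using \<mu>_nonneg[of n x] by linarith
      have "ln (r x / \<mu> n x) \<le> r x / \<mu> n x - 1" using m r[of x] by (intro ln_le_minus_one) simp
      then have "\<mu> n x * (ln (r x) - ln (\<mu> n x)) \<le> \<mu> n x * (r x / \<mu> n x - 1)"
        using m r[of x] by (intro mult_left_mono) (auto simp: ln_div)
      then show ?thesis using m by (simp add: algebra_simps)
    qed (use r[of x] in simp)
  qed
  also have "\<dots> = 0"
    using W by (simp add: sum_subtractf sum_\<mu> r_def flip: sum_divide_distrib W_def)
  finally have "H n \<le> - (\<Sum>x\<in>B n. \<mu> n x * ln (r x))"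
    by (simp add: H_def sum_subtractf sum_negf)
  also have "\<dots> = (\<Sum>x\<in>B n. c * (\<mu> n x * \<rho> x) + ln W * \<mu> n x)"
    using W by (simp add: r_def ln_div algebra_simps sum_negf[symmetric])
  also have "\<dots> = c * E n \<rho> + ln W"
    by (simp add: E_def sum.distrib sum_\<mu> flip: sum_distrib_left)
  also have "ln W \<le> ln Z" using Z W by (simp add: W_def)
  finally show ?thesis by simp
qed

text \<open>\<open>\<mu> (Suc n)\<close> is the average of the translates of \<open>\<mu> n\<close>
  by the steps, and each translate has entropy \<open>H n\<close>. The increment is therefore the
  average relative entropy of the translates with respect to their mean, and
  \<open>kl_ge_hellinger\<close> bounds it from below.\<close>

lemma entropy_increment:
  "(\<Sum>j\<in>J. \<Sum>x\<in>B (Suc n). (sqrt (\<mu> n (x \<otimes> inv st j)) - sqrt (\<mu> (Suc n) x))\<^sup>2) / card J \<le> H (Suc n) - H n"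
proof -
  let ?p = "\<lambda>j x. \<mu> n (x \<otimes> inv st j)" and ?q = "\<mu> (Suc n)" and ?U = "B (Suc n)"
  have sum_p: "(\<Sum>x\<in>?U. ?p j x) = 1" if "j \<in> J" for j
    using sum_translate[OF that, where F = "\<lambda>p x. p"] sum_\<mu> by simp
  have pos: "?q x > 0" if "j \<in> J" "?p j x > 0" for j x
  proof -
    have "0 < (\<Sum>j\<in>J. ?p j x)" using J that by (intro sum_pos2[of _ j]) auto
    then show ?thesis by (simp add: \<mu>.simps(2))
  qed
  have Hn: "(\<Sum>j\<in>J. \<Sum>x\<in>?U. ?p j x * ln (?p j x)) = - (card J * H n)"
  proof -
    have "(\<Sum>x\<in>?U. ?p j x * ln (?p j x)) = - H n" if "j \<in> J" for j
      using sum_translate[OF that, where F = "\<lambda>p x. p * ln p"] by (simp add: H_def sum_negf)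
    then show ?thesis by simp
  qed
  have Hq: "(\<Sum>j\<in>J. \<Sum>x\<in>?U. ?p j x * ln (?q x)) = - (card J * H (Suc n))"
  proof -
    have "(\<Sum>j\<in>J. \<Sum>x\<in>?U. ?p j x * ln (?q x)) = (\<Sum>x\<in>?U. (\<Sum>j\<in>J. ?p j x) * ln (?q x))"
      by (subst sum.swap) (simp add: sum_distrib_right)
    also have "\<dots> = (\<Sum>x\<in>?U. card J * (?q x * ln (?q x)))"
      using J by (intro sum.cong) (auto simp: \<mu>.simps(2))
    finally show ?thesis by (simp only: H_def sum_negf sum_distrib_left[symmetric])
  qed
  have "(\<Sum>x\<in>?U. (sqrt (?p j x) - sqrt (?q x))\<^sup>2) \<le> (\<Sum>x\<in>?U. ?p j x * (ln (?p j x) - ln (?q x)))"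
    if j: "j \<in> J" for j
  proof -
    have "(\<Sum>x\<in>?U. (sqrt (?p j x) - sqrt (?q x))\<^sup>2) = (\<Sum>x\<in>?U. (?q x - ?p j x) + (2 * ?p j x - 2 * (sqrt (?p j x) * sqrt (?q x))))"
      by (intro sum.cong) (auto simp: power2_diff)
    also have "\<dots> = (\<Sum>x\<in>?U. 2 * ?p j x - 2 * (sqrt (?p j x) * sqrt (?q x)))"
      using sum_p[OF j] sum_\<mu>[of "Suc n"]
      by (simp add: sum.distrib sum_subtractf sum_distrib_left[symmetric])
    also have "\<dots> \<le> (\<Sum>x\<in>?U. ?p j x * (ln (?p j x) - ln (?q x)))"
      by (intro sum_mono kl_ge_hellinger pos[OF j]) simp_all
    finally show ?thesis .
  qed
  then have "(\<Sum>j\<in>J. \<Sum>x\<in>?U. (sqrt (?p j x) - sqrt (?q x))\<^sup>2)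
    \<le> (\<Sum>j\<in>J. \<Sum>x\<in>?U. ?p j x * (ln (?p j x) - ln (?q x)))" by (rule sum_mono)
  also have "\<dots> = card J * (H (Suc n) - H n)"
    using Hn Hq by (simp add: right_diff_distrib sum_subtractf)
  finally show ?thesis using J by (simp add: divide_le_eq mult.commute)
qed

definition \<nu> :: "nat \<Rightarrow> 'a set \<Rightarrow> real" where
  "\<nu> n A = (\<Sum>x\<in>A \<inter> B n. \<mu> n x)"

lemma finitely_additive_\<nu>: "finitely_additive G (\<nu> n)"
proof -
  have "carrier G \<inter> B n = B n" using B_closed by blast
  moreover have "(\<Sum>x\<in>(A \<union> C) \<inter> B n. \<mu> n x) = (\<Sum>x\<in>A \<inter> B n. \<mu> n x) + (\<Sum>x\<in>C \<inter> B n. \<mu> n x)"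
    if "A \<inter> C = {}" for A C
    using that by (simp add: Int_Un_distrib2) (rule sum.union_disjoint, auto)
  ultimately show ?thesis by (simp add: finitely_additive_def \<nu>_def sum_\<mu> sum_nonneg)
qed

text \<open>The step k is idle, so \<open>\<mu> n\<close> is one of the translates: both it and its
  translate by \<open>st j\<close> are close to \<open>\<mu> (Suc n)\<close>, hence to each
  other.\<close>

lemma \<nu>_almost_invariant:
  fixes \<delta> :: real
  assumes j: "j \<in> J" and k: "k \<in> J" "st k = \<one>" and \<delta>: "H (Suc n) - H n \<le> \<delta>" and A: "A \<subseteq> carrier G"
  shows "\<bar>\<nu> n (A #> st j) - \<nu> n A\<bar> \<le> 4 * sqrt (card J * \<delta>)"
proof -
  let ?p = "\<lambda>j x. \<mu> n (x \<otimes> inv st j)" and ?q = "\<mu> (Suc n)" and ?U = "B (Suc n)"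
  have hell: "(\<Sum>x\<in>?U. \<bar>?p i x - ?q x\<bar>) \<le> 2 * sqrt (card J * \<delta>)" if i: "i \<in> J" for i
  proof (rule sum_abs_le_hellinger)
    show "(\<Sum>x\<in>?U. ?p i x) = 1"
      using sum_translate[OF i, where F = "\<lambda>p x. p"] sum_\<mu> by simp
    have "(\<Sum>x\<in>?U. (sqrt (?p i x) - sqrt (?q x))\<^sup>2) \<le> (\<Sum>j\<in>J. \<Sum>x\<in>?U. (sqrt (?p j x) - sqrt (?q x))\<^sup>2)"
      by (rule member_le_sum[OF i]) (auto intro: sum_nonneg simp: J)
    also have "\<dots> \<le> card J * \<delta>"
    proof -
      have "(\<Sum>j\<in>J. \<Sum>x\<in>?U. (sqrt (?p j x) - sqrt (?q x))\<^sup>2) / card J \<le> \<delta>"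
        using entropy_increment[of n] \<delta> by linarith
      moreover have "0 < real (card J)" by simp
      ultimately show ?thesis by (simp only: pos_divide_le_eq mult.commute)
    qed
    finally show "(\<Sum>x\<in>?U. (sqrt (?p i x) - sqrt (?q x))\<^sup>2) \<le> card J * \<delta>" .
  qed (simp_all add: sum_\<mu>)
  let ?As = "A #> st j"
  have As: "?As \<subseteq> carrier G" using A st[OF j] r_coset_subset_G by blast
  have pk: "?p k x = \<mu> n x" if "x \<in> carrier G" for x using k that by simp
  have "B n \<subseteq> ?U"
  proof
    fix x assume x: "x \<in> B n"
    then have "x \<in> (\<lambda>x. x \<otimes> st k) ` B n" using k by (intro image_eqI[of _ _ x]) auto
    then show "x \<in> ?U" using k(1) unfolding B.simps(2) by blast
  qed
  then have "\<nu> n ?As = (\<Sum>x\<in>?As \<inter> ?U. \<mu> n x)"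
    unfolding \<nu>_def using \<mu>_outside by (intro sum.mono_neutral_left) auto
  also have "\<dots> = (\<Sum>x\<in>?As \<inter> ?U. ?p k x)" using pk by (intro sum.cong) auto
  finally have 1: "\<nu> n ?As = (\<Sum>x\<in>?As \<inter> ?U. ?p k x)" .
  have "\<nu> n A = (\<Sum>y\<in>B n. if y \<otimes> st j \<in> ?As then \<mu> n y else 0)"
  proof -
    have "y \<otimes> st j \<in> ?As \<longleftrightarrow> y \<in> A" if "y \<in> B n" for y
      using that A st[OF j] by (auto simp: r_coset_eq m_assoc)
    then have "(\<Sum>y\<in>B n. if y \<otimes> st j \<in> ?As then \<mu> n y else 0) = (\<Sum>y\<in>B n. if y \<in> A then \<mu> n y else 0)"
      by (intro sum.cong) auto
    then show ?thesis unfolding \<nu>_def by (simp add: sum.inter_restrict Int_commute[of A])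
  qed
  also have "\<dots> = (\<Sum>x\<in>?U. if x \<in> ?As then ?p j x else 0)"
    using sum_translate[OF j, where F = "\<lambda>p x. if x \<in> ?As then p else 0" and n = n] by simp
  also have "\<dots> = (\<Sum>x\<in>?As \<inter> ?U. ?p j x)"
    using sum.inter_restrict[of ?U "?p j" ?As] by (simp add: Int_commute)
  finally have 2: "\<nu> n A = (\<Sum>x\<in>?As \<inter> ?U. ?p j x)" .
  have "\<bar>\<nu> n ?As - \<nu> n A\<bar> \<le> (\<Sum>x\<in>?As \<inter> ?U. \<bar>?p k x - ?p j x\<bar>)"
    unfolding 1 2 sum_subtractf[symmetric] by (rule sum_abs)
  also have "\<dots> \<le> (\<Sum>x\<in>?U. \<bar>?p k x - ?q x\<bar> + \<bar>?p j x - ?q x\<bar>)"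
  proof -
    have "(\<Sum>x\<in>?As \<inter> ?U. \<bar>?p k x - ?p j x\<bar>) \<le> (\<Sum>x\<in>?U. \<bar>?p k x - ?p j x\<bar>)"
      by (rule sum_mono2) auto
    also have "\<dots> \<le> (\<Sum>x\<in>?U. \<bar>?p k x - ?q x\<bar> + \<bar>?p j x - ?q x\<bar>)"
      by (rule sum_mono) linarith
    finally show ?thesis .
  qed
  also have "\<dots> \<le> 4 * sqrt (card J * \<delta>)"
    using hell[OF j] hell[OF k(1)] by (simp add: sum.distrib)
  finally show ?thesis .
qed

text \<open>Otherwise \<open>H n\<close> is at least \<delta> n, and the sum over n < N grows like
  \<delta> N^2 / 2, which exceeds the bound with c = \<delta> / 4.\<close>

lemma small_increment:
  assumes bound: "\<And>c. c > 0 \<Longrightarrow> \<exists>C. \<forall>N. (\<Sum>n<N. H n) \<le> c * (real N)\<^sup>2 + C * real N" and \<delta>: "\<delta> > 0"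
  shows "\<exists>n. H (Suc n) - H n \<le> \<delta>"
proof (rule ccontr)
  assume "\<nexists>n. H (Suc n) - H n \<le> \<delta>"
  then have inc: "H n + \<delta> \<le> H (Suc n)" for n by (metis add.commute le_diff_eq linear)
  have "\<delta> * n \<le> H n" for n
  proof (induction n)
    case (Suc n)
    then show ?case using inc[of n] by (simp add: algebra_simps)
  qed (simp add: H_def)
  then have "(\<Sum>n<N. \<delta> * real n) \<le> (\<Sum>n<N. H n)" for N by (intro sum_mono) auto
  moreover have "(\<Sum>n<N. \<delta> * real n) = \<delta> * (real N * (real N - 1) / 2)" for N
    by (induction N) (auto simp: algebra_simps)
  moreover obtain C where "\<And>N. (\<Sum>n<N. H n) \<le> \<delta> / 4 * (real N)\<^sup>2 + C * real N"
    using bound[of "\<delta> / 4"] \<delta> by auto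
  ultimately have le: "\<delta> * (real N * (real N - 1) / 2) \<le> \<delta> / 4 * (real N)\<^sup>2 + C * real N" for N
    by (metis order_trans)
  obtain N :: nat where N: "real N > 4 * (\<bar>C\<bar> + \<delta>) / \<delta>" using reals_Archimedean2 by blast
  then have "real N * \<delta> > 4 * (\<bar>C\<bar> + \<delta>)" using \<delta> by (simp add: field_simps)
  moreover have "real N > 0" using N \<delta> by (smt (verit) divide_nonneg_pos)
  moreover have "real N * (\<delta> * (real N - 1) / 2) \<le> real N * (\<delta> / 4 * real N + C)"
    using le[of N] by (simp add: algebra_simps power2_eq_square)
  ultimately have "\<delta> * (real N - 1) / 2 \<le> \<delta> / 4 * real N + C" by (simp add: mult_le_cancel_left_pos)
  then have "real N * \<delta> \<le> 4 * C + 2 * \<delta>" by (simp add: field_simps)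
  then show False using \<open>real N * \<delta> > 4 * (\<bar>C\<bar> + \<delta>)\<close> \<delta> by (simp add: abs_if split: if_splits)
qed

theorem amenable_of_entropy:
  assumes gen: "generate G (st ` J) = carrier G" and k: "k \<in> J" "st k = \<one>"
    and bound: "\<And>c. c > 0 \<Longrightarrow> \<exists>C. \<forall>N. (\<Sum>n<N. H n) \<le> c * (real N)\<^sup>2 + C * real N"
  shows "amenable G"
proof (rule amenable_criterion[OF _ gen])
  show "st ` J \<subseteq> carrier G" using st by blast
  fix \<epsilon> :: real assume \<epsilon>: "\<epsilon> > 0"
  define \<delta> where "\<delta> = (\<epsilon> / 4)\<^sup>2 / card J"
  have "\<delta> > 0" using \<epsilon> by (simp add: \<delta>_def J)
  then obtain n where n: "H (Suc n) - H n \<le> \<delta>" using small_increment[OF bound] by blast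
  have "4 * sqrt (card J * \<delta>) = \<epsilon>" using \<epsilon> J by (simp add: \<delta>_def)
  then show "\<exists>\<mu>. finitely_additive G \<mu> \<and> (\<forall>s\<in>st ` J. \<forall>A. A \<subseteq> carrier G \<longrightarrow> \<bar>\<mu> (A #> s) - \<mu> A\<bar> \<le> \<epsilon>)"
    using finitely_additive_\<nu>[of n] \<nu>_almost_invariant[OF _ k n] by (intro exI[of _ "\<nu> n"]) auto
qed

end

subsection \<open>Sections and word length\<close>

definition wlen :: "(digit list \<Rightarrow> digit list) \<Rightarrow> nat" where
  "wlen g = (LEAST n. \<exists>w. act w = g \<and> length w = n)"

lemma wlen_le: "wlen (act w) \<le> length w"
  unfolding wlen_def by (rule Least_le) blast

lemma wlen_ex:
  assumes "g \<in> carrier Gamma"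
  obtains w where "g = act w" "length w = wlen g"
proof -
  have "\<exists>n w. act w = g \<and> length w = n" using assms by (auto elim: Gamma_cases)
  then have "\<exists>w. act w = g \<and> length w = wlen g" unfolding wlen_def by (rule LeastI_ex)
  then show thesis using that by blast
qed

lemma wlen_id: "wlen id = 0"
  using wlen_le[of "[]"] by simp

lemma wlen_lact: "g \<in> carrier Gamma \<Longrightarrow> wlen (lact l \<circ> g) \<le> wlen g + 1"
proof -
  assume "g \<in> carrier Gamma"
  then obtain w where "g = act w" "length w = wlen g" by (rule wlen_ex)
  then show ?thesis using wlen_le[of "w @ [l]"] by simp
qed

lemma lact_mult_Gamma [simp]: "g \<in> carrier Gamma \<Longrightarrow> lact l \<circ> g \<in> carrier Gamma"
  by (metis Gamma_cases act.simps act_append act_in_Gamma comp_id fun.map_id id_comp)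

definition fsec :: "digit \<Rightarrow> (digit list \<Rightarrow> digit list) \<Rightarrow> digit list \<Rightarrow> digit list" where
  "fsec x g v = tl (g (x # v))"

definition fpos :: "digit \<Rightarrow> (digit list \<Rightarrow> digit list) \<Rightarrow> digit" where
  "fpos x g = hd (g [x])"

lemma fsec_act [simp]: "fsec x (act w) = act (wsec w x)"
  by (auto simp: fsec_def act_Cons)

lemma fpos_act [simp]: "fpos x (act w) = wpos w x"
  by (auto simp: fpos_def act_Cons)

lemma fsec_Gamma [simp]: "g \<in> carrier Gamma \<Longrightarrow> fsec x g \<in> carrier Gamma"
  by (auto elim: Gamma_cases)

lemma fsec_lact:
  assumes "g \<in> carrier Gamma"
  shows "fsec x (lact l \<circ> g) = act (lsec l (fpos x g)) \<circ> fsec x g" "fpos x (lact l \<circ> g) = lpos l (fpos x g)"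
proof -
  obtain w where w: "g = act w" using assms by (rule Gamma_cases)
  have "lact l \<circ> g = act (w @ [l])" by (simp add: w)
  then show "fsec x (lact l \<circ> g) = act (lsec l (fpos x g)) \<circ> fsec x g" "fpos x (lact l \<circ> g) = lpos l (fpos x g)"
    by (simp_all only: fsec_act fpos_act) (simp_all add: w)
qed

lemma wlen_sections:
  assumes "g \<in> carrier Gamma"
  shows "wlen (fsec One g) + wlen (fsec Two g) \<le> wlen g"
proof -
  obtain w where w: "g = act w" "length w = wlen g" using assms by (rule wlen_ex)
  then show ?thesis
    using wlen_le[of "wsec w One"] wlen_le[of "wsec w Two"] length_wsec[of One Two w] by simp
qed

lemma fpos_cases:
  assumes "g \<in> carrier Gamma"
  obtains "fpos One g = One" "fpos Two g = Two" | "fpos One g = Two" "fpos Two g = One"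
proof -
  obtain w where w: "g = act w" using assms by (rule Gamma_cases)
  then show thesis using that wpos_inj[of w One Two] by (cases "wpos w One"; cases "wpos w Two") auto
qed

primrec cost :: "nat \<Rightarrow> (digit list \<Rightarrow> digit list) \<Rightarrow> real" where
  "cost 0 g = wlen g"
| "cost (Suc k) g = cost k (fsec One g) + cost k (fsec Two g)"

lemma cost_nonneg [simp]: "0 \<le> cost k g"
  by (induction k arbitrary: g) auto

lemma cost_le_wlen: "g \<in> carrier Gamma \<Longrightarrow> cost k g \<le> wlen g"
proof (induction k arbitrary: g)
  case (Suc k)
  show ?case
    using Suc.IH[OF fsec_Gamma[OF Suc.prems], of One] Suc.IH[OF fsec_Gamma[OF Suc.prems], of Two]
      of_nat_mono[OF wlen_sections[OF Suc.prems], where 'a = real] by simp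
qed simp

text \<open>A generator writes at most one letter into the sections of a given level: a letter goes
  to only one of the two subtrees, and the same holds further down.\<close>

lemma cost_lact: "g \<in> carrier Gamma \<Longrightarrow> cost k (lact l \<circ> g) \<le> cost k g + 1"
proof (induction k arbitrary: g l)
  case 0
  then have "real (wlen (lact l \<circ> g)) \<le> real (wlen g + 1)" using wlen_lact by (intro of_nat_mono)
  then show ?case unfolding cost.simps by linarith
next
  case (Suc k)
  let ?i = "\<lambda>d. real (length (lsec l d))"
  have sec: "cost k (act (lsec l d) \<circ> h) \<le> cost k h + ?i d" if "h \<in> carrier Gamma" for d h
  proof -
    have "\<exists>m. lsec l d = [] \<or> lsec l d = [m]"
      by (cases l; cases "fst l"; cases "snd l"; cases d) auto
    then consider "lsec l d = []" | m where "lsec l d = [m]" by blast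
    then show ?thesis
    proof cases
      case 2
      then have "act (lsec l d) = lact m" "?i d = 1" by simp_all
      then show ?thesis using Suc.IH[OF that, of m] by (simp only:)
    qed simp
  qed
  have i: "?i One + ?i Two = 1" by (cases l; cases "fst l"; cases "snd l") auto
  from Suc.prems have "?i (fpos One g) + ?i (fpos Two g) = 1"
    using i by (cases rule: fpos_cases) (simp_all add: add.commute)
  then show ?case
    using sec[OF fsec_Gamma[OF Suc.prems], of "fpos One g" One] sec[OF fsec_Gamma[OF Suc.prems], of "fpos Two g" Two]
    unfolding cost.simps fsec_lact[OF Suc.prems] by linarith
qed

text \<open>At most 4^n elements have length n, so the constant ln 8 reduces the sum to a geometric
  series of ratio 1 / 2.\<close>

lemma exp_cost_0:
  assumes "finite U" "U \<subseteq> carrier Gamma"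
  shows "(\<Sum>g\<in>U. exp (- (ln 8 * cost 0 g))) \<le> 2"
proof -
  have "\<forall>g\<in>U. \<exists>w. g = act w \<and> length w = wlen g" using assms(2) wlen_ex by blast
  then obtain wd where wd: "\<And>g. g \<in> U \<Longrightarrow> g = act (wd g) \<and> length (wd g) = wlen g" by metis
  have fin: "finite (UNIV :: (ab \<times> bool) set)" and card: "card (UNIV :: (ab \<times> bool) set) = 4"
  proof -
    have "(UNIV :: ab set) = {La, Lb}" using ab.exhaust by blast
    note ab = this
    have "finite (UNIV :: ab set)" "card (UNIV :: ab set) = 2" unfolding ab by simp_all
    then show "finite (UNIV :: (ab \<times> bool) set)" "card (UNIV :: (ab \<times> bool) set) = 4"
      by (simp_all add: card_cartesian_product flip: UNIV_Times_UNIV)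
  qed
  define M where "M = Suc (Max (insert 0 (wlen ` U)))"
  have M: "wlen g < M" if "g \<in> U" for g
    using that assms(1) by (simp add: M_def less_Suc_eq_le Max_ge)
  let ?W = "\<Union>n<M. {w :: word. length w = n}"
  have finW: "finite {w :: word. length w = n}" "card {w :: word. length w = n} = 4 ^ n" for n
    using finite_lists_length_eq[OF fin, of n] card_lists_length_eq[OF fin, of n] card by simp_all
  have exp8: "exp (- (ln 8 * real n)) = (1 / 8) ^ n" for n
    by (simp add: exp_minus mult.commute[of "ln 8"] exp_of_nat_mult power_one_over inverse_eq_divide)
  have "(\<Sum>g\<in>U. exp (- (ln 8 * cost 0 g))) = (\<Sum>g\<in>U. (1 / 8) ^ length (wd g))"
    using wd by (intro sum.cong) (auto simp: exp8)
  also have "\<dots> = (\<Sum>w\<in>wd ` U. (1 / 8) ^ length w)"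
    using wd by (subst sum.reindex) (auto simp: inj_on_def, metis)
  also have "\<dots> \<le> (\<Sum>w\<in>?W. (1 / 8) ^ length w)"
    using M wd finW by (intro sum_mono2) auto
  also have "\<dots> = (\<Sum>n<M. \<Sum>w\<in>{w :: word. length w = n}. (1 / 8) ^ length w)"
    using finW by (intro sum.UNION_disjoint) auto
  also have "\<dots> = (\<Sum>n<M. (1 / 2) ^ n)"
  proof (rule sum.cong)
    fix n
    have "(\<Sum>w\<in>{w :: word. length w = n}. (1 / 8 :: real) ^ length w) = (\<Sum>w\<in>{w :: word. length w = n}. (1 / 8) ^ n)"
      by (intro sum.cong) auto
    also have "\<dots> = 4 ^ n * (1 / 8) ^ n" using finW(2)[of n] by simp
    also have "\<dots> = (4 * (1 / 8)) ^ n" by (rule power_mult_distrib[symmetric])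
    finally show "(\<Sum>w\<in>{w :: word. length w = n}. (1 / 8 :: real) ^ length w) = (1 / 2) ^ n" by simp
  qed simp
  also have "\<dots> \<le> 2" by (simp add: geometric_sum)
  finally show ?thesis .
qed

text \<open>An element is determined by its action on the first level and its two sections.\<close>

lemma exp_cost_bounded: "\<exists>Z. \<forall>U. finite U \<longrightarrow> U \<subseteq> carrier Gamma \<longrightarrow> (\<Sum>g\<in>U. exp (- (ln 8 * cost k g))) \<le> Z"
proof (induction k)
  case 0
  then show ?case using exp_cost_0 by blast
next
  case (Suc k)
  then obtain Z where Z: "\<And>U. finite U \<Longrightarrow> U \<subseteq> carrier Gamma \<Longrightarrow> (\<Sum>g\<in>U. exp (- (ln 8 * cost k g))) \<le> Z" by blast
  have Z0: "0 \<le> Z" using Z[of "{}"] by simp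
  have "(\<Sum>g\<in>U. exp (- (ln 8 * cost (Suc k) g))) \<le> 2 * (Z * Z)" if U: "finite U" "U \<subseteq> carrier Gamma" for U
  proof -
    let ?e = "\<lambda>g. exp (- (ln 8 * cost k g))"
    define F where "F g = (fpos One g, fsec One g, fsec Two g)" for g
    have "inj_on F U"
    proof (rule inj_onI)
      fix g h assume gh: "g \<in> U" "h \<in> U" "F g = F h"
      obtain u w where uw: "g = act u" "h = act w" using gh(1,2) U(2) by (metis Gamma_cases subsetD)
      have "wpos u One = wpos w One" "act (wsec u x) = act (wsec w x)" for x
        using gh(3) by (cases x; simp add: F_def uw)+
      moreover from this(1) have "wpos u Two = wpos w Two"
        using wpos_inj[of u One Two] wpos_inj[of w One Two] by (cases "wpos u Two"; cases "wpos w Two"; cases "wpos w One") auto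
      ultimately show "g = h" unfolding uw act_eq_iff[of u w] All_digit by blast
    qed
    let ?T = "{One, Two} \<times> (fsec One ` U \<times> fsec Two ` U)"
    have "(\<Sum>g\<in>U. exp (- (ln 8 * cost (Suc k) g))) = (\<Sum>g\<in>U. (\<lambda>(d, x, y). ?e x * ?e y) (F g))"
      by (intro sum.cong) (auto simp: F_def distrib_left mult_exp_exp)
    also have "\<dots> = (\<Sum>t\<in>F ` U. (\<lambda>(d, x, y). ?e x * ?e y) t)"
      using \<open>inj_on F U\<close> by (subst sum.reindex) (auto simp: comp_def)
    also have "\<dots> \<le> (\<Sum>t\<in>?T. (\<lambda>(d, x, y). ?e x * ?e y) t)"
    proof (rule sum_mono2)
      have "fpos One g \<in> {One, Two}" for g by (cases "fpos One g") auto
      then show "F ` U \<subseteq> ?T" by (auto simp: F_def)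
    qed (use U in auto)
    also have "\<dots> = 2 * ((\<Sum>x\<in>fsec One ` U. ?e x) * (\<Sum>y\<in>fsec Two ` U. ?e y))"
    proof -
      have "(\<Sum>t\<in>?T. (\<lambda>(d, x, y). ?e x * ?e y) t) =
          (\<Sum>d\<in>{One, Two}. \<Sum>p\<in>fsec One ` U \<times> fsec Two ` U. ?e (fst p) * ?e (snd p))"
        by (subst sum.cartesian_product) (simp add: split_def)
      then show ?thesis by (simp add: sum_product sum.cartesian_product split_def)
    qed
    also have "\<dots> \<le> 2 * (Z * Z)"
    proof -
      have "(\<Sum>x\<in>fsec d ` U. ?e x) \<le> Z" for d using U by (intro Z) auto
      then have "(\<Sum>x\<in>fsec One ` U. ?e x) * (\<Sum>y\<in>fsec Two ` U. ?e y) \<le> Z * Z"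
        using Z0 by (intro mult_mono) (auto intro: sum_nonneg)
      then show ?thesis by simp
    qed
    finally show ?thesis .
  qed
  then show ?case by blast
qed

subsection \<open>Potentials of the killed walk\<close>

text \<open>One step of the walk which multiplies by \<open>a\<^sup>\<plusminus>\<^sup>1\<close> with total weight \<open>\<alpha>\<close>, by \<open>b\<^sup>\<plusminus>\<^sup>1\<close> with total
  weight \<open>\<beta>\<close>, and dies otherwise.\<close>

definition step :: "real \<Rightarrow> real \<Rightarrow> ((digit list \<Rightarrow> digit list) \<Rightarrow> real) \<Rightarrow> (digit list \<Rightarrow> digit list) \<Rightarrow> real" where
  "step \<alpha> \<beta> f g = \<alpha> / 2 * (f (aut_a \<circ> g) + f (inv_a \<circ> g)) + \<beta> / 2 * (f (aut_b \<circ> g) + f (inv_b \<circ> g))"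

text \<open>A nonnegative supersolution: iterating the inequality shows that \<Phi> dominates the
  expected total of f along the killed walk.\<close>

definition potential :: "real \<Rightarrow> real \<Rightarrow> ((digit list \<Rightarrow> digit list) \<Rightarrow> real) \<Rightarrow> ((digit list \<Rightarrow> digit list) \<Rightarrow> real) \<Rightarrow> bool" where
  "potential \<alpha> \<beta> f \<Phi> \<longleftrightarrow> (\<forall>g\<in>carrier Gamma. 0 \<le> \<Phi> g \<and> f g + step \<alpha> \<beta> \<Phi> g \<le> \<Phi> g)"

lemma aut_mult_Gamma [simp]:
  assumes "g \<in> carrier Gamma"
  shows "aut_a \<circ> g \<in> carrier Gamma" "inv_a \<circ> g \<in> carrier Gamma" "aut_b \<circ> g \<in> carrier Gamma" "inv_b \<circ> g \<in> carrier Gamma"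
  using lact_mult_Gamma[OF assms, of "(La, True)"] lact_mult_Gamma[OF assms, of "(La, False)"]
    lact_mult_Gamma[OF assms, of "(Lb, True)"] lact_mult_Gamma[OF assms, of "(Lb, False)"] by (simp_all only: lact.simps)

lemma fsec_aut:
  assumes "g \<in> carrier Gamma"
  shows "fpos x (aut_a \<circ> g) = lpos (La, True) (fpos x g)" "fpos x (inv_a \<circ> g) = lpos (La, False) (fpos x g)"
    "fpos x (aut_b \<circ> g) = fpos x g" "fpos x (inv_b \<circ> g) = fpos x g"
    "fsec x (aut_a \<circ> g) = act (lsec (La, True) (fpos x g)) \<circ> fsec x g"
    "fsec x (inv_a \<circ> g) = act (lsec (La, False) (fpos x g)) \<circ> fsec x g"
    "fsec x (aut_b \<circ> g) = act (lsec (Lb, True) (fpos x g)) \<circ> fsec x g"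
    "fsec x (inv_b \<circ> g) = act (lsec (Lb, False) (fpos x g)) \<circ> fsec x g"
  using fsec_lact[OF assms, of x "(La, True)"] fsec_lact[OF assms, of x "(La, False)"]
    fsec_lact[OF assms, of x "(Lb, True)"] fsec_lact[OF assms, of x "(Lb, False)"] by (simp_all only: lact.simps lpos.simps)

text \<open>The walk survives a step with weight 1 - \<epsilon>, and a step lengthens a word by at
  most 1; summing (1 - \<epsilon>)^n (|g| + n) gives the two orders in 1 / \<epsilon>.\<close>

lemma potential_0:
  assumes "0 \<le> \<alpha>" "0 \<le> \<beta>" and \<epsilon>: "\<epsilon> = 1 - \<alpha> - \<beta>" "0 < \<epsilon>"
  shows "potential \<alpha> \<beta> (cost 0) (\<lambda>g. 1 / \<epsilon>\<^sup>2 + wlen g / \<epsilon>)"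
  unfolding potential_def
proof (intro ballI conjI)
  fix g assume g: "g \<in> carrier Gamma"
  let ?\<Phi> = "\<lambda>g. 1 / \<epsilon>\<^sup>2 + wlen g / \<epsilon>"
  define K where "K = 1 / \<epsilon>\<^sup>2 + (real (wlen g) + 1) / \<epsilon>"
  have *: "?\<Phi> (lact l \<circ> g) \<le> K" for l
    using wlen_lact[OF g, of l] \<epsilon> unfolding K_def by (intro add_left_mono divide_right_mono) auto
  have twice: "\<delta> / 2 * (x + y) \<le> \<delta> * K" if "x \<le> K" "y \<le> K" "0 \<le> \<delta>" for x y \<delta>
    using mult_left_mono[of "x + y" "2 * K" "\<delta> / 2"] that by simp
  have "step \<alpha> \<beta> ?\<Phi> g \<le> \<alpha> * K + \<beta> * K"
    unfolding step_def
    using *[of "(La, True)"] *[of "(La, False)"] *[of "(Lb, True)"] *[of "(Lb, False)"] assms(1,2)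
    unfolding lact.simps by (intro add_mono twice)
  also have "\<dots> = (\<alpha> + \<beta>) * K" by (simp add: distrib_right)
  also have "\<alpha> + \<beta> = 1 - \<epsilon>" using \<epsilon> by simp
  finally have "step \<alpha> \<beta> ?\<Phi> g \<le> (1 - \<epsilon>) * K" .
  moreover have "real (wlen g) + (1 - \<epsilon>) * K = ?\<Phi> g - 1"
    using \<epsilon>(2) by (simp add: K_def field_simps power2_eq_square)
  ultimately show "cost 0 g + step \<alpha> \<beta> ?\<Phi> g \<le> ?\<Phi> g" unfolding cost.simps by linarith
  show "0 \<le> ?\<Phi> g" using \<epsilon> by simp
qed

text \<open>Watched at the vertex \<open>One\<close>, the section performs a walk of the same kind: \<open>b\<close> contributes
  \<open>a\<close>, and an excursion through \<open>Two\<close> contributes \<open>b\<close>, \<open>b\<^sup>-\<^sup>1\<close> or, half of the time, nothing.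
  This loss is the factor \<open>1 - E / 2\<close>.\<close>

lemma potential_Suc:
  fixes \<alpha> \<beta> \<epsilon> E \<alpha>' \<beta>' \<epsilon>' m C L :: real
  assumes \<alpha>: "0 \<le> \<alpha>" and \<beta>: "0 \<le> \<beta>" and \<epsilon>: "\<epsilon> = 1 - \<alpha> - \<beta>" "0 < \<epsilon>"
    and E: "E = \<alpha>\<^sup>2 / (1 - \<beta>)" and \<alpha>': "\<alpha>' = \<beta> / (1 - E / 2)" and \<beta>': "\<beta>' = (E / 2) / (1 - E / 2)"
    and \<epsilon>': "\<epsilon>' = 1 - \<alpha>' - \<beta>'"
    and nonneg: "0 \<le> m" "0 \<le> C" "0 \<le> L"
    and pot: "potential \<alpha>' \<beta>' (cost k) \<Phi>'"
    and bound: "\<And>g. g \<in> carrier Gamma \<Longrightarrow> \<Phi>' g \<le> m / \<epsilon>'\<^sup>2 + (C + L * wlen g) / \<epsilon>'"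
  shows "\<exists>\<Phi>. potential \<alpha> \<beta> (cost (Suc k)) \<Phi> \<and> (\<forall>g\<in>carrier Gamma.
    \<Phi> g \<le> (1 - E / 2) * m / \<epsilon>\<^sup>2 + ((2 * C + L + 2) + (2 * L + 1) * wlen g) / \<epsilon>)"
proof -
  define q D where "q = 1 - \<beta>" and "D = 1 - E / 2"
  have q: "q = \<alpha> + \<epsilon>" "0 < q" "\<epsilon> \<le> q" "\<alpha> \<le> q" using assms by (auto simp: q_def)
  \<comment> \<open>Each visit to \<open>One\<close> counts 1, and the visits to \<open>Two\<close>
    that follow it count \<alpha> (1 + \<beta> + \<beta>^2 + ...) = \<alpha> / q. Likewise E =
    \<alpha>^2 / q is the weight of a full excursion.\<close>
  define \<gamma> where "\<gamma> = 1 + \<alpha> / q"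
  have \<gamma>: "1 \<le> \<gamma>" using \<alpha> q by (simp add: \<gamma>_def)
  have E': "E = \<alpha>\<^sup>2 / q" "0 \<le> E" using E q by (auto simp: q_def)
  have "\<alpha>\<^sup>2 \<le> q * q" using q \<alpha> unfolding power2_eq_square by (intro mult_mono) auto
  moreover have "q * q \<le> q * 1" using \<beta> q(2) by (intro mult_left_mono) (auto simp: q_def)
  ultimately have "\<alpha>\<^sup>2 \<le> q" by linarith
  then have "E \<le> 1" using q by (simp add: E'(1) divide_le_eq)
  then have D: "0 < D" "D \<le> 1" using E' by (auto simp: D_def)
  have \<alpha>D: "\<alpha>' * D = \<beta>" and \<beta>D: "\<beta>' * D = E / 2"
    using D unfolding \<alpha>' \<beta>' D_def[symmetric] by simp_all
  have \<epsilon>'_eq: "\<epsilon>' = \<epsilon> * \<gamma> / D"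
  proof -
    have "\<epsilon>' * D = D - \<alpha>' * D - \<beta>' * D" by (simp add: \<epsilon>' algebra_simps)
    also have "\<dots> = q - E" unfolding \<alpha>D \<beta>D by (simp add: D_def q_def)
    also have "\<dots> = \<epsilon> * \<gamma>"
    proof -
      have "q * E = \<alpha> * \<alpha>" "q * \<gamma> = q + \<alpha>" "\<epsilon> = q - \<alpha>"
        using q(1,2) by (simp_all add: E'(1) \<gamma>_def power2_eq_square distrib_left)
      then have "q * (q - E) = q * (\<epsilon> * \<gamma>)"
        by (simp add: right_diff_distrib mult.left_commute[of q]) (simp add: algebra_simps)
      then show ?thesis using q(2) by simp
    qed
    finally show ?thesis using D by (simp add: eq_divide_eq)
  qed
  have \<epsilon>'_pos: "0 < \<epsilon>'" using \<epsilon>'_eq \<epsilon> \<gamma> D by simp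
  \<comment> \<open>Entering \<open>Two\<close> through a writes the letter b, which raises the cost
    there by at most 1. These visits have weight \<alpha> / (2 q), and 1 / \<epsilon>' sums the
    error over the induced walk.\<close>
  define \<kappa> where "\<kappa> = \<alpha> / (2 * q) / \<epsilon>'"
  have \<kappa>: "0 \<le> \<kappa>" using \<alpha> q \<epsilon>'_pos by (simp add: \<kappa>_def)
  \<comment> \<open>The bounds for a vertex now at \<open>One\<close> or at \<open>Two\<close>.
    Division by D restores the excursions that write nothing, which the induced walk omits; \<Psi>2
    is the solution of the equation \<open>at_Two\<close>.\<close>
  define \<Psi>1 where "\<Psi>1 x = (\<gamma> * \<Phi>' x + \<kappa>) / D" for x
  define \<Psi>2 where "\<Psi>2 x = (cost k x + \<alpha> / 2 * (\<Psi>1 x + \<Psi>1 (inv_b \<circ> x))) / q" for x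
  have \<Phi>': "0 \<le> \<Phi>' x" "cost k x + step \<alpha>' \<beta>' \<Phi>' x \<le> \<Phi>' x" if "x \<in> carrier Gamma" for x
    using pot that by (auto simp: potential_def)
  have \<Psi>1_nonneg: "0 \<le> \<Psi>1 x" if "x \<in> carrier Gamma" for x
    using \<Phi>'(1)[OF that] \<gamma> \<kappa> D by (simp add: \<Psi>1_def)
  have \<Psi>2_nonneg: "0 \<le> \<Psi>2 x" if "x \<in> carrier Gamma" for x
    using \<Psi>1_nonneg that \<alpha> q by (simp add: \<Psi>2_def)
  have at_Two: "cost k x + \<beta> * \<Psi>2 x + \<alpha> / 2 * (\<Psi>1 x + \<Psi>1 (inv_b \<circ> x)) = \<Psi>2 x" for x
  proof -
    have "q * \<Psi>2 x = cost k x + \<alpha> / 2 * (\<Psi>1 x + \<Psi>1 (inv_b \<circ> x))" using q by (simp add: \<Psi>2_def)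
    then show ?thesis by (simp add: q_def algebra_simps)
  qed
  have at_One: "cost k x + \<beta> / 2 * (\<Psi>1 (aut_a \<circ> x) + \<Psi>1 (inv_a \<circ> x)) + \<alpha> / 2 * (\<Psi>2 (aut_b \<circ> x) + \<Psi>2 x) \<le> \<Psi>1 x"
    if x: "x \<in> carrier Gamma" for x
  proof -
    define \<rho> fx fa fa' fb fb' where "\<rho> = cost k x" and "fx = \<Phi>' x" and "fa = \<Phi>' (aut_a \<circ> x)"
      and "fa' = \<Phi>' (inv_a \<circ> x)" and "fb = \<Phi>' (aut_b \<circ> x)" and "fb' = \<Phi>' (inv_b \<circ> x)"
    define U W where "U = \<alpha>' / 2 * (fa + fa')" and "W = \<beta>' / 2 * (fb + fb')"
    define X1 X2 where "X1 = \<beta> / 2 * (\<Psi>1 (aut_a \<circ> x) + \<Psi>1 (inv_a \<circ> x))"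
      and "X2 = E / 4 * (\<Psi>1 (aut_b \<circ> x) + 2 * \<Psi>1 x + \<Psi>1 (inv_b \<circ> x))"
    have bb: "inv_b \<circ> (aut_b \<circ> x) = x" by auto
    have "cost k (aut_b \<circ> x) \<le> \<rho> + 1" using cost_lact[OF x, of k "(Lb, True)"] by (simp add: \<rho>_def)
    then have "\<Psi>2 (aut_b \<circ> x) \<le> (\<rho> + 1 + \<alpha> / 2 * (\<Psi>1 (aut_b \<circ> x) + \<Psi>1 x)) / q"
      using q unfolding \<Psi>2_def bb by (intro divide_right_mono) auto
    then have "\<alpha> / 2 * (\<Psi>2 (aut_b \<circ> x) + \<Psi>2 x) \<le>
        \<alpha> / 2 * ((\<rho> + 1 + \<alpha> / 2 * (\<Psi>1 (aut_b \<circ> x) + \<Psi>1 x)) / q + (\<rho> + \<alpha> / 2 * (\<Psi>1 x + \<Psi>1 (inv_b \<circ> x))) / q)"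
      using \<alpha> unfolding \<Psi>2_def[of x] \<rho>_def by (intro mult_left_mono add_mono) auto
    also have "\<dots> = \<alpha> / q * \<rho> + \<alpha> / (2 * q) + X2"
    proof -
      define i where "i = 1 / q"
      have i: "z / q = z * i" "z / (2 * q) = z * i / 2" for z
        by (simp_all add: i_def)
      have "\<alpha> / 2 * ((\<rho> + 1 + \<alpha> / 2 * (u + v)) * i + (\<rho> + \<alpha> / 2 * (v + w)) * i) =
          \<alpha> * i * \<rho> + \<alpha> * i / 2 + \<alpha> * \<alpha> * i / 4 * (u + 2 * v + w)" for u v w
        by (simp add: field_simps)
      then show ?thesis unfolding X2_def E'(1) power2_eq_square i by simp
    qed
    finally have "\<alpha> / 2 * (\<Psi>2 (aut_b \<circ> x) + \<Psi>2 x) \<le> \<alpha> / q * \<rho> + \<alpha> / (2 * q) + X2" .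
    moreover have "\<kappa> * \<epsilon>' = \<alpha> / (2 * q)" using \<epsilon>'_pos by (simp add: \<kappa>_def)
    moreover have "\<gamma> * \<rho> = \<rho> + \<alpha> / q * \<rho>" by (simp add: \<gamma>_def distrib_right)
    ultimately have 1: "\<rho> + X1 + \<alpha> / 2 * (\<Psi>2 (aut_b \<circ> x) + \<Psi>2 x) \<le> \<gamma> * \<rho> + \<kappa> * \<epsilon>' + X1 + X2"
      by linarith
    have D\<Psi>: "D * \<Psi>1 y = \<gamma> * \<Phi>' y + \<kappa>" for y using D by (simp add: \<Psi>1_def)
    have "X1 = \<alpha>' / 2 * (D * \<Psi>1 (aut_a \<circ> x) + D * \<Psi>1 (inv_a \<circ> x))"
      unfolding X1_def \<alpha>D[symmetric] by (simp add: algebra_simps)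
    then have X1: "X1 = \<gamma> * U + \<alpha>' * \<kappa>"
      unfolding D\<Psi> U_def fa_def fa'_def by (simp add: algebra_simps)
    have "X2 = \<beta>' / 2 * (D * \<Psi>1 (aut_b \<circ> x) + D * \<Psi>1 (inv_b \<circ> x)) + E / 2 * \<Psi>1 x"
    proof -
      have "E / 4 = \<beta>' * D / 2" using \<beta>D by simp
      then show ?thesis unfolding X2_def \<beta>D[symmetric] by (simp add: algebra_simps)
    qed
    then have X2: "X2 = \<gamma> * W + \<beta>' * \<kappa> + E / 2 * \<Psi>1 x"
      unfolding D\<Psi> W_def fb_def fb'_def by (simp add: algebra_simps)
    have "\<rho> + (U + W) \<le> fx"
      using \<Phi>'(2)[OF x] unfolding step_def U_def W_def \<rho>_def fx_def fa_def fa'_def fb_def fb'_def .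
    then have "\<gamma> * (\<rho> + (U + W)) \<le> \<gamma> * fx" using \<gamma> by (intro mult_left_mono) auto
    then have "\<gamma> * \<rho> + (\<gamma> * U + \<gamma> * W) \<le> \<gamma> * fx" by (simp only: distrib_left)
    moreover have "\<gamma> * fx + \<kappa> = D * \<Psi>1 x" unfolding D\<Psi> fx_def ..
    moreover have "\<kappa> * \<epsilon>' + \<alpha>' * \<kappa> + \<beta>' * \<kappa> = \<kappa>" by (simp add: \<epsilon>' algebra_simps)
    moreover have "D * \<Psi>1 x + E / 2 * \<Psi>1 x = \<Psi>1 x" by (simp add: D_def algebra_simps)
    ultimately show ?thesis using 1 X1 X2 unfolding X1_def[symmetric] \<rho>_def[symmetric] by linarith
  qed
  define \<Psi> where "\<Psi> d = (case d of One \<Rightarrow> \<Psi>1 | Two \<Rightarrow> \<Psi>2)" for d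
  define T where "T x g = \<Psi> (fpos x g) (fsec x g)" for x g
  define \<Phi> where "\<Phi> g = T One g + T Two g" for g
  have T: "cost k (fsec x g) + step \<alpha> \<beta> (T x) g \<le> T x g" if g: "g \<in> carrier Gamma" for x g
  proof (cases "fpos x g")
    case One
    then show ?thesis
      using at_One[OF fsec_Gamma[OF g, of x]] by (simp add: step_def T_def fsec_aut[OF g] \<Psi>_def algebra_simps)
  next
    case Two
    then show ?thesis
      using at_Two[of "fsec x g"] by (simp add: step_def T_def fsec_aut[OF g] \<Psi>_def algebra_simps)
  qed
  have "potential \<alpha> \<beta> (cost (Suc k)) \<Phi>"
    unfolding potential_def
  proof (intro ballI conjI)
    fix g assume g: "g \<in> carrier Gamma"
    show "0 \<le> \<Phi> g"
      using \<Psi>1_nonneg \<Psi>2_nonneg g by (auto simp: \<Phi>_def T_def \<Psi>_def split: digit.splits)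
    have "step \<alpha> \<beta> \<Phi> g = step \<alpha> \<beta> (T One) g + step \<alpha> \<beta> (T Two) g"
      by (simp add: step_def \<Phi>_def algebra_simps)
    then show "cost (Suc k) g + step \<alpha> \<beta> \<Phi> g \<le> \<Phi> g" using T[OF g, of One] T[OF g, of Two] by (simp add: \<Phi>_def)
  qed
  moreover have "\<Phi> g \<le> (1 - E / 2) * m / \<epsilon>\<^sup>2 + ((2 * C + L + 2) + (2 * L + 1) * wlen g) / \<epsilon>"
    if g: "g \<in> carrier Gamma" for g
  proof -
    define M where "M = D * m / (\<gamma> * \<epsilon>\<^sup>2)"
    have M: "0 \<le> M" using D nonneg \<gamma> by (simp add: M_def)
    have b1: "\<Psi>1 x \<le> M + (C + 1 + L * l) / \<epsilon>" if x: "x \<in> carrier Gamma" and l: "real (wlen x) \<le> l" for x l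
    proof -
      have "\<Psi>1 x \<le> (\<gamma> * (m / \<epsilon>'\<^sup>2 + (C + L * wlen x) / \<epsilon>') + \<kappa>) / D"
        unfolding \<Psi>1_def using bound[OF x] \<gamma> D by (intro divide_right_mono add_right_mono mult_left_mono) auto
      also have "\<dots> = M + (C + L * wlen x) / \<epsilon> + \<alpha> / (2 * q) / (\<epsilon> * \<gamma>)"
      proof -
        have "(\<gamma> * (m / (\<epsilon> * \<gamma> / D)\<^sup>2 + c / (\<epsilon> * \<gamma> / D)) + z / (\<epsilon> * \<gamma> / D)) / D =
            D * m / (\<gamma> * \<epsilon>\<^sup>2) + c / \<epsilon> + z / (\<epsilon> * \<gamma>)" for c z
        proof -
          have nz: "D \<noteq> 0" "\<epsilon> \<noteq> 0" "\<gamma> \<noteq> 0" using D(1) \<epsilon>(2) \<gamma> by auto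
          have "(\<gamma> * (m / (\<epsilon> * \<gamma> / D)\<^sup>2 + c / (\<epsilon> * \<gamma> / D)) + z / (\<epsilon> * \<gamma> / D)) / D =
              \<gamma> * (m / (\<epsilon> * \<gamma> / D)\<^sup>2) / D + \<gamma> * (c / (\<epsilon> * \<gamma> / D)) / D + z / (\<epsilon> * \<gamma> / D) / D"
            by (simp only: distrib_left add_divide_distrib)
          moreover have "\<gamma> * (m / (\<epsilon> * \<gamma> / D)\<^sup>2) / D = D * m / (\<gamma> * \<epsilon>\<^sup>2)"
            using nz by (simp add: power2_eq_square mult.commute mult.left_commute)
          moreover have "\<gamma> * (c / (\<epsilon> * \<gamma> / D)) / D = c / \<epsilon>" "z / (\<epsilon> * \<gamma> / D) / D = z / (\<epsilon> * \<gamma>)"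
            using nz by simp_all
          ultimately show ?thesis by simp
        qed
        then show ?thesis unfolding \<kappa>_def \<epsilon>'_eq M_def .
      qed
      also have "\<alpha> / (2 * q) / (\<epsilon> * \<gamma>) \<le> 1 / \<epsilon>"
      proof (rule frac_le)
        show "\<alpha> / (2 * q) \<le> 1" using q(2,4) by (simp add: pos_divide_le_eq)
        show "\<epsilon> \<le> \<epsilon> * \<gamma>" using mult_left_mono[OF \<gamma>, of \<epsilon>] \<epsilon>(2) by simp
      qed (use \<epsilon> in auto)
      also have "(C + L * wlen x) / \<epsilon> \<le> (C + L * l) / \<epsilon>"
        using l nonneg \<epsilon> by (intro divide_right_mono add_left_mono mult_left_mono) auto
      finally show ?thesis by (simp add: add_divide_distrib)
    qed
    have b2: "\<Psi>2 x \<le> \<alpha> / q * M + (C + 1 + L + L * wlen x + wlen x) / \<epsilon>" if x: "x \<in> carrier Gamma" for x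
    proof -
      define R where "R = (C + 1 + L * (real (wlen x) + 1)) / \<epsilon>"
      have R: "0 \<le> R" using nonneg \<epsilon> by (simp add: R_def)
      have "\<Psi>1 x \<le> M + R" "\<Psi>1 (inv_b \<circ> x) \<le> M + R"
        using b1[OF x, of "real (wlen x) + 1"] b1[OF aut_mult_Gamma(4)[OF x], of "real (wlen x) + 1"]
          wlen_lact[OF x, of "(Lb, False)"] by (auto simp: R_def)
      then have "\<alpha> / 2 * (\<Psi>1 x + \<Psi>1 (inv_b \<circ> x)) \<le> \<alpha> / 2 * (2 * (M + R))"
        using \<alpha> by (intro mult_left_mono) auto
      then have "\<Psi>2 x \<le> (wlen x + \<alpha> / 2 * (2 * (M + R))) / q"
        unfolding \<Psi>2_def using q cost_le_wlen[OF x, of k] by (intro divide_right_mono add_mono) auto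
      also have "\<dots> = wlen x / q + \<alpha> / q * M + \<alpha> / q * R" by (simp add: add_divide_distrib distrib_left)
      also have "wlen x / q \<le> wlen x / \<epsilon>" using q \<epsilon> by (intro divide_left_mono) auto
      also have "\<alpha> / q * R \<le> 1 * R" using R q by (intro mult_right_mono) auto
      finally show ?thesis by (simp add: R_def add_divide_distrib distrib_left)
    qed
    obtain x y where xy: "\<Phi> g = \<Psi>1 (fsec x g) + \<Psi>2 (fsec y g)"
    proof (rule fpos_cases[OF g])
      assume "fpos One g = One" "fpos Two g = Two"
      then show thesis using that[of One Two] by (simp add: \<Phi>_def T_def \<Psi>_def)
    next
      assume "fpos One g = Two" "fpos Two g = One"
      then show thesis using that[of Two One] by (simp add: \<Phi>_def T_def \<Psi>_def)
    qed
    have len: "real (wlen (fsec z g)) \<le> wlen g" for z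
      using wlen_sections[OF g] by (cases z) auto
    have "\<Psi>1 (fsec x g) \<le> M + (C + 1 + L * wlen g) / \<epsilon>" using b1[OF fsec_Gamma[OF g] len] .
    moreover have "\<Psi>2 (fsec y g) \<le> \<alpha> / q * M + (C + 1 + L + L * wlen g + wlen g) / \<epsilon>"
    proof -
      have "(C + 1 + L + L * wlen (fsec y g) + wlen (fsec y g)) / \<epsilon> \<le> (C + 1 + L + L * wlen g + wlen g) / \<epsilon>"
        using len[of y] nonneg \<epsilon> by (intro divide_right_mono add_mono mult_left_mono) auto
      then show ?thesis using b2[OF fsec_Gamma[OF g, of y]] by linarith
    qed
    ultimately have "\<Phi> g \<le> (M + \<alpha> / q * M) + ((C + 1 + L * wlen g) / \<epsilon> + (C + 1 + L + L * wlen g + wlen g) / \<epsilon>)"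
      using xy by linarith
    \<comment> \<open>The two vertices of the first level are at \<open>One\<close> and at
      \<open>Two\<close>. Their leading terms have the ratio 1 to \<alpha> / q and add up to
      \<gamma> M, so \<gamma> cancels and the factor D = 1 - E / 2 is the net gain.\<close>
    also have "M + \<alpha> / q * M = \<gamma> * M" by (simp add: \<gamma>_def algebra_simps)
    also have "\<gamma> * M = (1 - E / 2) * m / \<epsilon>\<^sup>2" using \<gamma> by (simp add: M_def D_def)
    also have "(C + 1 + L * wlen g) / \<epsilon> + (C + 1 + L + L * wlen g + wlen g) / \<epsilon> = ((2 * C + L + 2) + (2 * L + 1) * wlen g) / \<epsilon>"
      by (simp add: add_divide_distrib[symmetric] algebra_simps)
    finally show ?thesis .
  qed
  ultimately show ?thesis by blast
qed

subsection \<open>Sublinear cost and amenability of \<open>\<Gamma>\<close>\<close>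

text \<open>m is the leading coefficient as \<epsilon> tends to 0. It has to be uniform in \<alpha>
  and \<beta>, because passing to a section changes both.\<close>

definition potential_bound :: "nat \<Rightarrow> real \<Rightarrow> bool" where
  "potential_bound k m \<longleftrightarrow> (\<exists>e>0. \<exists>C\<ge>(0::real). \<exists>L\<ge>(0::real). \<forall>\<alpha>\<ge>0. \<forall>\<beta>\<ge>0. 0 < 1 - \<alpha> - \<beta> \<longrightarrow> 1 - \<alpha> - \<beta> \<le> e \<longrightarrow>
    (\<exists>\<Phi>. potential \<alpha> \<beta> (cost k) \<Phi> \<and> (\<forall>g\<in>carrier Gamma.
      \<Phi> g \<le> m / (1 - \<alpha> - \<beta>)\<^sup>2 + (C + L * wlen g) / (1 - \<alpha> - \<beta>))))"

lemma potential_bound_0: "potential_bound 0 1"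
proof -
  have main: "\<exists>\<Phi>. potential \<alpha> \<beta> (cost 0) \<Phi> \<and> (\<forall>g\<in>carrier Gamma.
      \<Phi> g \<le> 1 / (1 - \<alpha> - \<beta>)\<^sup>2 + (0 + 1 * real (wlen g)) / (1 - \<alpha> - \<beta>))"
    if "0 \<le> \<alpha>" "0 \<le> \<beta>" "0 < 1 - \<alpha> - \<beta>" for \<alpha> \<beta>
    by (rule exI, rule conjI[OF potential_0[OF that(1,2) refl that(3)]]) (simp add: add_divide_distrib)
  show ?thesis
    unfolding potential_bound_def
    by (rule exI[of _ 1], rule conjI, simp, rule exI[of _ 0], rule conjI, simp, rule exI[of _ 1], rule conjI, simp)
      (use main in blast)
qed

text \<open>Since \<open>\<alpha>\<close> and \<open>\<alpha>'\<close> cannot both be small, at least one of two consecutive steps contracts.\<close>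

lemma induced_parameters:
  fixes \<alpha> \<beta> :: real
  assumes "0 \<le> \<alpha>" "0 \<le> \<beta>" and \<epsilon>: "\<epsilon> = 1 - \<alpha> - \<beta>" "0 < \<epsilon>"
    and E: "E = \<alpha>\<^sup>2 / (1 - \<beta>)" and \<alpha>': "\<alpha>' = \<beta> / (1 - E / 2)" and \<beta>': "\<beta>' = (E / 2) / (1 - E / 2)"
  shows "0 \<le> E" "E \<le> 1" "0 \<le> \<alpha>'" "0 \<le> \<beta>'" "\<beta> \<le> \<alpha>'"
    "0 < 1 - \<alpha>' - \<beta>'" "1 - \<alpha>' - \<beta>' \<le> 4 * \<epsilon>"
    "\<lbrakk>1 / 3 \<le> \<alpha>; \<epsilon> \<le> 1 / 6\<rbrakk> \<Longrightarrow> 1 - E / 2 \<le> 8 / 9"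
proof -
  define q D where "q = 1 - \<beta>" and "D = 1 - E / 2"
  have q: "q = \<alpha> + \<epsilon>" "0 < q" "q \<le> 1" using assms by (auto simp: q_def)
  have E_q: "E = \<alpha>\<^sup>2 / q" by (simp add: E q_def)
  then show "0 \<le> E" using q by simp
  have "\<alpha> * \<alpha> \<le> q * 1" using q assms by (intro mult_mono) auto
  then show "E \<le> 1" using q by (simp add: E_q power2_eq_square divide_le_eq)
  then have D: "1 / 2 \<le> D" "D \<le> 1" using \<open>0 \<le> E\<close> by (auto simp: D_def)
  note \<alpha>' = \<alpha>'[folded D_def] and \<beta>' = \<beta>'[folded D_def]
  show "0 \<le> \<alpha>'" "0 \<le> \<beta>'" using D assms \<open>0 \<le> E\<close> by (simp_all add: \<alpha>' \<beta>')
  have "\<beta> * D \<le> \<beta> * 1" using D assms by (intro mult_left_mono) auto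
  then show "\<beta> \<le> \<alpha>'" using D by (simp add: \<alpha>' pos_le_divide_eq)
  \<comment> \<open>A difference of squares, q^2 - \<alpha>^2. It gives q - E \<le> 2 \<epsilon>,
    and D \<ge> 1 / 2 accounts for the remaining factor 2 in 4 \<epsilon>.\<close>
  have qE: "q * (q - E) = \<epsilon> * (q + \<alpha>)"
  proof -
    have "q * E = \<alpha> * \<alpha>" using q(2) by (simp add: E_q power2_eq_square)
    then show ?thesis using q(1) by (simp add: algebra_simps)
  qed
  have "(1 - \<alpha>' - \<beta>') * D = D - \<alpha>' * D - \<beta>' * D" by (simp add: algebra_simps)
  also have "\<dots> = q - E" using D by (simp add: \<alpha>' \<beta>' q_def) (simp add: D_def)
  finally have e': "(1 - \<alpha>' - \<beta>') * D = q - E" .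
  have "0 < \<epsilon> * (q + \<alpha>)" using \<epsilon> q assms by (intro mult_pos_pos) auto
  then have "0 < q - E" using qE q(2) by (metis zero_less_mult_pos)
  then show "0 < 1 - \<alpha>' - \<beta>'" using e' D by (metis zero_less_mult_pos2 less_le_trans half_gt_zero zero_less_one)
  define y where "y = 1 - \<alpha>' - \<beta>'"
  have "\<epsilon> * (q + \<alpha>) \<le> \<epsilon> * (2 * q)" using \<epsilon> q assms by (intro mult_left_mono) auto
  then have "q * (q - E) \<le> q * (2 * \<epsilon>)" using qE by (simp add: algebra_simps)
  then have "q - E \<le> 2 * \<epsilon>" using q(2) by simp
  then have "y * D \<le> 2 * \<epsilon>" using e' by (simp add: y_def)
  moreover have "y * (1 / 2) \<le> y * D"
    using D \<open>0 < 1 - \<alpha>' - \<beta>'\<close> by (intro mult_left_mono) (auto simp: y_def)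
  ultimately have "y \<le> 4 * \<epsilon>" by linarith
  then show "1 - \<alpha>' - \<beta>' \<le> 4 * \<epsilon>" by (simp add: y_def)
  assume a: "1 / 3 \<le> \<alpha>" "\<epsilon> \<le> 1 / 6"
  \<comment> \<open>Here \<epsilon> \<le> \<alpha> / 2, so q \<le> 3 \<alpha> / 2 and \<alpha>^2
    \<ge> \<alpha> / 3 \<ge> 2 q / 9. Thus E \<ge> 2 / 9, which is the origin of 8 / 9.\<close>
  have "1 / 3 * \<alpha> \<le> \<alpha> * \<alpha>" using a by (intro mult_right_mono) auto
  then have "2 / 9 * q \<le> \<alpha>\<^sup>2" using a q(1) unfolding power2_eq_square by linarith
  then have "2 / 9 \<le> E" using q by (simp add: E_q pos_le_divide_eq)
  then show "1 - E / 2 \<le> 8 / 9" by simp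
qed

lemma potential_bound_Suc_Suc:
  assumes "potential_bound k m" "0 \<le> m"
  shows "potential_bound (Suc (Suc k)) (8 / 9 * m)"
proof -
  obtain e C L :: real where e: "0 < e" "0 \<le> C" "0 \<le> L" and IH: "\<And>\<alpha> \<beta>. 0 \<le> \<alpha> \<Longrightarrow> 0 \<le> \<beta> \<Longrightarrow> 0 < 1 - \<alpha> - \<beta> \<Longrightarrow> 1 - \<alpha> - \<beta> \<le> e \<Longrightarrow>
    \<exists>\<Phi>. potential \<alpha> \<beta> (cost k) \<Phi> \<and> (\<forall>g\<in>carrier Gamma.
      \<Phi> g \<le> m / (1 - \<alpha> - \<beta>)\<^sup>2 + (C + L * wlen g) / (1 - \<alpha> - \<beta>))"
    using assms(1) unfolding potential_bound_def by auto
  define C' L' where "C' = 2 * C + L + 2" and "L' = 2 * L + 1"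
  have CL': "0 \<le> C'" "0 \<le> L'" using e by (auto simp: C'_def L'_def)
  \<comment> \<open>One passage to a section enlarges \<epsilon> at most fourfold. Two passages
    account for 16, and 1 / 24 keeps the value after one passage within the 1 / 6 of
    \<open>induced_parameters\<close>.\<close>
  define e' where "e' = min (e / 16) (1 / 24)"
  have e': "0 < e'" "16 * e' \<le> e" "e' \<le> 1 / 24" using e by (auto simp: e'_def)
  have "\<exists>\<Phi>. potential \<alpha> \<beta> (cost (Suc (Suc k))) \<Phi> \<and> (\<forall>g\<in>carrier Gamma. \<Phi> g \<le> 8 / 9 * m / (1 - \<alpha> - \<beta>)\<^sup>2 +
      ((2 * C' + L' + 2) + (2 * L' + 1) * wlen g) / (1 - \<alpha> - \<beta>))"
    if ab: "0 \<le> \<alpha>" "0 \<le> \<beta>" "0 < 1 - \<alpha> - \<beta>" "1 - \<alpha> - \<beta> \<le> e'" for \<alpha> \<beta>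
  proof -
    define E where "E = \<alpha>\<^sup>2 / (1 - \<beta>)"
    define \<alpha>1 \<beta>1 where "\<alpha>1 = \<beta> / (1 - E / 2)" and "\<beta>1 = (E / 2) / (1 - E / 2)"
    define E1 where "E1 = \<alpha>1\<^sup>2 / (1 - \<beta>1)"
    define \<alpha>2 \<beta>2 where "\<alpha>2 = \<beta>1 / (1 - E1 / 2)" and "\<beta>2 = (E1 / 2) / (1 - E1 / 2)"
    note p1 = induced_parameters[OF ab(1,2) refl ab(3) E_def \<alpha>1_def \<beta>1_def]
    note p2 = induced_parameters[OF p1(3,4) refl p1(6) E1_def \<alpha>2_def \<beta>2_def]
    have "1 - \<alpha>2 - \<beta>2 \<le> 4 * (1 - \<alpha>1 - \<beta>1)" by (rule p2(7))
    also have "\<dots> \<le> 4 * (4 * (1 - \<alpha> - \<beta>))" by (rule mult_left_mono[OF p1(7)]) simp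
    also have "\<dots> \<le> 4 * (4 * e')" using ab(4) by (intro mult_left_mono) auto
    also have "\<dots> \<le> e" using e'(2) by simp
    finally obtain \<Phi>2 where "potential \<alpha>2 \<beta>2 (cost k) \<Phi>2"
      "\<And>g. g \<in> carrier Gamma \<Longrightarrow> \<Phi>2 g \<le> m / (1 - \<alpha>2 - \<beta>2)\<^sup>2 + (C + L * wlen g) / (1 - \<alpha>2 - \<beta>2)"
      using IH[OF p2(3,4,6)] by blast
    from potential_Suc[OF p1(3,4) refl p1(6) E1_def \<alpha>2_def \<beta>2_def refl assms(2) e(2,3) this]
    obtain \<Phi>1 where \<Phi>1: "potential \<alpha>1 \<beta>1 (cost (Suc k)) \<Phi>1"
      "\<And>g. g \<in> carrier Gamma \<Longrightarrow> \<Phi>1 g \<le> (1 - E1 / 2) * m / (1 - \<alpha>1 - \<beta>1)\<^sup>2 + (C' + L' * wlen g) / (1 - \<alpha>1 - \<beta>1)"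
      unfolding C'_def L'_def by blast
    have m1: "0 \<le> (1 - E1 / 2) * m" using assms(2) p2(2) by simp
    from potential_Suc[OF ab(1,2) refl ab(3) E_def \<alpha>1_def \<beta>1_def refl m1 CL' \<Phi>1]
    obtain \<Phi> where \<Phi>: "potential \<alpha> \<beta> (cost (Suc (Suc k))) \<Phi>"
      "\<And>g. g \<in> carrier Gamma \<Longrightarrow> \<Phi> g \<le> (1 - E / 2) * ((1 - E1 / 2) * m) / (1 - \<alpha> - \<beta>)\<^sup>2 +
        ((2 * C' + L' + 2) + (2 * L' + 1) * wlen g) / (1 - \<alpha> - \<beta>)" by blast
    have "(1 - E / 2) * (1 - E1 / 2) \<le> 8 / 9"
    proof (cases "1 / 3 \<le> \<alpha>")
      case True
      then have "1 - E / 2 \<le> 8 / 9" using p1(8) ab(4) e'(3) by simp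
      then have "(1 - E / 2) * (1 - E1 / 2) \<le> 8 / 9 * 1" using p1(2) p2(1,2) by (intro mult_mono) auto
      then show ?thesis by simp
    next
      case False
      then have "1 / 3 \<le> \<alpha>1" using p1(5) ab(4) e'(3) by linarith
      then have "1 - E1 / 2 \<le> 8 / 9" using p2(8) p1(7) ab(4) e'(3) by simp
      then have "(1 - E / 2) * (1 - E1 / 2) \<le> 1 * (8 / 9)" using p1(1,2) p2(2) by (intro mult_mono) auto
      then show ?thesis by simp
    qed
    then have "(1 - E / 2) * (1 - E1 / 2) * m / (1 - \<alpha> - \<beta>)\<^sup>2 \<le> 8 / 9 * m / (1 - \<alpha> - \<beta>)\<^sup>2"
      using assms(2) by (intro divide_right_mono mult_right_mono) auto
    then have "\<Phi> g \<le> 8 / 9 * m / (1 - \<alpha> - \<beta>)\<^sup>2 + ((2 * C' + L' + 2) + (2 * L' + 1) * wlen g) / (1 - \<alpha> - \<beta>)"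
      if "g \<in> carrier Gamma" for g
      using \<Phi>(2)[OF that] by (simp only: mult.assoc[symmetric])
    then show ?thesis using \<Phi>(1) by blast
  qed
  moreover have "0 \<le> 2 * C' + L' + 2" "0 \<le> 2 * L' + 1" using CL' by auto
  ultimately show ?thesis using e'(1) unfolding potential_bound_def by blast
qed

lemma potential_bound_small: "c > 0 \<Longrightarrow> \<exists>k m. 0 \<le> m \<and> m \<le> c \<and> potential_bound k m"
proof -
  assume "c > 0"
  then obtain n where "(8 / 9 :: real) ^ n < c" using real_arch_pow_inv[of c "8 / 9"] by auto
  moreover have "potential_bound (2 * n) ((8 / 9) ^ n)" for n
  proof (induction n)
    case (Suc n)
    then show ?case using potential_bound_Suc_Suc[of "2 * n" "(8 / 9) ^ n"] by simp
  qed (simp add: potential_bound_0)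
  ultimately show ?thesis by (intro exI[of _ "2 * n"] exI[of _ "(8 / 9) ^ n"]) auto
qed

section \<open>The lazy simple random walk on \<Gamma>\<close>

definition walk_step :: "(ab \<times> bool) option \<Rightarrow> digit list \<Rightarrow> digit list" where
  "walk_step j = (case j of None \<Rightarrow> id | Some l \<Rightarrow> lact l)"

lemma UNIV_letters: "(UNIV :: (ab \<times> bool) option set) =
    {None, Some (La, True), Some (La, False), Some (Lb, True), Some (Lb, False)}"
proof -
  have "x \<in> {None, Some (La, True), Some (La, False), Some (Lb, True), Some (Lb, False)}" for x
    by (cases x; cases "fst (the x)"; cases "snd (the x)") (auto simp: prod_eq_iff)
  then show ?thesis by blast
qed

interpretation walk: random_walk Gamma "UNIV :: (ab \<times> bool) option set" walk_step
proof unfold_locales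
  show "finite (UNIV :: (ab \<times> bool) option set)" unfolding UNIV_letters by simp
  fix j have "walk_step j = act (case j of None \<Rightarrow> [] | Some l \<Rightarrow> [l])"
    by (auto simp: walk_step_def split: option.splits)
  then show "walk_step j \<in> carrier Gamma" by simp
qed simp

lemma walk_P: "walk.P f g = (f g + (f (aut_a \<circ> g) + f (inv_a \<circ> g)) + (f (aut_b \<circ> g) + f (inv_b \<circ> g))) / 5"
proof -
  have sum: "(\<Sum>j\<in>UNIV. F j) = F None + (F (Some (La, True)) + F (Some (La, False))) +
      (F (Some (Lb, True)) + F (Some (Lb, False)))" for F :: "(ab \<times> bool) option \<Rightarrow> real"
    unfolding UNIV_letters by simp
  have "card (UNIV :: (ab \<times> bool) option set) = 5" unfolding UNIV_letters by simp
  then show ?thesis by (simp add: walk.P_def sum walk_step_def)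
qed

text \<open>A discounted sum with discount 1 - 1 / (2 N) dominates a fixed fraction of the sum over
  n < N. The 10 is 5 / 2, from the factor 2 / 5 lost on the way, times the 4 from 1 / \<epsilon>
  \<le> 2 N.\<close>

lemma walk_cost:
  assumes "potential_bound k m" "0 \<le> m"
  shows "\<exists>C. \<forall>N. (\<Sum>n<N. walk.E n (cost k)) \<le> 10 * m * (real N)\<^sup>2 + C * real N"
proof -
  obtain e C L :: real where e: "0 < e" "0 \<le> C" "0 \<le> L" and pot: "\<And>\<alpha> \<beta>. 0 \<le> \<alpha> \<Longrightarrow> 0 \<le> \<beta> \<Longrightarrow> 0 < 1 - \<alpha> - \<beta> \<Longrightarrow> 1 - \<alpha> - \<beta> \<le> e \<Longrightarrow>
    \<exists>\<Phi>. potential \<alpha> \<beta> (cost k) \<Phi> \<and> (\<forall>g\<in>carrier Gamma.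
      \<Phi> g \<le> m / (1 - \<alpha> - \<beta>)\<^sup>2 + (C + L * wlen g) / (1 - \<alpha> - \<beta>))"
    using assms(1) unfolding potential_bound_def by auto
  obtain N0 :: nat where N0: "1 / e < N0" using reals_Archimedean2 by blast
  have E_nonneg: "0 \<le> walk.E n (cost k)" for n
    unfolding walk.E_def by (intro sum_nonneg mult_nonneg_nonneg) auto
  have large: "(\<Sum>n<N. walk.E n (cost k)) \<le> 10 * m * (real N)\<^sup>2 + 5 * C * real N" if N: "N0 \<le> N" for N
  proof -
    have "0 < 1 / e" using e by simp
    then have N_pos: "0 < real N" using N0 N by linarith
    then have N_e: "1 / real N \<le> e" using N0 N e(1) by (simp add: field_simps) (smt (verit) mult_left_mono of_nat_mono)
    define s where "s = 1 - 1 / (2 * real N)"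
    have "1 \<le> real N" using N_pos by simp
    then have "1 / (2 * real N) \<le> 1 / 2" by simp
    then have s: "1 / 2 \<le> s" "s < 1" using N_pos by (auto simp: s_def)
    \<comment> \<open>Eliminating the idle step, of discounted weight s / 5, leaves a killed walk in
      which the letters a and the letters b have this same weight. Its killing rate lies between 1 /
      (2 N) and 1 / N.\<close>
    define \<alpha> where "\<alpha> = s * (2 / 5) / (1 - s / 5)"
    have \<alpha>: "0 \<le> \<alpha>" using s by (simp add: \<alpha>_def)
    define \<epsilon> where "\<epsilon> = 1 - \<alpha> - \<alpha>"
    have "1 - s / 5 \<noteq> 0" using s by simp
    from nonzero_divide_eq_eq[OF this] have \<alpha>s: "\<alpha> * (1 - s / 5) = s * (2 / 5)" unfolding \<alpha>_def by metis
    have \<epsilon>_eq: "\<epsilon> = (1 - s) / (1 - s / 5)"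
    proof -
      have "\<epsilon> * (1 - s / 5) = 1 - s" using \<alpha>s unfolding \<epsilon>_def left_diff_distrib by simp
      then show ?thesis using s by (simp add: eq_divide_eq)
    qed
    have "\<epsilon> \<le> (1 - s) / (1 / 2)" unfolding \<epsilon>_eq using s by (intro divide_left_mono) auto
    also have "\<dots> = 1 / real N" by (simp add: s_def)
    finally have \<epsilon>_e: "\<epsilon> \<le> e" using N_e by linarith
    have "(1 - s) / 1 \<le> (1 - s) / (1 - s / 5)" using s by (intro divide_left_mono) auto
    then have \<epsilon>_ge: "1 / (2 * real N) \<le> \<epsilon>" by (simp add: \<epsilon>_eq s_def)
    have \<epsilon>_pos: "0 < \<epsilon>" using \<epsilon>_ge N_pos by (smt (verit) divide_pos_pos)
    then have inv_\<epsilon>: "1 / \<epsilon> \<le> 2 * real N" using \<epsilon>_ge N_pos by (simp add: field_simps)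
    obtain \<Phi> where \<Phi>: "potential \<alpha> \<alpha> (cost k) \<Phi>" and bound: "\<And>g. g \<in> carrier Gamma \<Longrightarrow> \<Phi> g \<le> m / \<epsilon>\<^sup>2 + (C + L * wlen g) / \<epsilon>"
      using pot[OF \<alpha> \<alpha>] \<epsilon>_pos \<epsilon>_e unfolding \<epsilon>_def by blast
    have "(\<Sum>n<N. s ^ n * walk.E n (\<lambda>g. 4 / 5 * cost k g)) \<le> \<Phi> \<one>\<^bsub>Gamma\<^esub>"
    proof (rule walk.discounted_sum_le)
      show "0 \<le> s" using s by simp
      fix g assume g: "g \<in> carrier Gamma"
      show "0 \<le> \<Phi> g" using \<Phi> g by (simp add: potential_def)
      define S where "S = (\<Phi> (aut_a \<circ> g) + \<Phi> (inv_a \<circ> g)) + (\<Phi> (aut_b \<circ> g) + \<Phi> (inv_b \<circ> g))"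
      have "cost k g + \<alpha> / 2 * S \<le> \<Phi> g" using \<Phi> g by (simp add: potential_def step_def S_def distrib_left)
      then have "(1 - s / 5) * (cost k g + \<alpha> / 2 * S) \<le> (1 - s / 5) * \<Phi> g" using s by (intro mult_left_mono) auto
      moreover have "(1 - s / 5) * \<alpha> = s * (2 / 5)" using \<alpha>s by (simp only: mult.commute)
      then have "(1 - s / 5) * (cost k g + \<alpha> / 2 * S) = (1 - s / 5) * cost k g + s / 5 * S"
        by (simp add: distrib_left mult.assoc[symmetric])
      moreover have "4 / 5 * cost k g \<le> (1 - s / 5) * cost k g" using s by (intro mult_right_mono) auto
      moreover have "s * walk.P \<Phi> g = s / 5 * \<Phi> g + s / 5 * S"
        by (simp add: walk_P S_def algebra_simps)
      moreover have "(1 - s / 5) * \<Phi> g = \<Phi> g - s / 5 * \<Phi> g" by (simp add: left_diff_distrib)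
      ultimately show "4 / 5 * cost k g + s * walk.P \<Phi> g \<le> \<Phi> g" by linarith
    qed
    also have "\<dots> \<le> m / \<epsilon>\<^sup>2 + C / \<epsilon>" using bound[of id] wlen_id act_in_Gamma[of "[]"] by simp
    also have "\<dots> \<le> m * (2 * real N)\<^sup>2 + C * (2 * real N)"
    proof -
      have "m * (1 / \<epsilon>)\<^sup>2 \<le> m * (2 * real N)\<^sup>2"
        using inv_\<epsilon> \<epsilon>_pos assms(2) by (intro mult_left_mono power_mono) auto
      moreover have "C * (1 / \<epsilon>) \<le> C * (2 * real N)" using inv_\<epsilon> e(2) by (rule mult_left_mono)
      ultimately show ?thesis by (simp add: power_one_over)
    qed
    finally have 1: "(\<Sum>n<N. s ^ n * walk.E n (\<lambda>g. 4 / 5 * cost k g)) \<le> m * (2 * real N)\<^sup>2 + C * (2 * real N)" .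
    have "2 / 5 * walk.E n (cost k) \<le> s ^ n * walk.E n (\<lambda>g. 4 / 5 * cost k g)" if n: "n < N" for n
    proof -
      \<comment> \<open>Bernoulli's inequality keeps s^n at least 1 / 2 for n < N.\<close>
      have "1 + real n * (- (1 / (2 * real N))) \<le> (1 + - (1 / (2 * real N))) ^ n"
        using \<open>1 / (2 * real N) \<le> 1 / 2\<close> by (intro Bernoulli_inequality) simp
      moreover have "real n * (1 / (2 * real N)) \<le> 1 / 2" using n by (simp add: field_simps)
      ultimately have "1 / 2 \<le> s ^ n" by (simp add: s_def)
      then have "1 / 2 * (4 / 5 * walk.E n (cost k)) \<le> s ^ n * (4 / 5 * walk.E n (cost k))"
        using E_nonneg by (intro mult_right_mono) auto
      moreover have eq: "walk.E n (\<lambda>g. 4 / 5 * cost k g) = 4 / 5 * walk.E n (cost k)"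
        by (simp add: walk.E_def sum_distrib_left mult.left_commute)
      ultimately show ?thesis unfolding eq by linarith
    qed
    then have "(\<Sum>n<N. 2 / 5 * walk.E n (cost k)) \<le> (\<Sum>n<N. s ^ n * walk.E n (\<lambda>g. 4 / 5 * cost k g))"
      by (intro sum_mono) simp
    then have "2 / 5 * (\<Sum>n<N. walk.E n (cost k)) \<le> m * (2 * real N)\<^sup>2 + C * (2 * real N)"
      using 1 by (simp only: sum_distrib_left[symmetric])
    then show ?thesis by (simp add: power_mult_distrib)
  qed
  define C0 where "C0 = (\<Sum>n<N0. walk.E n (cost k))"
  have C0: "0 \<le> C0" unfolding C0_def by (intro sum_nonneg E_nonneg)
  have "(\<Sum>n<N. walk.E n (cost k)) \<le> 10 * m * (real N)\<^sup>2 + (5 * C + C0) * real N" for N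
  proof (cases "N0 \<le> N")
    case True
    then show ?thesis using large[OF True] mult_nonneg_nonneg[OF C0, of "real N"] by (simp add: distrib_right)
  next
    case False
    then have "(\<Sum>n<N. walk.E n (cost k)) \<le> C0"
      unfolding C0_def using E_nonneg by (intro sum_mono2) auto
    moreover have "C0 \<le> C0 * real N" if "N > 0" using mult_left_mono[of 1 "real N" C0] C0 that by simp
    moreover have "0 \<le> 10 * m * (real N)\<^sup>2" "0 \<le> 5 * C * real N" using assms(2) e(2) by auto
    ultimately show ?thesis by (cases "N = 0") (auto simp: distrib_right)
  qed
  then show ?thesis by blast
qed

theorem amenable_Gamma: "amenable Gamma"
proof (rule walk.amenable_of_entropy)
  show "walk_step None = \<one>\<^bsub>Gamma\<^esub>" by (simp add: walk_step_def)
  have "{aut_a, aut_b} \<subseteq> range walk_step"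
    using rangeI[of walk_step "Some (La, True)"] rangeI[of walk_step "Some (Lb, True)"] by (simp add: walk_step_def)
  moreover have "range walk_step \<subseteq> carrier Gamma" using walk.st by blast
  ultimately show "generate Gamma (range walk_step) = carrier Gamma"
    using Gam.mono_generate[of "{aut_a, aut_b}" "range walk_step"] Gam.generate_in_carrier[of "range walk_step"]
    unfolding generate_Gamma by blast
  fix c :: real assume c: "c > 0"
  have ln8: "0 < ln (8 :: real)" by simp
  \<comment> \<open>10 is the constant of \<open>walk_cost\<close>, and ln 8 that of the partition
    function, which \<open>exp_cost_bounded\<close> keeps bounded on all finite sets.\<close>
  obtain k m where m: "0 \<le> m" "m \<le> c / (10 * ln 8)" "potential_bound k m"
    using potential_bound_small[of "c / (10 * ln 8)"] c ln8 by (metis divide_pos_pos mult_pos_pos zero_less_numeral)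
  obtain C where C: "\<And>N. (\<Sum>n<N. walk.E n (cost k)) \<le> 10 * m * (real N)\<^sup>2 + C * real N"
    using walk_cost[OF m(3,1)] by blast
  obtain Z where Z: "\<And>U. finite U \<Longrightarrow> U \<subseteq> carrier Gamma \<Longrightarrow> (\<Sum>g\<in>U. exp (- (ln 8 * cost k g))) \<le> Z"
    using exp_cost_bounded[of k] by blast
  have H: "walk.H n \<le> ln 8 * walk.E n (cost k) + ln Z" for n
    by (rule walk.entropy_le[OF Z[OF walk.finite_B walk.B_closed]])
  have "(\<Sum>n<N. walk.H n) \<le> c * (real N)\<^sup>2 + (ln 8 * C + ln Z) * real N" for N
  proof -
    have "(\<Sum>n<N. walk.H n) \<le> (\<Sum>n<N. ln 8 * walk.E n (cost k) + ln Z)" by (intro sum_mono H)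
    also have "\<dots> = ln 8 * (\<Sum>n<N. walk.E n (cost k)) + real N * ln Z"
      by (simp add: sum.distrib sum_distrib_left)
    also have "ln 8 * (\<Sum>n<N. walk.E n (cost k)) \<le> ln 8 * (10 * m * (real N)\<^sup>2 + C * real N)"
      using C ln8 by (intro mult_left_mono) auto
    also have "\<dots> = (10 * ln 8 * m) * (real N)\<^sup>2 + ln 8 * C * real N" by (simp add: algebra_simps)
    also have "(10 * ln 8 * m) * (real N)\<^sup>2 \<le> c * (real N)\<^sup>2"
      using m(2) ln8 by (intro mult_right_mono) (auto simp: pos_le_divide_eq mult.commute mult.left_commute)
    finally show ?thesis by (simp add: algebra_simps)
  qed
  then show "\<exists>C. \<forall>N. (\<Sum>n<N. walk.H n) \<le> c * (real N)\<^sup>2 + C * real N" by blast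
qed simp_all

theorem theorem2p4:
  shows "(\<exists>\<sigma> \<in> mon Gamma Gamma. \<sigma> aut_a = aut_b \<and> \<sigma> aut_b = aut_a [^]\<^bsub>Gamma\<^esub> (2::nat) \<and>
            Delta = hnn_extension Gamma (carrier Gamma) \<sigma>)
    \<and> amenable Gamma \<and> amenable Delta
    \<and> \<not> in_BG TYPE('u) Gamma \<and> \<not> in_BG TYPE('u) Delta
    \<and> \<not> finitely_presented Gamma
    \<and> finite_presentation {Gen_b, Gen_t} bt_relators
    \<and> balanced_presentation {Gen_b, Gen_t} bt_relators
    \<and> (\<exists>\<phi> \<in> iso (presented_group {Gen_b, Gen_t} bt_relators) Delta.
         \<phi> (presented_gen {Gen_b, Gen_t} bt_relators Gen_b) = Delta_of_Gamma aut_b \<and>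
         \<phi> (presented_gen {Gen_b, Gen_t} bt_relators Gen_t) = Delta_t)"
proof (intro conjI)
  show "\<exists>\<sigma> \<in> mon Gamma Gamma. \<sigma> aut_a = aut_b \<and> \<sigma> aut_b = aut_a [^]\<^bsub>Gamma\<^esub> (2::nat) \<and>
      Delta = hnn_extension Gamma (carrier Gamma) \<sigma>"
    using sig_mon sig_gens Delta_eq_hnn by blast
  show "amenable Gamma" by (rule amenable_Gamma)
  then show "amenable Delta" by (rule amenable_Delta)
  show "\<not> in_BG TYPE('u) Gamma" by (rule not_in_BG[OF group_Gamma involves_Gamma_Gamma])
  show "\<not> in_BG TYPE('u) Delta" by (rule not_in_BG[OF group_Delta involves_Gamma_Delta])
  show "\<not> finitely_presented Gamma" by (rule not_finitely_presented_Gamma)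
  have "finite bt_relators" by (simp add: bt_relators_def Let_def)
  then show "finite_presentation {Gen_b, Gen_t} bt_relators"
    unfolding finite_presentation_def using bt_relators_closed by simp
  show "balanced_presentation {Gen_b, Gen_t} bt_relators"
    unfolding balanced_presentation_def by (rule card_bt_relators)
qed (rule presentation_iso)

end
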